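(* Let $g:\mathbb{N}\to\mathbb{N}_0$ be a non-decreasing genus function, let $\mathcal A^g$ be any one of $\mathcal E^g$, $\mathcal O\mathcal E^g$, $\mathcal N\mathcal E^g$ or $\mathcal O\mathcal E^g\cap\mathcal N\mathcal E^g$, let $\mathcal B=\mathrm{Minor}(\mathcal A^g)$, and let $R_n$ be uniformly random in $\mathcal B_n$. (a) If $\mathcal A^g$ contains all graphs, then $\ell(R_n)=0$ with very high probability. (b) If $\mathcal A^g$ does not contain all graphs, then for any $0<\varepsilon<1$, $\rho(\{G\in\mathcal B:\ \ell(G)\notin((1-\varepsilon)\rho(\mathcal B)v(G),(1+\varepsilon)\rho(\mathcal B)v(G))\})>\rho(\mathcal B)$.
   Context: All graphs are finite and simple. $\mathcal E^g$ is the class of graphs $G$ such that, if $G$ has $n$ vertices, $G$ embeds in some surface of Euler genus at most $g(n)$; $\mathcal O\mathcal E^g$ / $\mathcal N\mathcal E^g$ require the surface to be orientable / non-orientable. $\mathrm{Minor}(\mathcal A^g)$ is the class of graphs all of whose minors lie in $\mathcal A^g$; $\mathcal B_n$ is the set of graphs of $\mathcal B$ on vertex set $[n]$. $\ell(G)$ is the number of leaves (degree-1 vertices), $v(G)$ the number of vertices. For a class $\mathcal D$, $\rho(\mathcal D)$ is the radius of convergence of $\sum_n|\mathcal D_n|x^n/n!$. With very high probability means with probability $1-e^{-\Omega(n)}$.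
   Formalization: The sphere (Euler genus 0) is also counted as non-orientable, so planar graphs are allowed in NE^g at orders where g(n)=0; otherwise for g(1)=0 the class B would be empty and (b) false. For g(1)≥1 nothing changes. *)

theory Defs
  imports "HOL-Probability.Probability"
begin

section \<open>Graphs and minors\<close>

type_synonym 'v graph = "'v set \<times> 'v set set"

text \<open>The order of a graph is a positive integer, since genus functions are defined on
  \<open>1, 2, 3, \<dots>\<close>.\<close>

definition simple_graph :: "'v graph \<Rightarrow> bool" where
  "simple_graph G \<longleftrightarrow>
     finite (fst G) \<and> fst G \<noteq> {} \<and> snd G \<subseteq> {e. e \<subseteq> fst G \<and> card e = 2}"

definition num_vertices :: "'v graph \<Rightarrow> nat" where
  "num_vertices G = card (fst G)"

definition num_leaves :: "'v graph \<Rightarrow> nat" where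
  "num_leaves G = card {v \<in> fst G. card {e \<in> snd G. v \<in> e} = 1}"

text \<open>Contracting the edge \<open>{u, v}\<close> keeps the name \<open>u\<close> for the new vertex; loops and parallel
  edges are suppressed.\<close>

inductive minor_step :: "'v graph \<Rightarrow> 'v graph \<Rightarrow> bool" where
  delete_edge: "e \<in> E \<Longrightarrow> minor_step (V, E) (V, E - {e})"
| delete_vertex: "v \<in> V \<Longrightarrow> V \<noteq> {v} \<Longrightarrow> minor_step (V, E) (V - {v}, {e \<in> E. v \<notin> e})"
| contract_edge: "{u, v} \<in> E \<Longrightarrow> u \<noteq> v \<Longrightarrow>
    minor_step (V, E) (V - {v}, {e \<in> E. v \<notin> e} \<union> {{u, w} |w. {v, w} \<in> E \<and> w \<noteq> u})"

definition is_minor :: "'v graph \<Rightarrow> 'v graph \<Rightarrow> bool" where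
  "is_minor H G \<longleftrightarrow> minor_step\<^sup>*\<^sup>* G H"

section \<open>Surfaces\<close>

definition closed_surface :: "'a topology \<Rightarrow> bool" where
  "closed_surface S \<longleftrightarrow>
     compact_space S \<and> connected_space S \<and> Hausdorff_space S \<and>
     (\<forall>x \<in> topspace S. \<exists>U. openin S U \<and> x \<in> U \<and>
        subtopology S U homeomorphic_space (euclidean :: complex topology))"

text \<open>
  The closed discs with centre \<open>hole_centre j\<close> and radius \<open>hole_radius j\<close> are pairwise disjoint and
  contained in the open unit disc. The part of the unit sphere in \<open>complex \<times> real\<close> lying
  vertically above (or below) such a disc is a closed disc on the sphere.
\<close>

definition hole_centre :: "nat \<Rightarrow> complex" where
  "hole_centre j = of_real (1 / 2 ^ (j + 1))"

definition hole_radius :: "nat \<Rightarrow> real" where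
  "hole_radius j = 1 / 2 ^ (j + 3)"

text \<open>
  The sphere with \<open>h\<close> handles: remove the open discs above and below the first \<open>h\<close> holes, and
  attach each handle as a vertical tube joining the upper to the lower boundary circle. The tube is
  collapsed to the identification of \<open>(z, t)\<close> with \<open>(z, -t)\<close>, which reverses the induced boundary
  orientations, so that the result is orientable.
\<close>

definition handle_domain :: "nat \<Rightarrow> (complex \<times> real) set" where
  "handle_domain h = sphere 0 1 - {x. \<exists>j<h. fst x \<in> ball (hole_centre j) (hole_radius j)}"

definition handle_glued :: "nat \<Rightarrow> complex \<times> real \<Rightarrow> complex \<times> real \<Rightarrow> bool" where
  "handle_glued h x y \<longleftrightarrow>
     (\<exists>j<h. fst x \<in> sphere (hole_centre j) (hole_radius j) \<and> fst y = fst x \<and> snd y = - snd x)"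

definition sphere_with_handles :: "nat \<Rightarrow> 'a topology \<Rightarrow> bool" where
  "sphere_with_handles h S \<longleftrightarrow>
     (\<exists>q. quotient_map (top_of_set (handle_domain h)) S q \<and>
        (\<forall>x \<in> handle_domain h. \<forall>y \<in> handle_domain h. q x = q y \<longleftrightarrow> x = y \<or> handle_glued h x y))"

text \<open>
  The sphere with \<open>k\<close> crosscaps: remove only the open discs above the first \<open>k\<close> holes, and identify
  antipodal points (antipodal after projection to the plane) on each boundary circle.
\<close>

definition crosscap_domain :: "nat \<Rightarrow> (complex \<times> real) set" where
  "crosscap_domain k =
     sphere 0 1 - {x. snd x > 0 \<and> (\<exists>j<k. fst x \<in> ball (hole_centre j) (hole_radius j))}"

definition crosscap_glued :: "nat \<Rightarrow> complex \<times> real \<Rightarrow> complex \<times> real \<Rightarrow> bool" where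
  "crosscap_glued k x y \<longleftrightarrow>
     snd x > 0 \<and> snd y > 0 \<and>
     (\<exists>j<k. fst x \<in> sphere (hole_centre j) (hole_radius j) \<and> fst x + fst y = 2 * hole_centre j)"

definition sphere_with_crosscaps :: "nat \<Rightarrow> 'a topology \<Rightarrow> bool" where
  "sphere_with_crosscaps k S \<longleftrightarrow>
     (\<exists>q. quotient_map (top_of_set (crosscap_domain k)) S q \<and>
        (\<forall>x \<in> crosscap_domain k. \<forall>y \<in> crosscap_domain k.
           q x = q y \<longleftrightarrow> x = y \<or> crosscap_glued k x y))"

text \<open>
  The sphere with \<open>h\<close> handles has Euler genus \<open>2 * h\<close> and the sphere with \<open>k\<close> crosscaps has Euler
  genus \<open>k\<close>. By convention the sphere itself, being the sphere with no crosscaps, counts as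
  orientable and as non-orientable.
\<close>

definition orientable_surface :: "nat \<Rightarrow> 'a topology \<Rightarrow> bool" where
  "orientable_surface eg S \<longleftrightarrow> closed_surface S \<and> (\<exists>h. eg = 2 * h \<and> sphere_with_handles h S)"

definition nonorientable_surface :: "nat \<Rightarrow> 'a topology \<Rightarrow> bool" where
  "nonorientable_surface eg S \<longleftrightarrow> closed_surface S \<and> sphere_with_crosscaps eg S"

section \<open>Embeddings of graphs\<close>

text \<open>
  Vertices are distinct points, edges are simple arcs joining their end vertices, and the interior
  of an edge avoids all vertices and the interiors of all other edges.
\<close>

definition embeds_in :: "'v graph \<Rightarrow> 'a topology \<Rightarrow> bool" where
  "embeds_in G S \<longleftrightarrow>
     (\<exists>(p :: 'v \<Rightarrow> 'a) (\<gamma> :: 'v set \<Rightarrow> real \<Rightarrow> 'a).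
        p ` fst G \<subseteq> topspace S \<and> inj_on p (fst G) \<and>
        (\<forall>e \<in> snd G. pathin S (\<gamma> e) \<and> inj_on (\<gamma> e) {0..1} \<and>
           {\<gamma> e 0, \<gamma> e 1} = p ` e \<and> \<gamma> e ` {0<..<1} \<inter> p ` fst G = {}) \<and>
        (\<forall>e \<in> snd G. \<forall>e' \<in> snd G. e \<noteq> e' \<longrightarrow>
           \<gamma> e ` {0<..<1} \<inter> \<gamma> e' ` {0<..<1} = {}))"

section \<open>Classes of graphs\<close>

text \<open>Every closed surface has the cardinality of the continuum, so it has a homeomorphic copy whose
  points are of type \<open>complex \<times> real\<close>.\<close>

definition OE_class :: "(nat \<Rightarrow> nat) \<Rightarrow> nat graph set" where
  "OE_class g = {G. simple_graph G \<and>
     (\<exists>eg \<le> g (num_vertices G). \<exists>S :: (complex \<times> real) topology.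
        orientable_surface eg S \<and> embeds_in G S)}"

definition NE_class :: "(nat \<Rightarrow> nat) \<Rightarrow> nat graph set" where
  "NE_class g = {G. simple_graph G \<and>
     (\<exists>eg \<le> g (num_vertices G). \<exists>S :: (complex \<times> real) topology.
        nonorientable_surface eg S \<and> embeds_in G S)}"

definition E_class :: "(nat \<Rightarrow> nat) \<Rightarrow> nat graph set" where
  "E_class g = {G. simple_graph G \<and>
     (\<exists>eg \<le> g (num_vertices G). \<exists>S :: (complex \<times> real) topology.
        (orientable_surface eg S \<or> nonorientable_surface eg S) \<and> embeds_in G S)}"

definition Minor_class :: "nat graph set \<Rightarrow> nat graph set" where
  "Minor_class \<A> = {G. simple_graph G \<and> (\<forall>H. is_minor H G \<longrightarrow> H \<in> \<A>)}"

definition labelled :: "nat graph set \<Rightarrow> nat \<Rightarrow> nat graph set" where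
  "labelled \<D> n = {G \<in> \<D>. fst G = {1..n}}"

definition egf_radius :: "nat graph set \<Rightarrow> ereal" where
  "egf_radius \<D> = conv_radius (\<lambda>n. real (card (labelled \<D> n)) / fact n)"

end

theory Submission
  imports Defs "HOL-Real_Asymp.Real_Asymp"
begin

text \<open>
  A pendant edge can be attached at any vertex of an embedded graph without leaving the surface: in a
  disc round the vertex the edges form a star of arcs, and Janiszewski's theorem shows that the
  centre of the star is accessible from the complement. Hence \<open>\<B>\<close> is closed under adding and
  deleting leaves.

  Let \<open>b\<^sub>n\<close> be the number of graphs of \<open>\<B>\<close> on \<open>n\<close> labelled vertices divided by \<open>n!\<close>. Counting pairs of a
  graph and one of its leaves bounds \<open>k\<close> times the part of \<open>b\<^sub>n\<^sub>+\<^sub>1\<close> with at least \<open>k\<close> leaves by \<open>n\<close> times the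
  part of \<open>b\<^sub>n\<close> with at least \<open>k - 2\<close> leaves, and similarly for graphs with few leaves. Iterating a small
  multiple of \<open>n\<close> times and comparing with the exponential growth rate \<open>1 / \<rho>\<close> of \<open>b\<^sub>n\<close> gains an
  exponential factor as soon as the number of leaves deviates from \<open>\<rho> n\<close>. For the class of all
  graphs, \<open>b\<^sub>n / b\<^sub>n\<^sub>+\<^sub>1\<close> is exponentially small and the same count shows that there are no leaves.

  This needs \<open>0 < \<rho> < \<infinity>\<close>. The lower bound is the theorem of Norine, Seymour, Thomas and Wollan that a
  proper minor-closed class is small. By Mader, its graphs have at most \<open>d n\<close> edges. Either there is a
  matching of linear size; contracting it leaves only exponentially many graphs with a given result,
  because the result has few edges. Or all but few vertices form an independent set. Contract
  vertices of this set into the rest as long as this creates new edges; afterwards the remaining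
  neighbourhoods are cliques, of which there are few, so there are linearly many twins to delete.
\<close>

section \<open>Accessible points in the plane\<close>

text \<open>Edges of an embedding are arbitrary simple arcs: they may spiral infinitely often round
  a vertex and re-enter a chart disc, so there is no direction in which a new edge can simply be
  drawn. This is why accessibility of the vertex has to be proved.

  The class \<open>\<A>\<close> need not be minor-closed, since losing a vertex can lower the genus
  allowance. It is shown to be stable under adding a leaf, deleting an edge and renaming; the
  closure of \<open>\<B>\<close> under adding leaves is derived from this by following all minors of
  the extended graph.

  The comparison with the growth rate rests on upper bounds \<open>K * (t / r) ^ n\<close>,
  available for every \<open>t > 1\<close>. Each of about \<open>\<delta> * N\<close> steps gains a
  fixed factor \<open>q < 1\<close>, while \<open>t\<close> costs at most
  \<open>t ^ (2 * N)\<close>; as \<open>t\<close> is chosen after \<open>q\<close> and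
  \<open>\<delta>\<close>, half of the gain survives.

  For smallness, one reduction may cost a factor exponential in \<open>n\<close>, provided that it
  removes a fixed fraction of the vertices: this is a bounded factor for each removed
  vertex.\<close>

lemma infinite_path_concatenation:
  fixes l :: "'a::metric_space"
  assumes p: "\<And>n. path (p n)"
    and join: "\<And>n. pathfinish (p n) = pathstart (p (Suc n))"
    and lim: "\<And>\<epsilon>. \<epsilon> > 0 \<Longrightarrow> \<exists>N. \<forall>n\<ge>N. path_image (p n) \<subseteq> ball l \<epsilon>"
  obtains g where "path g" "pathstart g = pathstart (p 0)" "pathfinish g = l"
    "path_image g \<subseteq> insert l (\<Union>n. path_image (p n))"
proof -
  \<comment> \<open>On the half line, \<open>p n\<close> is traversed during the interval from
    \<open>n\<close> to \<open>n + 1\<close>.\<close>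
  define h where "h t = p (nat \<lfloor>t\<rfloor>) (t - \<lfloor>t\<rfloor>)" for t :: real
  have h_eq: "h t = p n (t - real n)" if "t \<in> {real n..real n + 1}" for t n
  proof (cases "t = real n + 1")
    case True
    then have "h t = p (Suc n) 0"
      by (simp add: h_def nat_add_distrib)
    then show ?thesis
      using join[of n] True by (simp add: pathstart_def pathfinish_def)
  next
    case False
    with that have "\<lfloor>t\<rfloor> = int n"
      by (intro floor_unique) auto
    then show ?thesis
      by (simp add: h_def)
  qed
  have cont_piece: "continuous_on {real n..real n + 1} h" for n
  proof -
    have "continuous_on {real n..real n + 1} (\<lambda>t. p n (t - real n))"
      using p[of n] unfolding path_def
      by (rule continuous_on_compose2[of "{0..1}" "p n"]) (auto intro!: continuous_intros)
    then show ?thesis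
      by (rule continuous_on_eq) (metis h_eq)
  qed
  have cont_n: "continuous_on {0..real n} h" for n
  proof (induction n)
    case (Suc n)
    have "{0..real (Suc n)} = {0..real n} \<union> {real n..real n + 1}"
      by auto
    then show ?case
      using continuous_on_closed_Un[OF closed_atLeastAtMost closed_atLeastAtMost Suc.IH cont_piece] by simp
  qed auto
  have cont_h: "continuous_on {0..} h"
  proof (unfold continuous_on_eq_continuous_within, intro ballI)
    fix t :: real assume t: "t \<in> {0..}"
    obtain n where n: "t < real n"
      using reals_Archimedean2 by blast
    have "continuous (at t within {0..real n}) h"
      using cont_n[of n] t n by (auto simp: continuous_on_eq_continuous_within)
    moreover have "at t within {0..real n} = at t within {0..}"
      by (rule at_within_nhd[of _ "{..<real n}"]) (use n in auto)
    ultimately show "continuous (at t within {0..}) h"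
      by simp
  qed
  \<comment> \<open>The map \<open>s / (1 - s)\<close> compresses the half line to
    \<open>[0, 1)\<close>; the shrinking images of the \<open>p n\<close> give continuity at
    1.\<close>
  define g where "g s = (if s = 1 then l else h (s / (1 - s)))" for s :: real
  have h_im: "\<exists>n. real n \<le> t \<and> t < real n + 1 \<and> h t \<in> path_image (p n)" if "t \<ge> 0" for t
  proof (intro exI conjI)
    show "real (nat \<lfloor>t\<rfloor>) \<le> t" "t < real (nat \<lfloor>t\<rfloor>) + 1"
      using that by linarith+
    have "t - \<lfloor>t\<rfloor> \<in> {0..1}"
      by (auto simp: frac_def[symmetric] less_imp_le[OF frac_lt_1])
    then show "h t \<in> path_image (p (nat \<lfloor>t\<rfloor>))"
      by (auto simp: path_image_def h_def)
  qed
  have "continuous (at s within {0..1}) g" if s: "s \<in> {0..1}" for s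
  proof (cases "s = 1")
    case True
    have "\<forall>\<^sub>F x in at 1 within {0..1}. dist (g x) l < \<epsilon>" if "\<epsilon> > 0" for \<epsilon>
    proof -
      obtain N where N: "\<forall>n\<ge>N. path_image (p n) \<subseteq> ball l \<epsilon>"
        using lim[OF \<open>\<epsilon> > 0\<close>] by blast
      have "dist (g x) l < \<epsilon>" if x: "x \<in> {0..1}" "x \<noteq> 1" "dist x 1 < 1 / (real N + 2)" for x
      proof -
        have x1: "0 < 1 - x" "1 - x < 1 / (real N + 2)"
          using x by (auto simp: dist_real_def)
        then have "(1 - x) * (real N + 2) < 1"
          by (simp add: field_simps)
        then have le: "real N + 1 \<le> x / (1 - x)"
          using x1 by (simp add: field_simps)
        then obtain n where n: "x / (1 - x) < real n + 1" "h (x / (1 - x)) \<in> path_image (p n)"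
          using h_im[of "x / (1 - x)"] by force
        then have "n \<ge> N"
          using le by linarith
        then have "h (x / (1 - x)) \<in> ball l \<epsilon>"
          using N n(2) by blast
        then show ?thesis
          using x(2) by (simp add: g_def dist_commute)
      qed
      moreover have "1 / (real N + 2) > 0"
        by simp
      ultimately show ?thesis
        unfolding eventually_at by blast
    qed
    then show ?thesis
      using True by (simp add: continuous_within tendsto_iff g_def)
  next
    case False
    have "continuous_on {0..<1} (\<lambda>s. h (s / (1 - s)))"
      by (rule continuous_on_compose2[OF cont_h]) (auto intro!: continuous_intros)
    then have "continuous_on {0..<1} g"
      by (rule continuous_on_eq) (auto simp: g_def)
    then have "continuous (at s within {0..<1}) g"
      using s False by (auto simp: continuous_on_eq_continuous_within)
    moreover have "at s within {0..<1} = at s within {0..1}"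
      by (rule at_within_nhd[of _ "{..<1}"]) (use s False in auto)
    ultimately show ?thesis
      by simp
  qed
  then have "path g"
    by (auto simp: path_def continuous_on_eq_continuous_within)
  moreover have "pathstart g = pathstart (p 0)" "pathfinish g = l"
    using h_eq[of 0 0] by (auto simp: g_def pathstart_def pathfinish_def)
  moreover have "g s \<in> insert l (\<Union>n. path_image (p n))" if "s \<in> {0..1}" for s
    using h_im[of "s / (1 - s)"] that by (auto simp: g_def)
  ultimately show ?thesis
    using that[of g] unfolding path_image_def by blast
qed

text \<open>Invariance of dimension: the inverse of the arc would embed an open set of the plane
  into the line. It serves to find a point of the disc that lies off the star.\<close>

lemma interior_arc_image_complex:
  fixes c :: "real \<Rightarrow> complex"
  assumes "arc c"
  shows "interior (path_image c) = {}"
proof (rule ccontr)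
  assume ne: "interior (path_image c) \<noteq> {}"
  obtain d where d: "homeomorphism {0..1} (path_image c) c d"
    using homeomorphism_compact[of "{0..1}" c "path_image c"] assms
    by (auto simp: arc_def path_def path_image_def)
  have "inj_on d (interior (path_image c))"
    using homeomorphism_apply2[OF d] interior_subset by (intro inj_on_inverseI[of _ c]) blast
  moreover have "continuous_on (interior (path_image c)) d"
    using homeomorphism_cont2[OF d] interior_subset continuous_on_subset by blast
  ultimately have "DIM(complex) \<le> DIM(real)"
    using ne by (intro invariance_of_dimension[of "interior (path_image c)" d]) auto
  then show False
    by simp
qed

lemma interior_Union_arcs_complex:
  fixes c :: "'i \<Rightarrow> real \<Rightarrow> complex"
  assumes "finite I" "\<And>i. i \<in> I \<Longrightarrow> arc (c i)"
  shows "interior (\<Union>i\<in>I. path_image (c i)) = {}"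
  using assms
proof (induction rule: finite_induct)
  case (insert i I)
  then show ?case
    by (simp add: interior_closed_Un_empty_interior closed_arc_image interior_arc_image_complex)
qed auto

text \<open>The arcs \<open>c i\<close> are the edges at a vertex, cut off where they first leave a disc round it.\<close>

locale star_in_disc =
  fixes I :: "'i set" and c :: "'i \<Rightarrow> real \<Rightarrow> complex" and r :: real
  assumes fin: "finite I" and r: "0 < r"
    and arc: "i \<in> I \<Longrightarrow> arc (c i)"
    and start: "i \<in> I \<Longrightarrow> c i 0 = 0"
    and finish: "i \<in> I \<Longrightarrow> norm (c i 1) = r"
    and inner: "i \<in> I \<Longrightarrow> 0 \<le> t \<Longrightarrow> t < 1 \<Longrightarrow> norm (c i t) < r"
    and disj: "i \<in> I \<Longrightarrow> j \<in> I \<Longrightarrow> i \<noteq> j \<Longrightarrow> path_image (c i) \<inter> path_image (c j) \<subseteq> {0}"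
begin

text \<open>Rim, hub and spokes. The hub is listed separately because there are no spokes when the
  vertex is isolated.\<close>

definition wheel :: "complex set" where
  "wheel = sphere 0 r \<union> {0} \<union> (\<Union>i\<in>I. path_image (c i))"

text \<open>The rim with the outer ends of the spokes in \<open>J\<close>: connected through the
  rim, and for \<open>s > 0\<close> away from the hub.\<close>

definition tails :: "'i set \<Rightarrow> real \<Rightarrow> complex set" where
  "tails J s = sphere 0 r \<union> (\<Union>i\<in>J. c i ` {s..1})"

lemma inj: "i \<in> I \<Longrightarrow> inj_on (c i) {0..1}"
  using arc by (simp add: arc_def)

lemma cont: "i \<in> I \<Longrightarrow> continuous_on {0..1} (c i)"
  using arc by (simp add: arc_def path_def)

lemma compact_tail: "i \<in> I \<Longrightarrow> 0 \<le> s \<Longrightarrow> compact (c i ` {s..1})"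
  by (intro compact_continuous_image continuous_on_subset[OF cont]) auto

lemma compact_tails: "J \<subseteq> I \<Longrightarrow> 0 \<le> s \<Longrightarrow> compact (tails J s)"
  unfolding tails_def
  by (intro compact_Un compact_UN finite_subset[OF _ fin] compact_tail) auto

lemma compact_wheel: "compact wheel"
  unfolding wheel_def using fin arc by (intro compact_Un compact_UN) (auto simp: compact_arc_image)

lemma tail_nonzero: "i \<in> I \<Longrightarrow> 0 < s \<Longrightarrow> t \<in> {s..1} \<Longrightarrow> c i t \<noteq> 0"
  using inj_onD[OF inj, of i t 0] start by force

lemma zero_notin_tails: "J \<subseteq> I \<Longrightarrow> 0 < s \<Longrightarrow> 0 \<notin> tails J s"
  using r tail_nonzero by (force simp: tails_def)

lemma tails_subset_wheel: "J \<subseteq> I \<Longrightarrow> 0 \<le> s \<Longrightarrow> tails J s \<subseteq> wheel"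
  by (force simp: tails_def wheel_def path_image_def)

lemma connected_tails:
  assumes "J \<subseteq> I" "0 \<le> s" "s \<le> 1"
  shows "connected (tails J s)"
proof -
  have "finite J"
    using assms fin finite_subset by blast
  then show ?thesis
    using assms(1)
  proof (induction rule: finite_induct)
    case empty
    then show ?case
      by (simp add: tails_def connected_sphere)
  next
    case (insert i J)
    have "connected (tails J s \<union> c i ` {s..1})"
    proof (rule connected_Un)
      show "connected (c i ` {s..1})"
        using insert.prems assms
        by (intro connected_continuous_image continuous_on_subset[OF cont]) auto
      have "c i 1 \<in> tails J s \<inter> c i ` {s..1}"
        using finish insert.prems assms by (auto simp: tails_def)
      then show "tails J s \<inter> c i ` {s..1} \<noteq> {}"
        by blast
    qed (use insert in auto)
    then show ?case
      by (simp add: tails_def Un_ac)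
  qed
qed

text \<open>Spokes are added one at a time. The tail of a spoke is an arc, which does not separate
  the plane, and it meets what is already there only in its end on the rim, so Janiszewski's theorem
  applies.\<close>

lemma tails_not_separating:
  assumes "J \<subseteq> I" "0 < s" "s < 1" "a \<in> ball 0 r - tails J s" "b \<in> ball 0 r - tails J s"
  shows "connected_component (- tails J s) a b"
proof -
  have "finite J"
    using assms fin finite_subset by blast
  then show ?thesis
    using assms(1,4,5)
  proof (induction rule: finite_induct)
    case empty
    have "ball 0 r \<subseteq> - tails {} s"
      by (auto simp: tails_def)
    then show ?case
      using empty connected_component_of_subset[of "ball 0 r"]
      by (metis DiffD1 connected_ball connected_component_def subset_refl)
  next
    case (insert i J)
    have i: "i \<in> I" "J \<subseteq> I"
      using insert by auto
    have eq: "tails (insert i J) s = c i ` {s..1} \<union> tails J s"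
      by (auto simp: tails_def)
    have "connected_component (- (c i ` {s..1} \<union> tails J s)) a b"
    proof (rule Janiszewski)
      show "compact (c i ` {s..1})"
        using compact_tail i assms by simp
      show "closed (tails J s)"
        using compact_tails i assms by (simp add: compact_imp_closed)
      \<comment> \<open>Inside the disc a common point would lie on two spokes, hence be 0, which
        tails avoid.\<close>
      have "c i t = c i 1" if t: "t \<in> {s..1}" "c i t \<in> tails J s" for t
      proof (cases "t = 1")
        case False
        then have "norm (c i t) < r"
          using inner i t assms by auto
        then obtain j where j: "j \<in> J" "c i t \<in> c j ` {s..1}"
          using t by (auto simp: tails_def)
        then have "c i t \<in> path_image (c i) \<inter> path_image (c j)"
          using t assms by (auto simp: path_image_def)
        then have "c i t = 0"
          using disj[of i j] i j insert.hyps by auto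
        then show ?thesis
          using tail_nonzero i t assms by auto
      qed simp
      moreover have "c i 1 \<in> tails J s"
        using finish i by (auto simp: tails_def)
      ultimately have "c i ` {s..1} \<inter> tails J s = {c i 1}"
        using assms by auto
      then show "connected (c i ` {s..1} \<inter> tails J s)"
        by simp
      have "c i ` {s..1} = path_image (subpath s 1 (c i))"
        using assms by (simp add: path_image_subpath)
      moreover have "arc (subpath s 1 (c i))"
        using arc i assms by (intro arc_subpath_arc) auto
      ultimately have "connected (- (c i ` {s..1}))"
        using connected_arc_complement[of "subpath s 1 (c i)"] by simp
      then show "connected_component (- (c i ` {s..1})) a b"
        using insert.prems eq by (auto simp: connected_iff_connected_component)
      show "connected_component (- tails J s) a b"
        using insert eq by auto
    qed
    then show ?case
      by (simp add: eq)
  qed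
qed

lemma small_tails:
  assumes "0 < \<epsilon>"
  obtains s where "0 < s" "s < 1" "wheel - tails I s \<subseteq> ball 0 \<epsilon>"
proof -
  have "\<exists>s. 0 < s \<and> s < 1 \<and> c i ` {0..s} \<subseteq> ball 0 \<epsilon>" if i: "i \<in> I" for i
  proof -
    have "continuous (at 0 within {0..1}) (c i)"
      using cont[OF i] by (auto simp: continuous_on_eq_continuous_within)
    then obtain d where d: "d > 0" "\<forall>t\<in>{0..1}. dist t 0 < d \<longrightarrow> dist (c i t) (c i 0) < \<epsilon>"
      using assms unfolding continuous_within_eps_delta by blast
    show ?thesis
      using d start[OF i] by (intro exI[of _ "min (d/2) (1/2)"]) (auto simp: dist_real_def)
  qed
  then obtain s where s: "\<And>i. i \<in> I \<Longrightarrow> 0 < s i \<and> s i < 1 \<and> c i ` {0..s i} \<subseteq> ball 0 \<epsilon>"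
    by metis
  \<comment> \<open>The value \<open>1/2\<close> keeps the set nonempty when there are no
    spokes.\<close>
  define m where "m = Min (insert (1/2) (s ` I))"
  have m: "0 < m" "m < 1"
    unfolding m_def using fin s by (auto simp: Min_less_iff)
  have mi: "m \<le> s i" if "i \<in> I" for i
    unfolding m_def using fin that by auto
  have "z \<in> ball 0 \<epsilon>" if z: "z \<in> wheel - tails I m" for z
  proof (cases "z = 0")
    case False
    then obtain i t where it: "i \<in> I" "t \<in> {0..1}" "z = c i t"
      using z by (auto simp: wheel_def tails_def path_image_def)
    then have "t \<le> m"
      using z by (force simp: tails_def)
    then have "t \<in> {0..s i}"
      using mi it by force
    then show ?thesis
      using s it by blast
  qed (use assms in auto)
  then show ?thesis
    using that m by blast
qed

text \<open>Otherwise the component of \<open>w\<close> would be open and closed in the complement of \<open>tails I s\<close>, which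
  does not separate the disc.\<close>

lemma sector_at_centre:
  assumes w: "w \<in> ball 0 r - wheel" and "0 < \<epsilon>"
  obtains a where "a \<in> ball 0 \<epsilon>" "connected_component (- wheel) w a"
proof -
  obtain s where s: "0 < s" "s < 1" "wheel - tails I s \<subseteq> ball 0 \<epsilon>"
    using small_tails assms by blast
  define V where "V = connected_component_set (- wheel) w"
  define T where "T = connected_component_set (- tails I s) w"
  have sub: "tails I s \<subseteq> wheel"
    using tails_subset_wheel s by simp
  have "V \<inter> ball 0 \<epsilon> \<noteq> {}"
  proof
    assume disj: "V \<inter> ball 0 \<epsilon> = {}"
    have 0: "connected_component (- tails I s) w 0"
      using w sub s r by (intro tails_not_separating) (auto simp: zero_notin_tails)
    have VT: "V \<subseteq> T"
      unfolding V_def T_def by (intro connected_component_mono) (use sub in auto)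
    have "open V"
      unfolding V_def using compact_wheel
      by (simp add: open_connected_component open_Compl compact_imp_closed)
    then have "openin (top_of_set T) V"
      using VT unfolding openin_open by blast
    \<comment> \<open>A limit point of \<open>V\<close> in \<open>T\<close> lies off the tails and,
      as \<open>V\<close> misses the open ball, outside that ball; the rest of the wheel is inside
      the ball, so the limit point is off the wheel.\<close>
    moreover have "closure V \<inter> T \<subseteq> V"
    proof
      fix z assume z: "z \<in> closure V \<inter> T"
      then have "z \<notin> ball 0 \<epsilon>"
        using disj open_Int_closure_eq_empty[of "ball 0 \<epsilon>" V] by auto
      moreover have "z \<notin> tails I s"
        using z connected_component_in unfolding T_def by auto
      ultimately have "z \<in> - wheel"
        using s by auto
      moreover have "closedin (top_of_set (- wheel)) V"
        unfolding V_def by (rule closedin_connected_component)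
      then obtain C where "closed C" "V = - wheel \<inter> C"
        unfolding closedin_closed by blast
      moreover from this have "z \<in> C"
        using z closure_minimal[of V C] by blast
      ultimately show "z \<in> V"
        by blast
    qed
    then have "closedin (top_of_set T) V"
      using VT closure_subset[of V] unfolding closedin_closed
      by (intro exI[of _ "closure V"]) auto
    moreover have "connected T"
      unfolding T_def by simp
    moreover have "w \<in> V"
      using w unfolding V_def by auto
    ultimately have "V = T"
      unfolding connected_clopen by blast
    then show False
      using 0 disj assms by (auto simp: T_def)
  qed
  then show ?thesis
    using that unfolding V_def by auto
qed

text \<open>Janiszewski's theorem for the wheel and the union of the tails with the outside of a small disc:
  these two sets meet exactly in the tails, which are connected through the rim.\<close>

lemma locally_connected_at_centre:
  assumes "0 < \<epsilon>"
  obtains \<delta> where "0 < \<delta>" "\<And>a b. a \<in> ball 0 \<delta> \<Longrightarrow> b \<in> ball 0 \<delta> \<Longrightarrow>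
    connected_component (- wheel) a b \<Longrightarrow> connected_component (ball 0 \<epsilon> - wheel) a b"
proof -
  define \<epsilon>' where "\<epsilon>' = min \<epsilon> r"
  have \<epsilon>': "0 < \<epsilon>'" "\<epsilon>' \<le> \<epsilon>" "\<epsilon>' \<le> r"
    using assms r by (auto simp: \<epsilon>'_def)
  obtain s where s: "0 < s" "s < 1" "wheel - tails I s \<subseteq> ball 0 \<epsilon>'"
    using small_tails \<epsilon>' by blast
  have clo: "closed (tails I s)"
    using compact_tails s by (simp add: compact_imp_closed)
  then have "open (- tails I s \<inter> ball 0 \<epsilon>')"
    by auto
  moreover have "0 \<in> - tails I s \<inter> ball 0 \<epsilon>'"
    using \<epsilon>' s zero_notin_tails by auto
  ultimately obtain \<delta> where \<delta>: "0 < \<delta>" "ball 0 \<delta> \<subseteq> - tails I s \<inter> ball 0 \<epsilon>'"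
    unfolding open_contains_ball by meson
  show ?thesis
  proof
    fix a b assume ab: "a \<in> ball 0 \<delta>" "b \<in> ball 0 \<delta>" "connected_component (- wheel) a b"
    define T where "T = - ball 0 \<epsilon>' \<union> tails I s"
    have "connected_component (- (wheel \<union> T)) a b"
    proof (rule Janiszewski)
      show "closed T"
        unfolding T_def using clo by (intro closed_Un) auto
      have "wheel \<inter> T = tails I s"
        using s tails_subset_wheel[of I s] by (auto simp: T_def)
      then show "connected (wheel \<inter> T)"
        using connected_tails s by simp
      have "ball 0 \<delta> \<subseteq> - T"
        using \<delta> by (auto simp: T_def)
      then show "connected_component (- T) a b"
        using ab connected_ball unfolding connected_component_def by blast
    qed (use compact_wheel ab in auto)
    moreover have "- (wheel \<union> T) \<subseteq> ball 0 \<epsilon> - wheel"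
      using \<epsilon>' by (auto simp: T_def)
    ultimately show "connected_component (ball 0 \<epsilon> - wheel) a b"
      using connected_component_of_subset by blast
  qed (use \<delta> in auto)
qed

text \<open>One component of the complement comes arbitrarily close to 0. Points of it converging to
  0 are joined successively inside shrinking discs, and the infinite concatenation of these paths
  ends at 0.\<close>

lemma accessible_centre:
  obtains \<beta> where "arc \<beta>" "\<beta> 0 = 0" "\<And>t. 0 < t \<Longrightarrow> t \<le> 1 \<Longrightarrow> \<beta> t \<notin> wheel"
proof -
  have "interior (\<Union>i\<in>I. path_image (c i)) = {}"
    using fin arc by (rule interior_Union_arcs_complex)
  then have "interior ({0} \<union> (\<Union>i\<in>I. path_image (c i))) = {}"
    using interior_closed_Un_empty_interior[of "{0::complex}" "\<Union>i\<in>I. path_image (c i)"]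
    by (metis Un_commute closed_singleton fin arc closed_UN closed_arc_image interior_closed_Un_empty_interior interior_singleton)
  then have "\<not> ball 0 r \<subseteq> {0} \<union> (\<Union>i\<in>I. path_image (c i))"
    using r by (metis centre_in_ball empty_iff interior_maximal open_ball subsetD)
  then obtain w where "w \<in> ball 0 r" "w \<notin> {0} \<union> (\<Union>i\<in>I. path_image (c i))"
    by blast
  then have w: "w \<in> ball 0 r - wheel"
    by (auto simp: wheel_def)
  have open_wheel: "open (ball 0 \<epsilon> - wheel)" for \<epsilon>
    using compact_wheel by (simp add: compact_imp_closed open_Diff)
  have "\<forall>n. \<exists>\<delta>>0. \<forall>a b. a \<in> ball 0 \<delta> \<longrightarrow> b \<in> ball 0 \<delta> \<longrightarrow> connected_component (- wheel) a b \<longrightarrow>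
          connected_component (ball 0 (1 / (real n + 1)) - wheel) a b"
    using locally_connected_at_centre[of "1 / (real n + 1)" for n]
    by (metis add_nonneg_pos divide_pos_pos of_nat_0_le_iff zero_less_one)
  then obtain \<delta> where \<delta>: "\<And>n. \<delta> n > 0" "\<And>n a b. a \<in> ball 0 (\<delta> n) \<Longrightarrow> b \<in> ball 0 (\<delta> n) \<Longrightarrow>
      connected_component (- wheel) a b \<Longrightarrow> connected_component (ball 0 (1 / (real n + 1)) - wheel) a b"
    by metis
  \<comment> \<open>The running minimum is non-increasing, so \<open>a n\<close> and
    \<open>a (Suc n)\<close> both lie in the disc of radius \<open>\<delta> n\<close>.\<close>
  define m where "m n = Min (\<delta> ` {..n})" for n
  have m: "m n > 0" "m n \<le> \<delta> n" "m (Suc n) \<le> \<delta> n" for n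
    unfolding m_def using \<delta>(1) by auto
  have "\<forall>n. \<exists>a. a \<in> ball 0 (m n) \<and> connected_component (- wheel) w a"
    using sector_at_centre[OF w] m(1) by metis
  then obtain a where a: "\<And>n. a n \<in> ball 0 (m n)" "\<And>n. connected_component (- wheel) w (a n)"
    by metis
  have "\<exists>p. path p \<and> path_image p \<subseteq> ball 0 (1 / (real n + 1)) - wheel \<and>
          pathstart p = a n \<and> pathfinish p = a (Suc n)" for n
  proof -
    have "connected_component (- wheel) (a n) (a (Suc n))"
      using a(2) connected_component_trans connected_component_sym by metis
    moreover have "a n \<in> ball 0 (\<delta> n)" "a (Suc n) \<in> ball 0 (\<delta> n)"
      using a(1)[of n] a(1)[of "Suc n"] m[of n] by auto
    ultimately have "connected_component (ball 0 (1 / (real n + 1)) - wheel) (a n) (a (Suc n))"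
      using \<delta>(2) by blast
    then show ?thesis
      unfolding open_path_connected_component[OF open_wheel, symmetric] path_component_def .
  qed
  then have "\<exists>p. \<forall>n. path (p n) \<and> path_image (p n) \<subseteq> ball 0 (1 / (real n + 1)) - wheel \<and>
          pathstart (p n) = a n \<and> pathfinish (p n) = a (Suc n)"
    by (intro choice) blast
  then obtain p where p: "\<And>n. path (p n)" "\<And>n. path_image (p n) \<subseteq> ball 0 (1 / (real n + 1)) - wheel"
      "\<And>n. pathstart (p n) = a n" "\<And>n. pathfinish (p n) = a (Suc n)"
    by blast
  have "\<exists>N. \<forall>n\<ge>N. path_image (p n) \<subseteq> ball 0 \<epsilon>" if "\<epsilon> > 0" for \<epsilon>
  proof -
    obtain N where N: "inverse (real (Suc N)) < \<epsilon>"
      using reals_Archimedean[OF \<open>\<epsilon> > 0\<close>] by blast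
    have "path_image (p n) \<subseteq> ball 0 \<epsilon>" if "n \<ge> N" for n
    proof -
      have "1 / (real n + 1) \<le> 1 / (real N + 1)"
        using that by (simp add: field_simps)
      then show ?thesis
        using N p(2)[of n] by (force simp: inverse_eq_divide add.commute)
    qed
    then show ?thesis
      by blast
  qed
  moreover have "pathfinish (p n) = pathstart (p (Suc n))" for n
    using p by simp
  ultimately obtain g where g: "path g" "pathstart g = pathstart (p 0)" "pathfinish g = 0"
      "path_image g \<subseteq> insert 0 (\<Union>n. path_image (p n))"
    using infinite_path_concatenation[of p 0, OF p(1)] by blast
  have out: "path_image g \<subseteq> insert 0 (- wheel)"
    using g(4) p(2) by blast
  have "a 0 \<notin> wheel"
    using a(2) connected_component_in by blast
  then have "a 0 \<noteq> 0"
    by (auto simp: wheel_def)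
  \<comment> \<open>The path may touch the wheel at 0 only. Passing to an arc that starts at 0
    excludes later returns to 0.\<close>
  then obtain q where q: "arc q" "path_image q \<subseteq> path_image g" "pathstart q = 0"
    using path_contains_arc[of "reversepath g" 0 "a 0"] g(1,2,3) p(3)[of 0]
    by (metis path_reversepath path_image_reversepath pathstart_reversepath pathfinish_reversepath)
  show ?thesis
  proof
    show "arc q" "q 0 = 0"
      using q by (auto simp: pathstart_def)
    fix t :: real assume t: "0 < t" "t \<le> 1"
    then have "q t \<noteq> q 0"
      using q(1) inj_onD[of q "{0..1}" t 0] by (auto simp: arc_def)
    then have "q t \<noteq> 0"
      using q(3) by (simp add: pathstart_def)
    moreover have "q t \<in> path_image q"
      using t by (simp add: path_image_def)
    ultimately show "q t \<notin> wheel"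
      using q(2) out by blast
  qed
qed

end

section \<open>Attaching pendant edges on a surface\<close>

lemma closed_surface_centred_chart:
  fixes S :: "'a topology"
  assumes "closed_surface S" "P \<in> topspace S"
  obtains U and f :: "'a \<Rightarrow> complex" and k where "openin S U" "P \<in> U" "f P = 0"
    "continuous_map (subtopology S U) euclidean f" "continuous_map euclidean (subtopology S U) k"
    "\<And>w. f (k w) = w" "\<And>z. z \<in> U \<Longrightarrow> k (f z) = z" "\<And>w. k w \<in> U"
proof -
  obtain U where U: "openin S U" "P \<in> U"
      "subtopology S U homeomorphic_space (euclidean :: complex topology)"
    using assms unfolding closed_surface_def by blast
  then obtain f :: "'a \<Rightarrow> complex" and k where fk: "homeomorphic_maps (subtopology S U) euclidean f k"
    unfolding homeomorphic_space_def by blast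
  have top: "topspace (subtopology S U) = U"
    using openin_subset[OF U(1)] by auto
  have f: "continuous_map (subtopology S U) euclidean f" and k: "continuous_map euclidean (subtopology S U) k"
    and inv: "\<And>w. f (k w) = w" "\<And>z. z \<in> U \<Longrightarrow> k (f z) = z"
    using fk unfolding homeomorphic_maps_def top by auto
  show ?thesis
  proof
    show "continuous_map (subtopology S U) euclidean (\<lambda>z. f z - f P)"
      using f by (intro continuous_map_diff) auto
    have "continuous_map euclidean (subtopology S U) (k \<circ> (\<lambda>w. w + f P))"
      by (intro continuous_map_compose[OF _ k]) (auto intro!: continuous_intros)
    then show "continuous_map euclidean (subtopology S U) (\<lambda>w. k (w + f P))"
      by (simp add: o_def)
    show "k (w + f P) \<in> U" for w
      using k top by (auto simp: continuous_map_def Pi_iff)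
  qed (use U inv in auto)
qed

lemma pathin_reverse:
  assumes "pathin S \<gamma>"
  shows "pathin S (\<lambda>t. \<gamma> (1 - t))"
proof -
  have "continuous_map (top_of_set {0..1}) (top_of_set {0..1}) (\<lambda>t::real. 1 - t)"
    by (auto simp: continuous_map_in_subtopology intro!: continuous_intros)
  then have "continuous_map (top_of_set {0..1}) S (\<gamma> \<circ> (\<lambda>t. 1 - t))"
    using assms unfolding pathin_def by (rule continuous_map_compose)
  then show ?thesis
    by (simp add: pathin_def o_def)
qed

text \<open>In a chart disc that meets only edges at \<open>v\<close>, these edges, cut off at their
  first exit, form a star. An arc that reaches the centre through the complement of the star is
  carried back to the surface and shortened.\<close>

lemma embeds_in_add_leaf:
  fixes S :: "'a topology" and V :: "'v set"
  assumes S: "closed_surface S" and emb: "embeds_in (V, E) S"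
    and V: "finite V" "E \<subseteq> {e. e \<subseteq> V \<and> card e = 2}" and v: "v \<in> V" and x: "x \<notin> V"
  shows "embeds_in (insert x V, insert {x, v} E) S"
proof -
  obtain p and \<gamma> :: "'v set \<Rightarrow> real \<Rightarrow> 'a" where p: "p ` V \<subseteq> topspace S" "inj_on p V"
    and \<gamma>_all: "\<forall>e\<in>E. pathin S (\<gamma> e) \<and> inj_on (\<gamma> e) {0..1} \<and> {\<gamma> e 0, \<gamma> e 1} = p ` e \<and>
      \<gamma> e ` {0<..<1} \<inter> p ` V = {}"
    and \<gamma>_disj: "\<forall>e\<in>E. \<forall>e'\<in>E. e \<noteq> e' \<longrightarrow> \<gamma> e ` {0<..<1} \<inter> \<gamma> e' ` {0<..<1} = {}"
    using emb unfolding embeds_in_def fst_conv snd_conv by (elim exE conjE) (rule that; assumption)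
  have \<gamma>: "pathin S (\<gamma> e)" "inj_on (\<gamma> e) {0..1}" "{\<gamma> e 0, \<gamma> e 1} = p ` e"
      "\<gamma> e ` {0<..<1} \<inter> p ` V = {}" if "e \<in> E" for e
    using \<gamma>_all that by blast+
  have haus: "Hausdorff_space S"
    using S by (simp add: closed_surface_def)
  have finE: "finite E"
    using V by (intro finite_subset[of E "Pow V"]) auto
  have Esub: "e \<subseteq> V" "card e = 2" if "e \<in> E" for e
    using that V by auto
  have in01: "t \<in> {0<..<1} \<or> t = 0 \<or> t = 1" if "t \<in> {0..1}" for t :: real
    using that by auto
  have \<gamma>_cases: "z \<in> \<gamma> e ` {0<..<1} \<or> z \<in> p ` e" if "e \<in> E" "z \<in> \<gamma> e ` {0..1}" for e z
    using that in01 \<gamma>(3)[of e] by blast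
  obtain U and f :: "'a \<Rightarrow> complex" and k where U: "openin S U" "p v \<in> U" "f (p v) = 0"
    and f: "continuous_map (subtopology S U) euclidean f"
    and k: "continuous_map euclidean (subtopology S U) k"
    and fk: "\<And>w. f (k w) = w" and kf: "\<And>z. z \<in> U \<Longrightarrow> k (f z) = z" and kU: "\<And>w. k w \<in> U"
    using closed_surface_centred_chart[OF S, of "p v"] p v by blast
  have kS: "continuous_map euclidean S k"
    using k continuous_map_in_subtopology by blast
  have k0: "k 0 = p v"
    using kf U by metis
  have avoid: "\<exists>r>0. \<forall>w\<in>cball 0 r. k w \<notin> X" if "closedin S X" "p v \<notin> X" for X
  proof -
    have "openin euclidean {w \<in> topspace euclidean. k w \<in> topspace S - X}"
      using kS that by (intro openin_continuous_map_preimage) auto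
    moreover have "k w \<in> topspace S" for w
      using kU openin_subset[OF U(1)] by auto
    ultimately have "open {w. k w \<notin> X}"
      by simp
    moreover have "0 \<in> {w. k w \<notin> X}"
      using that k0 by simp
    ultimately obtain r where "r > 0" "cball 0 r \<subseteq> {w. k w \<notin> X}"
      unfolding open_contains_cball by meson
    then show ?thesis
      by blast
  qed
  have closed_path: "closedin S (\<sigma> ` {a..b})" if "pathin S \<sigma>" "0 \<le> a" "b \<le> 1" for \<sigma> a b
  proof -
    have "compactin (top_of_set {0..1}) {a..b}"
      using that by (simp add: compactin_subtopology)
    then show ?thesis
      using that haus unfolding pathin_def
      by (meson compactin_imp_closedin image_compactin)
  qed
  define Ev where "Ev = {e \<in> E. v \<in> e}"
  have finEv: "finite Ev"
    using finE by (simp add: Ev_def)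
  \<comment> \<open>All that the disc round \<open>p v\<close> has to avoid: the other vertices and
    the edges that do not end at \<open>v\<close>.\<close>
  define X where "X = p ` (V - {v}) \<union> (\<Union>e\<in>E - Ev. \<gamma> e ` {0..1})"
  have "closedin S X"
  proof -
    have "closedin S (p ` (V - {v}))"
      using V p haus by (intro closedin_Hausdorff_finite) auto
    moreover have "closedin S (\<Union>((\<lambda>e. \<gamma> e ` {0..1}) ` (E - Ev)))"
      using finE \<gamma>(1) closed_path by (intro closedin_Union) auto
    ultimately show ?thesis
      unfolding X_def by (rule closedin_Un)
  qed
  moreover have "p v \<notin> X"
  proof
    assume "p v \<in> X"
    then consider u where "u \<in> V - {v}" "p v = p u" | e where "e \<in> E - Ev" "p v \<in> \<gamma> e ` {0..1}"
      unfolding X_def by blast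
    then show False
    proof cases
      case 1
      then show False
        using p v by (auto dest: inj_onD)
    next
      case 2
      then have "p v \<in> p ` e"
        using \<gamma>_cases[of e "p v"] \<gamma>(4)[of e] v by blast
      then obtain u where "u \<in> e" "p v = p u"
        by blast
      then have "v \<in> e"
        using inj_onD[OF p(2), of v u] 2 Esub(1)[of e] v by auto
      then show False
        using 2 by (simp add: Ev_def)
    qed
  qed
  ultimately obtain r where disc: "r > 0" "\<And>w. w \<in> cball 0 r \<Longrightarrow> k w \<notin> X"
    using avoid by blast
  \<comment> \<open>Edges at \<open>v\<close> are directed away from \<open>v\<close>. The far end
    is a vertex in \<open>X\<close>, hence outside the disc, so each of these edges must leave the
    disc.\<close>
  have "\<exists>\<sigma>. pathin S \<sigma> \<and> inj_on \<sigma> {0..1} \<and> \<sigma> 0 = p v \<and> \<sigma> 1 \<in> X \<and> \<sigma> ` {0..1} = \<gamma> e ` {0..1}"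
    if e: "e \<in> Ev" for e
  proof -
    have eE: "e \<in> E" "v \<in> e"
      using e by (auto simp: Ev_def)
    then obtain u where u: "e = {v, u}" "u \<noteq> v"
      using Esub(2)[of e] by (auto simp: card_2_iff)
    then have uX: "p u \<in> X"
      using Esub(1)[OF eE(1)] by (auto simp: X_def)
    have puv: "p u \<noteq> p v"
      using u Esub(1)[OF eE(1)] p by (auto dest: inj_onD)
    have ends: "{\<gamma> e 0, \<gamma> e 1} = {p v, p u}"
      using \<gamma>(3)[OF eE(1)] u by auto
    show ?thesis
    proof (cases "\<gamma> e 0 = p v")
      case True
      then have "\<gamma> e 1 = p u"
        using ends puv by (auto simp: doubleton_eq_iff)
      then show ?thesis
        using True uX \<gamma>(1,2)[OF eE(1)] by (intro exI[of _ "\<gamma> e"]) auto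
    next
      case False
      then have *: "\<gamma> e 0 = p u" "\<gamma> e 1 = p v"
        using ends puv by (auto simp: doubleton_eq_iff)
      have "(\<lambda>t::real. 1 - t) ` {0..1} = {0..1}"
        by (auto simp: image_iff intro!: bexI[of _ "1 - _"])
      then have im: "(\<lambda>t. \<gamma> e (1 - t)) ` {0..1} = \<gamma> e ` {0..1}"
        by (metis image_image)
      moreover have "inj_on (\<lambda>t. \<gamma> e (1 - t)) {0..1}"
      proof
        fix s t :: real assume "s \<in> {0..1}" "t \<in> {0..1}" "\<gamma> e (1 - s) = \<gamma> e (1 - t)"
        then show "s = t"
          using inj_onD[OF \<gamma>(2)[OF eE(1)], of "1 - s" "1 - t"] by auto
      qed
      ultimately show ?thesis
        using * uX pathin_reverse[OF \<gamma>(1)[OF eE(1)]] by (intro exI[of _ "\<lambda>t. \<gamma> e (1 - t)"]) auto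
    qed
  qed
  then obtain \<sigma> where \<sigma>: "\<And>e. e \<in> Ev \<Longrightarrow> pathin S (\<sigma> e)" "\<And>e. e \<in> Ev \<Longrightarrow> inj_on (\<sigma> e) {0..1}"
      "\<And>e. e \<in> Ev \<Longrightarrow> \<sigma> e 0 = p v" "\<And>e. e \<in> Ev \<Longrightarrow> \<sigma> e 1 \<in> X"
      "\<And>e. e \<in> Ev \<Longrightarrow> \<sigma> e ` {0..1} = \<gamma> e ` {0..1}"
    by metis
  have open_disc: "openin S (k ` ball 0 r)"
  proof -
    have "k ` ball 0 r = {z \<in> topspace (subtopology S U). f z \<in> ball 0 r}"
    proof (intro equalityI subsetI)
      fix z assume "z \<in> {z \<in> topspace (subtopology S U). f z \<in> ball 0 r}"
      then have "z = k (f z)" "f z \<in> ball 0 r"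
        using kf by auto
      then show "z \<in> k ` ball 0 r"
        by blast
    qed (use fk kU openin_subset[OF U(1)] in auto)
    moreover have "openin (subtopology S U) {z \<in> topspace (subtopology S U). f z \<in> ball 0 r}"
      using f by (intro openin_continuous_map_preimage) auto
    ultimately show ?thesis
      using openin_trans_full[OF _ U(1)] by simp
  qed
  have closed_disc: "closedin S (k ` cball 0 r)"
    using kS haus by (intro compactin_imp_closedin image_compactin[of euclidean]) auto
  have "\<exists>T. 0 < T \<and> T \<le> 1 \<and> (\<forall>t. 0 \<le> t \<longrightarrow> t < T \<longrightarrow> \<sigma> e t \<in> k ` ball 0 r) \<and> \<sigma> e T \<in> k ` sphere 0 r"
    if e: "e \<in> Ev" for e
  proof -
    \<comment> \<open>The times spent outside the open disc form a closed set; its infimum is the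
      first exit. Since the closed disc is closed in \<open>S\<close>, the exit point lies on the
      boundary circle.\<close>
    define A where "A = {t \<in> {0..1}. \<sigma> e t \<notin> k ` ball 0 r}"
    have cm: "continuous_map (top_of_set {0..1}) S (\<sigma> e)"
      using \<sigma>(1)[OF e] by (simp add: pathin_def)
    then have "\<sigma> e t \<in> topspace S" if "t \<in> {0..1}" for t
      using that by (auto simp: continuous_map_def Pi_iff)
    then have "A = {t \<in> topspace (top_of_set {0..1}). \<sigma> e t \<in> topspace S - k ` ball 0 r}"
      by (auto simp: A_def)
    then have "closedin (top_of_set {0..1}) A"
      using closedin_continuous_map_preimage[OF cm, of "topspace S - k ` ball 0 r"] open_disc
      by (metis openin_closedin_eq)
    then have "closed A"
      by (rule closedin_closed_trans) auto
    moreover have "1 \<in> A"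
      using \<sigma>(4)[OF e] disc(2) by (auto simp: A_def)
    moreover have "A \<subseteq> {0..1}"
      by (auto simp: A_def)
    moreover from this have bdd: "bdd_below A"
      by (intro bdd_belowI[of _ 0]) auto
    ultimately have T: "Inf A \<in> A"
      using closed_contains_Inf[of A] by blast
    define T where "T = Inf A"
    have before: "\<sigma> e t \<in> k ` ball 0 r" if "0 \<le> t" "t < T" for t
    proof (rule ccontr)
      assume "\<sigma> e t \<notin> k ` ball 0 r"
      then have "t \<in> A"
        using that T \<open>A \<subseteq> {0..1}\<close> by (auto simp: A_def T_def)
      then show False
        using cInf_lower[OF _ bdd, of t] that by (simp add: T_def)
    qed
    have T01: "T \<in> {0..1}" "\<sigma> e T \<notin> k ` ball 0 r"
      using T by (auto simp: A_def T_def)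
    have "p v \<in> k ` ball 0 r"
      using k0 disc(1) by (metis centre_in_ball imageI)
    then have "T \<noteq> 0"
      using T01 \<sigma>(3)[OF e] by auto
    then have T0: "0 < T"
      using T01 by auto
    have "closedin (top_of_set {0..1}) {t \<in> topspace (top_of_set {0..1}). \<sigma> e t \<in> k ` cball 0 r}"
      using closedin_continuous_map_preimage[OF cm closed_disc] .
    then have "closed {t \<in> topspace (top_of_set {0..1}). \<sigma> e t \<in> k ` cball 0 r}"
      by (rule closedin_closed_trans) simp
    then have "closed {t \<in> {0..1}. \<sigma> e t \<in> k ` cball 0 r}"
      by simp
    moreover have "{0..<T} \<subseteq> {t \<in> {0..1}. \<sigma> e t \<in> k ` cball 0 r}"
    proof
      fix t assume t: "t \<in> {0..<T}"
      then have "\<sigma> e t \<in> k ` cball 0 r"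
        using before[of t] image_mono[OF ball_subset_cball[of 0 r], of k] by auto
      then show "t \<in> {t \<in> {0..1}. \<sigma> e t \<in> k ` cball 0 r}"
        using t T01(1) by simp
    qed
    ultimately have "closure {0..<T} \<subseteq> {t \<in> {0..1}. \<sigma> e t \<in> k ` cball 0 r}"
      by (intro closure_minimal)
    moreover have "T \<in> closure {0..<T}"
      using T0 by simp
    ultimately have "\<sigma> e T \<in> k ` cball 0 r"
      by blast
    then obtain w where w: "w \<in> cball 0 r" "\<sigma> e T = k w"
      by blast
    then have "w \<notin> ball 0 r"
      using T01(2) by blast
    then have "\<sigma> e T \<in> k ` sphere 0 r"
      using w by auto
    then show ?thesis
      using before T0 T01 by auto
  qed
  then obtain T where T: "\<And>e. e \<in> Ev \<Longrightarrow> 0 < T e" "\<And>e. e \<in> Ev \<Longrightarrow> T e \<le> 1"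
      "\<And>e t. e \<in> Ev \<Longrightarrow> 0 \<le> t \<Longrightarrow> t < T e \<Longrightarrow> \<sigma> e t \<in> k ` ball 0 r"
      "\<And>e. e \<in> Ev \<Longrightarrow> \<sigma> e (T e) \<in> k ` sphere 0 r"
    by metis
  have in_disc: "\<sigma> e t \<in> k ` cball 0 r" if "e \<in> Ev" "0 \<le> t" "t \<le> T e" for e t
    using T(3)[OF that(1,2)] T(4)[OF that(1)] that(3)
      image_mono[OF ball_subset_cball[of 0 r], of k] image_mono[OF sphere_cball[of 0 r], of k]
    by (cases "t = T e") auto
  have inU: "\<sigma> e t \<in> U" and notX: "\<sigma> e t \<notin> X" if "e \<in> Ev" "0 \<le> t" "t \<le> T e" for e t
  proof -
    obtain w where "w \<in> cball 0 r" "\<sigma> e t = k w"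
      using in_disc \<open>e \<in> Ev\<close> \<open>0 \<le> t\<close> \<open>t \<le> T e\<close> by blast
    then show "\<sigma> e t \<in> U" "\<sigma> e t \<notin> X"
      using kU disc(2) by auto
  qed
  \<comment> \<open>The edges up to their first exit, read in the chart and rescaled to the unit
    interval. They meet only in 0, because a common point of two edges is a vertex and the disc
    contains no vertex except \<open>v\<close>.\<close>
  define c where "c e t = f (\<sigma> e (T e * t))" for e t
  have scale: "0 \<le> T e * t" "T e * t \<le> T e" "T e * t \<in> {0..1}" if "e \<in> Ev" "t \<in> {0..1}" for e t
    using T(1,2)[OF that(1)] that(2) by (auto simp: mult_le_one mult_left_le)
  have f_inj: "a = b" if "f a = f b" "a \<in> U" "b \<in> U" for a b
    using that kf by metis
  interpret star_in_disc Ev c r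
  proof
    show "arc (c e)" if e: "e \<in> Ev" for e
    proof -
      have "continuous_map (top_of_set {0..1}) (top_of_set {0..1}) (\<lambda>t. T e * t)"
        using scale[OF e] by (auto simp: continuous_map_in_subtopology intro!: continuous_intros)
      then have "continuous_map (top_of_set {0..1}) S (\<sigma> e \<circ> (\<lambda>t. T e * t))"
        using \<sigma>(1)[OF e] unfolding pathin_def by (rule continuous_map_compose)
      then have "continuous_map (top_of_set {0..1}) (subtopology S U) (\<sigma> e \<circ> (\<lambda>t. T e * t))"
        using inU[OF e] scale[OF e] by (auto simp: continuous_map_in_subtopology)
      then have "continuous_map (top_of_set {0..1}) euclidean (f \<circ> (\<sigma> e \<circ> (\<lambda>t. T e * t)))"
        using f by (rule continuous_map_compose)
      then have "path (c e)"
        by (simp add: path_def o_def c_def[abs_def])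
      moreover have "s = t" if "s \<in> {0..1}" "t \<in> {0..1}" "c e s = c e t" for s t
      proof -
        have "\<sigma> e (T e * s) = \<sigma> e (T e * t)"
          using that(3) inU[OF e scale(1,2)[OF e that(1)]] inU[OF e scale(1,2)[OF e that(2)]]
          unfolding c_def by (intro f_inj)
        then have "T e * s = T e * t"
          using inj_onD[OF \<sigma>(2)[OF e], of "T e * s" "T e * t"] scale(3)[OF e] that by blast
        then show ?thesis
          using T(1)[OF e] by simp
      qed
      ultimately show ?thesis
        by (auto simp: arc_def inj_on_def)
    qed
    show "c e 0 = 0" if "e \<in> Ev" for e
      using \<sigma>(3)[OF that] U by (simp add: c_def)
    show "norm (c e 1) = r" if "e \<in> Ev" for e
      using T(4)[OF that] fk by (auto simp: c_def)
    show "norm (c e t) < r" if "e \<in> Ev" "0 \<le> t" "t < 1" for e t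
      using T(1)[OF that(1)] T(3)[OF that(1), of "T e * t"] that fk by (auto simp: c_def)
    show "path_image (c e) \<inter> path_image (c e') \<subseteq> {0}" if e: "e \<in> Ev" "e' \<in> Ev" "e \<noteq> e'" for e e'
    proof
      fix w assume "w \<in> path_image (c e) \<inter> path_image (c e')"
      then obtain s s' where s: "s \<in> {0..1}" "s' \<in> {0..1}" "w = c e s" "w = c e' s'"
        by (auto simp: path_image_def)
      define z where "z = \<sigma> e (T e * s)"
      have "z = \<sigma> e' (T e' * s')"
        using s(3,4) inU[OF e(1) scale(1,2)[OF e(1) s(1)]] inU[OF e(2) scale(1,2)[OF e(2) s(2)]]
        unfolding c_def z_def by (intro f_inj) auto
      then have "z \<in> \<gamma> e ` {0..1}" "z \<in> \<gamma> e' ` {0..1}"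
        using imageI[OF scale(3)[OF e(1) s(1)], of "\<sigma> e"] imageI[OF scale(3)[OF e(2) s(2)], of "\<sigma> e'"]
          \<sigma>(5)[OF e(1)] \<sigma>(5)[OF e(2)] z_def by auto
      moreover have eE: "e \<in> E" "e' \<in> E"
        using e by (auto simp: Ev_def)
      moreover have "\<gamma> e ` {0<..<1} \<inter> \<gamma> e' ` {0<..<1} = {}"
        using \<gamma>_disj eE e(3) by simp
      ultimately have "z \<in> p ` e \<or> z \<in> p ` e'"
        using \<gamma>_cases[of e z] \<gamma>_cases[of e' z] by blast
      then have "z \<in> p ` V"
        using Esub eE by blast
      moreover have "z \<notin> X"
        using notX[OF e(1)] scale[OF e(1) s(1)] by (simp add: z_def)
      ultimately have "z = p v"
        by (auto simp: X_def)
      then show "w \<in> {0}"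
        using s U by (simp add: c_def z_def)
    qed
  qed (use finEv disc in auto)
  obtain \<beta> where \<beta>: "arc \<beta>" "\<beta> 0 = 0" "\<And>t. 0 < t \<Longrightarrow> t \<le> 1 \<Longrightarrow> \<beta> t \<notin> wheel"
    using accessible_centre by blast
  \<comment> \<open>The wheel records an edge only up to its first exit, but the edge may come back
    into the disc. The later parts form a closed set without \<open>p v\<close>, so a smaller disc
    of radius \<open>r'\<close> avoids them.\<close>
  have "closedin S (\<Union>((\<lambda>e. \<sigma> e ` {T e..1}) ` Ev))"
    using finEv \<sigma>(1) T by (intro closedin_Union) (auto intro!: closed_path less_imp_le)
  moreover have "p v \<notin> \<Union>((\<lambda>e. \<sigma> e ` {T e..1}) ` Ev)"
  proof
    assume "p v \<in> \<Union>((\<lambda>e. \<sigma> e ` {T e..1}) ` Ev)"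
    then obtain e t where et: "e \<in> Ev" "t \<in> {T e..1}" "\<sigma> e t = \<sigma> e 0"
      using \<sigma>(3) by auto
    then have "0 < t" "t \<le> 1"
      using T(1)[of e] by auto
    then show False
      using et inj_onD[OF \<sigma>(2)[OF et(1)], of t 0] by auto
  qed
  ultimately have "\<exists>r'>0. \<forall>w\<in>cball 0 r'. k w \<notin> \<Union>((\<lambda>e. \<sigma> e ` {T e..1}) ` Ev)"
    by (rule avoid)
  then obtain r' where r': "r' > 0" "\<forall>w\<in>cball 0 r'. k w \<notin> \<Union>((\<lambda>e. \<sigma> e ` {T e..1}) ` Ev)"
    by (elim exE conjE) (rule that)
  have "continuous (at 0 within {0..1}) \<beta>"
    using \<beta>(1) by (auto simp: arc_def path_def continuous_on_eq_continuous_within)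
  then obtain d where d: "d > 0" "\<And>t. t \<in> {0..1} \<Longrightarrow> dist t 0 < d \<Longrightarrow> dist (\<beta> t) (\<beta> 0) < min r r'"
    using r(1) r'(1) unfolding continuous_within_eps_delta by (metis min_less_iff_conj)
  \<comment> \<open>The part of \<open>\<beta>\<close> up to \<open>\<tau>\<close> stays in both
    discs; its end becomes the new vertex.\<close>
  define \<tau> where "\<tau> = min (d / 2) 1"
  have \<tau>: "0 < \<tau>" "\<tau> \<le> 1"
    using d by (auto simp: \<tau>_def)
  have \<tau>01: "\<tau> * t \<in> {0..1}" if "t \<in> {0..1}" for t
    using that \<tau> by (auto simp: mult_le_one)
  have small: "\<beta> (\<tau> * t) \<in> cball 0 r" "\<beta> (\<tau> * t) \<in> cball 0 r'" if "t \<in> {0..1}" for t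
  proof -
    have "\<tau> * t \<le> \<tau>"
      using \<tau> that by (simp add: mult_left_le)
    then have "dist (\<tau> * t) 0 < d"
      using \<tau> that d by (auto simp: dist_real_def \<tau>_def)
    then have "dist (\<beta> (\<tau> * t)) (\<beta> 0) < min r r'"
      using d \<tau>01 that by blast
    then show "\<beta> (\<tau> * t) \<in> cball 0 r" "\<beta> (\<tau> * t) \<in> cball 0 r'"
      using \<beta>(2) by auto
  qed
  define \<gamma>' where "\<gamma>' t = k (\<beta> (\<tau> * t))" for t
  have \<gamma>'_path: "pathin S \<gamma>'"
  proof -
    have "continuous_on {0..1} (\<lambda>t. \<beta> (\<tau> * t))"
      using \<beta>(1) \<tau>01 unfolding arc_def path_def
      by (intro continuous_on_compose2[where g = \<beta> and f = "\<lambda>t. \<tau> * t"]) (auto intro!: continuous_intros)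
    then have "continuous_map (top_of_set {0..1}) euclidean (\<lambda>t. \<beta> (\<tau> * t))"
      by simp
    from continuous_map_compose[OF this kS] show ?thesis
      by (simp add: pathin_def o_def \<gamma>'_def[abs_def])
  qed
  have \<gamma>'_inj: "inj_on \<gamma>' {0..1}"
  proof
    fix s t :: real assume st: "s \<in> {0..1}" "t \<in> {0..1}" "\<gamma>' s = \<gamma>' t"
    then have "\<beta> (\<tau> * s) = \<beta> (\<tau> * t)"
      unfolding \<gamma>'_def using fk by metis
    then have "\<tau> * s = \<tau> * t"
      using \<beta>(1) \<tau>01[OF st(1)] \<tau>01[OF st(2)] unfolding arc_def by (metis inj_onD)
    then show "s = t"
      using \<tau> by simp
  qed
  have \<gamma>'_0: "\<gamma>' 0 = p v"
    using \<beta> k0 by (simp add: \<gamma>'_def)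
  have not_wheel: "\<beta> (\<tau> * t) \<notin> wheel" if "0 < t" "t \<le> 1" for t
    using \<beta>(3)[of "\<tau> * t"] that \<tau> by (simp add: mult_le_one)
  have \<gamma>'_edge: "\<gamma>' t \<notin> \<gamma> e ` {0..1}" if t: "0 < t" "t \<le> 1" and e: "e \<in> E" for t e
  proof (cases "e \<in> Ev")
    case False
    moreover have "\<gamma>' t \<notin> X"
      using disc(2)[OF small(1)] t by (simp add: \<gamma>'_def)
    ultimately show ?thesis
      using e by (auto simp: X_def)
  next
    case True
    show ?thesis
    proof
      assume "\<gamma>' t \<in> \<gamma> e ` {0..1}"
      then have "k (\<beta> (\<tau> * t)) \<in> \<sigma> e ` {0..1}"
        unfolding \<sigma>(5)[OF True] \<gamma>'_def .
      then obtain s where s: "s \<in> {0..1}" "k (\<beta> (\<tau> * t)) = \<sigma> e s"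
        by blast
      have "k (\<beta> (\<tau> * t)) \<notin> \<sigma> e ` {T e..1}"
        using bspec[OF r'(2) small(2)[of t]] t True by auto
      then have "s < T e"
        using s by force
      then have "\<beta> (\<tau> * t) = c e (s / T e)" "s / T e \<in> {0..1}"
        using s fk[of "\<beta> (\<tau> * t)"] T(1)[OF True] by (auto simp: c_def)
      then have "\<beta> (\<tau> * t) \<in> path_image (c e)"
        unfolding path_image_def by blast
      then have "\<beta> (\<tau> * t) \<in> wheel"
        using True unfolding wheel_def by blast
      then show False
        using not_wheel t by blast
    qed
  qed
  have \<gamma>'_vertex: "\<gamma>' t \<notin> p ` V" if t: "0 < t" "t \<le> 1" for t
  proof
    assume "\<gamma>' t \<in> p ` V"
    moreover have "\<gamma>' t \<notin> X"
      using disc(2)[OF small(1)] t by (simp add: \<gamma>'_def)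
    ultimately have "\<gamma>' t = \<gamma>' 0"
      using \<gamma>'_0 by (auto simp: X_def)
    then show False
      using inj_onD[OF \<gamma>'_inj, of t 0] t by auto
  qed
  define q where "q = p(x := \<gamma>' 1)"
  define \<eta> where "\<eta> = \<gamma>({x, v} := \<gamma>')"
  have new: "{x, v} \<notin> E"
    using Esub x by blast
  have q_V: "q ` A = p ` A" if "A \<subseteq> V" for A
    using that x by (auto simp: q_def)
  have \<eta>_E: "\<eta> e = \<gamma> e" if "e \<in> E" for e
    using that new by (auto simp: \<eta>_def)
  have \<eta>_new: "\<eta> {x, v} = \<gamma>'"
    by (simp add: \<eta>_def)
  have qx: "q x = \<gamma>' 1"
    by (simp add: q_def)
  have qins: "q ` insert x V = insert (\<gamma>' 1) (p ` V)"
    using q_V[of V] qx by simp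
  have "\<gamma>' 1 \<in> topspace S"
    using \<gamma>'_path by (auto simp: pathin_def continuous_map_def Pi_iff)
  then have "q ` insert x V \<subseteq> topspace S"
    using p qins by simp
  moreover have "inj_on q (insert x V)"
  proof -
    have "inj_on q V"
      using p(2) x by (metis inj_on_cong q_def fun_upd_apply)
    moreover have "q x \<notin> q ` (V - {x})"
      using \<gamma>'_vertex[of 1] q_V[of "V - {x}"] qx by auto
    ultimately show ?thesis
      by simp
  qed
  moreover have "pathin S (\<eta> e) \<and> inj_on (\<eta> e) {0..1} \<and> {\<eta> e 0, \<eta> e 1} = q ` e \<and>
      \<eta> e ` {0<..<1} \<inter> q ` insert x V = {}" if "e \<in> insert {x, v} E" for e
  proof (cases "e = {x, v}")
    case True
    have "q v = p v"
      using v x by (auto simp: q_def)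
    then have "{\<gamma>' 0, \<gamma>' 1} = q ` {x, v}"
      using qx \<gamma>'_0 by auto
    moreover have "\<gamma>' t \<notin> insert (\<gamma>' 1) (p ` V)" if "t \<in> {0<..<1}" for t
      using \<gamma>'_vertex[of t] inj_onD[OF \<gamma>'_inj, of t 1] that by auto
    then have "\<gamma>' ` {0<..<1} \<inter> q ` insert x V = {}"
      unfolding qins by blast
    ultimately show ?thesis
      unfolding True \<eta>_new using \<gamma>'_path \<gamma>'_inj by (intro conjI)
  next
    case False
    then have e: "e \<in> E"
      using that by simp
    have "\<gamma>' 1 \<notin> \<gamma> e ` {0<..<1}"
      using \<gamma>'_edge[OF _ _ e, of 1] by auto
    from Int_insert_right_if0[OF this] have "\<gamma> e ` {0<..<1} \<inter> q ` insert x V = {}"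
      unfolding qins using \<gamma>(4)[OF e] by simp
    then show ?thesis
      unfolding \<eta>_E[OF e] q_V[OF Esub(1)[OF e]] using \<gamma>(1,2,3)[OF e] by (intro conjI)
  qed
  moreover have "\<eta> e ` {0<..<1} \<inter> \<eta> e' ` {0<..<1} = {}"
    if "e \<in> insert {x, v} E" "e' \<in> insert {x, v} E" "e \<noteq> e'" for e e'
  proof -
    have *: "\<gamma>' ` {0<..<1} \<inter> \<gamma> d ` {0<..<1} = {}" if "d \<in> E" for d
    proof -
      have "\<gamma> d ` {0<..<1} \<subseteq> \<gamma> d ` {0..1}"
        by (intro image_mono) auto
      moreover have "\<gamma>' ` {0<..<1} \<inter> \<gamma> d ` {0..1} = {}"
      proof (rule equals0I)
        fix z assume "z \<in> \<gamma>' ` {0<..<1} \<inter> \<gamma> d ` {0..1}"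
        then obtain t where "t \<in> {0<..<1}" "\<gamma>' t \<in> \<gamma> d ` {0..1}"
          by blast
        then show False
          using \<gamma>'_edge[OF _ _ that, of t] by simp
      qed
      ultimately show ?thesis
        by blast
    qed
    consider "e = {x, v}" "e' \<in> E" | "e \<in> E" "e' = {x, v}" | "e \<in> E" "e' \<in> E"
      using \<open>e \<in> insert {x, v} E\<close> \<open>e' \<in> insert {x, v} E\<close> \<open>e \<noteq> e'\<close> by blast
    then show ?thesis
    proof cases
      case 1
      then show ?thesis
        using *[of e'] \<eta>_E \<eta>_new by simp
    next
      case 2
      then show ?thesis
        using *[of e] \<eta>_E \<eta>_new by (simp add: Int_commute)
    next
      case 3
      then show ?thesis
        using \<gamma>_disj \<open>e \<noteq> e'\<close> \<eta>_E by simp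
    qed
  qed
  ultimately show ?thesis
    unfolding embeds_in_def fst_conv snd_conv by (intro exI[of _ q] exI[of _ \<eta>] conjI ballI impI) auto
qed

section \<open>Minor-closed classes and pendant vertices\<close>

definition relabel :: "('a \<Rightarrow> 'b) \<Rightarrow> 'a graph \<Rightarrow> 'b graph" where
  "relabel f G = (f ` fst G, (`) f ` snd G)"

lemma fst_relabel [simp]: "fst (relabel f G) = f ` fst G"
  by (simp add: relabel_def)

lemma snd_relabel [simp]: "snd (relabel f G) = (`) f ` snd G"
  by (simp add: relabel_def)

lemma simple_graph_edge:
  assumes "simple_graph G" "e \<in> snd G"
  shows "e \<subseteq> fst G" "card e = 2" "finite e"
  using assms by (auto simp: simple_graph_def intro: card_ge_0_finite)

lemma simple_graph_edges_subset: "simple_graph G \<Longrightarrow> snd G \<subseteq> Pow (fst G)"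
  by (auto simp: simple_graph_def)

lemma no_edge_in_singleton: "e \<subseteq> {y} \<Longrightarrow> card e = 2 \<Longrightarrow> False"
  using card_mono[of "{y}" e] by simp

lemma simple_graph_relabel:
  assumes "simple_graph G" "inj_on f (fst G)"
  shows "simple_graph (relabel f G)"
proof -
  have "card (f ` e) = 2" if "e \<in> snd G" for e
    using simple_graph_edge[OF assms(1) that] assms(2)
    by (metis card_image inj_on_subset)
  then show ?thesis
    using assms simple_graph_edge(1)[OF assms(1)] by (fastforce simp: simple_graph_def)
qed

lemma relabel_inv_into:
  assumes "simple_graph G" "inj_on f (fst G)"
  shows "relabel (inv_into (fst G) f) (relabel f G) = G"
proof -
  have "inv_into (fst G) f ` f ` A = A" if "A \<subseteq> fst G" for A
    using that assms(2) by (rule inv_into_image_cancel[rotated])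
  then have "(`) (inv_into (fst G) f) ` (`) f ` snd G = snd G"
    using simple_graph_edge(1)[OF assms(1)] by (force simp: image_image)
  then show ?thesis
    using assms by (simp add: relabel_def inv_into_image_cancel)
qed

lemma minor_step_simple_graph:
  assumes "minor_step G H" "simple_graph G"
  shows "simple_graph H"
  using assms
proof (induction rule: minor_step.induct)
  case (contract_edge u v E V)
  then have E: "\<And>e. e \<in> E \<Longrightarrow> e \<subseteq> V \<and> card e = 2"
    by (auto simp: simple_graph_def)
  have "u \<in> V" "v \<in> V"
    using E contract_edge by auto
  moreover have "w \<in> V" "w \<noteq> v" if "{v, w} \<in> E" for w
    using E[OF that] by auto
  ultimately show ?case
    using E contract_edge by (auto simp: simple_graph_def card_2_iff)
qed (auto simp: simple_graph_def)

lemma is_minor_simple_graph: "is_minor H G \<Longrightarrow> simple_graph G \<Longrightarrow> simple_graph H"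
  unfolding is_minor_def by (induction rule: rtranclp_induct) (auto intro: minor_step_simple_graph)

lemma minor_step_vertices: "minor_step G H \<Longrightarrow> fst H \<subseteq> fst G"
  by (induction rule: minor_step.induct) auto

lemma is_minor_vertices: "is_minor H G \<Longrightarrow> fst H \<subseteq> fst G"
  unfolding is_minor_def by (induction rule: rtranclp_induct) (auto dest: minor_step_vertices)

lemma minor_step_relabel:
  assumes "minor_step G H" "simple_graph G" "inj_on f (fst G)"
  shows "minor_step (relabel f G) (relabel f H)"
  using assms
proof (induction rule: minor_step.induct)
  case (delete_edge e E V)
  have EV: "E \<subseteq> Pow V" and inj: "inj_on ((`) f) (Pow V)"
    using simple_graph_edges_subset[of "(V, E)"] delete_edge by (auto simp: inj_on_image_Pow)
  have "(`) f ` (E - {e}) = (`) f ` E - {f ` e}"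
    using inj_on_image_set_diff[OF inj, of E "{e}"] EV delete_edge by auto
  then show ?case
    using minor_step.delete_edge[of "f ` e" "(`) f ` E" "f ` V"] delete_edge by (simp add: relabel_def)
next
  case (delete_vertex v V E)
  have EV: "E \<subseteq> Pow V" and inj: "inj_on f V"
    using simple_graph_edges_subset[of "(V, E)"] delete_vertex by auto
  have "f ` V \<noteq> {f v}"
    using delete_vertex inj inj_on_image_eq_iff[OF inj, of V "{v}"] by auto
  then have "minor_step (f ` V, (`) f ` E) (f ` V - {f v}, {e \<in> (`) f ` E. f v \<notin> e})"
    using delete_vertex by (intro minor_step.delete_vertex) auto
  moreover have "{e \<in> (`) f ` E. f v \<notin> e} = (`) f ` {e \<in> E. v \<notin> e}"
    using EV inj delete_vertex(1) inj_on_image_mem_iff[OF inj] by blast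
  moreover have "f ` (V - {v}) = f ` V - {f v}"
    using inj delete_vertex by (simp add: inj_on_image_set_diff)
  ultimately show ?case
    by (simp add: relabel_def)
next
  case (contract_edge u v E V)
  have EV: "E \<subseteq> Pow V" and inj: "inj_on f V"
    using simple_graph_edges_subset[of "(V, E)"] contract_edge by auto
  have uv: "u \<in> V" "v \<in> V"
    using EV contract_edge by auto
  have injP: "inj_on ((`) f) (Pow V)"
    using inj by (simp add: inj_on_image_Pow)
  have "f ` {u, v} \<in> (`) f ` E"
    using contract_edge by blast
  moreover have "f u \<noteq> f v"
    using inj uv contract_edge by (auto dest: inj_onD)
  ultimately have "minor_step (f ` V, (`) f ` E) (f ` V - {f v},
      {e \<in> (`) f ` E. f v \<notin> e} \<union> {{f u, w} |w. {f v, w} \<in> (`) f ` E \<and> w \<noteq> f u})"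
    by (intro minor_step.contract_edge) auto
  moreover have "{e \<in> (`) f ` E. f v \<notin> e} = (`) f ` {e \<in> E. v \<notin> e}"
    using EV uv inj_on_image_mem_iff[OF inj] by blast
  moreover have "{{f u, w} |w. {f v, w} \<in> (`) f ` E \<and> w \<noteq> f u} =
      (`) f ` {{u, w} |w. {v, w} \<in> E \<and> w \<noteq> u}"
  proof (intro equalityI subsetI)
    fix d assume "d \<in> {{f u, w} |w. {f v, w} \<in> (`) f ` E \<and> w \<noteq> f u}"
    then obtain w' where w': "d = {f u, w'}" "{f v, w'} \<in> (`) f ` E" "w' \<noteq> f u"
      by blast
    then obtain e where e: "e \<in> E" "{f v, w'} = f ` e"
      by blast
    then obtain w where w: "w \<in> V" "w' = f w"
      using EV by blast
    then have "f ` {v, w} = f ` e"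
      using e by simp
    then have "{v, w} = e"
      using inj_onD[OF injP] EV e uv w by blast
    then have "{u, w} \<in> {{u, w} |w. {v, w} \<in> E \<and> w \<noteq> u}"
      using e w' w by auto
    moreover have "d = f ` {u, w}"
      using w w' by simp
    ultimately show "d \<in> (`) f ` {{u, w} |w. {v, w} \<in> E \<and> w \<noteq> u}"
      by blast
  next
    fix d assume "d \<in> (`) f ` {{u, w} |w. {v, w} \<in> E \<and> w \<noteq> u}"
    then obtain w where w: "d = f ` {u, w}" "{v, w} \<in> E" "w \<noteq> u"
      by blast
    then have "w \<in> V" "f ` {v, w} \<in> (`) f ` E"
      using EV by blast+
    then have "f w \<noteq> f u" "{f v, f w} \<in> (`) f ` E"
      using inj uv w by (auto dest: inj_onD)
    then show "d \<in> {{f u, w} |w. {f v, w} \<in> (`) f ` E \<and> w \<noteq> f u}"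
      using w by auto
  qed
  moreover have "f ` (V - {v}) = f ` V - {f v}"
    using inj uv by (simp add: inj_on_image_set_diff)
  ultimately show ?case
    by (simp add: relabel_def image_Un)
qed

lemma is_minor_relabel:
  assumes "is_minor H G" "simple_graph G" "inj_on f (fst G)"
  shows "is_minor (relabel f H) (relabel f G)"
  using assms(1) unfolding is_minor_def
proof (induction rule: rtranclp_induct)
  case (step H H')
  then have "is_minor H G"
    by (simp add: is_minor_def)
  then have "simple_graph H" "inj_on f (fst H)"
    using assms is_minor_simple_graph is_minor_vertices inj_on_subset by metis+
  with step.hyps(2) have "minor_step (relabel f H) (relabel f H')"
    by (rule minor_step_relabel)
  then show ?case
    using step.IH by (rule rtranclp.rtrancl_into_rtrancl[rotated])
qed simp

section \<open>Contractions as quotients by vertex maps\<close>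

definition contraction :: "'v graph \<Rightarrow> 'v \<Rightarrow> 'v \<Rightarrow> 'v graph" where
  "contraction G u v =
     (fst G - {v}, {e \<in> snd G. v \<notin> e} \<union> {{u, w} |w. {v, w} \<in> snd G \<and> w \<noteq> u})"

text \<open>The quotient by a vertex map, where edges inside a fibre disappear. Quotients compose,
  which makes it possible to treat the contraction of a whole matching as one map.\<close>

definition collapse :: "('v \<Rightarrow> 'v) \<Rightarrow> 'v graph \<Rightarrow> 'v graph" where
  "collapse f G = (f ` fst G, {f ` e |e. e \<in> snd G \<and> card (f ` e) = 2})"

lemma collapse_eq_contraction:
  assumes "simple_graph G" "{u, v} \<in> snd G"
  shows "collapse (id(v := u)) G = contraction G u v"
proof -
  let ?f = "id(v := u)"
  have uv: "u \<noteq> v" "u \<in> fst G"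
    using simple_graph_edge[OF assms] by auto
  have 1: "?f ` e = e" if "v \<notin> e" for e
    using that by (auto simp: image_iff)
  have 2: "?f ` {v, w} = {u, w}" if "v \<noteq> w" for w
    using that by auto
  have "{?f ` e |e. e \<in> snd G \<and> card (?f ` e) = 2} =
      {e \<in> snd G. v \<notin> e} \<union> {{u, w} |w. {v, w} \<in> snd G \<and> w \<noteq> u}"
  proof (intro equalityI subsetI)
    fix d assume "d \<in> {?f ` e |e. e \<in> snd G \<and> card (?f ` e) = 2}"
    then obtain e where e: "e \<in> snd G" "card (?f ` e) = 2" "d = ?f ` e"
      by blast
    show "d \<in> {e \<in> snd G. v \<notin> e} \<union> {{u, w} |w. {v, w} \<in> snd G \<and> w \<noteq> u}"
    proof (cases "v \<in> e")
      case True
      then obtain w where w: "e = {v, w}" "v \<noteq> w"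
        using simple_graph_edge(2)[OF assms(1) e(1)] by (auto simp: card_2_iff)
      then have "d = {u, w}"
        using 2[OF w(2)] e(3) by simp
      moreover from this have "w \<noteq> u"
        using e(2,3) by auto
      ultimately show ?thesis
        using e(1) w(1) by blast
    next
      case False
      then show ?thesis
        using 1 e by simp
    qed
  next
    fix d assume "d \<in> {e \<in> snd G. v \<notin> e} \<union> {{u, w} |w. {v, w} \<in> snd G \<and> w \<noteq> u}"
    then consider "d \<in> snd G" "v \<notin> d" | w where "d = {u, w}" "{v, w} \<in> snd G" "w \<noteq> u"
      by blast
    then show "d \<in> {?f ` e |e. e \<in> snd G \<and> card (?f ` e) = 2}"
    proof cases
      case 1
      then have "d = ?f ` d"
        using \<open>\<And>e. v \<notin> e \<Longrightarrow> ?f ` e = e\<close> by simp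
      moreover have "card d = 2"
        using simple_graph_edge(2)[OF assms(1) 1(1)] .
      ultimately show ?thesis
        using 1(1) by (metis (mono_tags, lifting) mem_Collect_eq)
    next
      case 2
      have "v \<noteq> w"
        using simple_graph_edge(2)[OF assms(1) 2(2)] by auto
      then have "?f ` {v, w} = {u, w}"
        by auto
      moreover have "card {u, w} = 2"
        using 2(3) by simp
      ultimately show ?thesis
        using 2 by (metis (mono_tags, lifting) mem_Collect_eq)
    qed
  qed
  moreover have "?f ` fst G = fst G - {v}"
    using uv by (auto simp: image_iff)
  ultimately show ?thesis
    by (simp add: collapse_def contraction_def)
qed

locale graph_class =
  fixes \<B> :: "nat graph set"
  assumes simple: "G \<in> \<B> \<Longrightarrow> simple_graph G"
    and iso: "G \<in> \<B> \<Longrightarrow> inj_on f (fst G) \<Longrightarrow> relabel f G \<in> \<B>"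
    and minor: "G \<in> \<B> \<Longrightarrow> minor_step G H \<Longrightarrow> H \<in> \<B>"
begin

lemma is_minor: "G \<in> \<B> \<Longrightarrow> is_minor H G \<Longrightarrow> H \<in> \<B>"
  unfolding is_minor_def by (rotate_tac 1, induction rule: rtranclp_induct) (auto intro: minor)

end

locale leaf_closed_class = graph_class +
  assumes leaf: "(V, E) \<in> \<B> \<Longrightarrow> v \<in> V \<Longrightarrow> x \<notin> V \<Longrightarrow> (insert x V, insert {x, v} E) \<in> \<B>"
    and nonempty: "\<B> \<noteq> {}"

text \<open>A minor of \<open>relabel f G\<close> is pulled back along the inverse of
  \<open>f\<close> to a minor of \<open>G\<close>, which lies in \<open>\<A>\<close>, and is then
  renamed by \<open>f\<close> again.\<close>

lemma graph_class_Minor_class: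
  assumes iso: "\<And>G f. G \<in> \<A> \<Longrightarrow> simple_graph G \<Longrightarrow> inj_on f (fst G) \<Longrightarrow> relabel f G \<in> \<A>"
  shows "graph_class (Minor_class \<A>)"
proof
  fix G and f :: "nat \<Rightarrow> nat"
  assume G: "G \<in> Minor_class \<A>" and f: "inj_on f (fst G)"
  then have simple: "simple_graph G"
    by (simp add: Minor_class_def)
  have "H \<in> \<A>" if H: "is_minor H (relabel f G)" for H
  proof -
    define k where "k = inv_into (fst G) f"
    have Hs: "simple_graph H" "fst H \<subseteq> f ` fst G"
      using is_minor_simple_graph[OF H] simple_graph_relabel[OF simple f] is_minor_vertices[OF H] by auto
    have "inj_on k (f ` fst G)"
      unfolding k_def by (rule inj_on_inv_into) simp
    then have "is_minor (relabel k H) (relabel k (relabel f G))"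
      using is_minor_relabel[OF H] simple_graph_relabel[OF simple f] by simp
    then have "is_minor (relabel k H) G"
      using relabel_inv_into[OF simple f] by (simp add: k_def)
    then have "relabel k H \<in> \<A>" "simple_graph (relabel k H)" "fst (relabel k H) \<subseteq> fst G"
      using G is_minor_simple_graph simple is_minor_vertices unfolding Minor_class_def by blast+
    then have "relabel f (relabel k H) \<in> \<A>"
      using iso[of "relabel k H" f] inj_on_subset[OF f] by metis
    moreover have fk: "f ` k ` A = A" if "A \<subseteq> f ` fst G" for A
      using that unfolding k_def by (rule image_inv_into_cancel[OF refl])
    have "f ` k ` e = e" if "e \<in> snd H" for e
      using subset_trans[OF simple_graph_edge(1)[OF Hs(1) that] Hs(2)] by (rule fk)
    then have "(`) f ` (`) k ` snd H = snd H"
      by (simp add: image_image)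
    then have "relabel f (relabel k H) = H"
      using fk[OF Hs(2)] by (simp add: relabel_def)
    ultimately show ?thesis
      by simp
  qed
  then show "relabel f G \<in> Minor_class \<A>"
    using simple_graph_relabel[OF simple f] by (simp add: Minor_class_def)
next
  fix G H :: "nat graph"
  assume G: "G \<in> Minor_class \<A>" and H: "minor_step G H"
  have "is_minor K G" if "is_minor K H" for K
    using that H unfolding is_minor_def by (rule converse_rtranclp_into_rtranclp[rotated])
  then show "H \<in> Minor_class \<A>"
    using G minor_step_simple_graph[OF H] by (auto simp: Minor_class_def)
qed (simp add: Minor_class_def)

text \<open>Every minor of a graph with a pendant vertex \<open>x\<close> is a minor of the graph itself, possibly
  together with \<open>x\<close> as a pendant or isolated vertex.\<close>

inductive pendant_or_isolated :: "nat graph set \<Rightarrow> nat \<Rightarrow> nat graph \<Rightarrow> bool" for \<B> x where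
  member: "G \<in> \<B> \<Longrightarrow> pendant_or_isolated \<B> x G"
| isolated: "(V, E) \<in> \<B> \<Longrightarrow> x \<notin> V \<Longrightarrow> pendant_or_isolated \<B> x (insert x V, E)"
| pendant: "(V, E) \<in> \<B> \<Longrightarrow> x \<notin> V \<Longrightarrow> v \<in> V \<Longrightarrow> pendant_or_isolated \<B> x (insert x V, insert {x, v} E)"

text \<open>The three shapes are preserved by each minor operation, so they cover all minors of a
  graph with an added leaf. The assumption \<open>single\<close> handles the deletion of the last
  vertex other than \<open>x\<close>.\<close>

lemma (in graph_class) pendant_or_isolated_minor_step:
  assumes "pendant_or_isolated \<B> x G" "minor_step G H" and single: "({x}, {}) \<in> \<B>"
  shows "pendant_or_isolated \<B> x H"
  using assms(1)
proof cases
  case member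
  then show ?thesis
    using assms(2) minor pendant_or_isolated.member by blast
next
  case (isolated V E)
  have EV: "\<And>e. e \<in> E \<Longrightarrow> e \<subseteq> V \<and> card e = 2"
    using simple[OF isolated(2)] by (auto simp: simple_graph_def)
  from assms(2) show ?thesis
    unfolding isolated(1)
  proof cases
    case (delete_edge e)
    then show ?thesis
      using minor[OF isolated(2) minor_step.delete_edge] isolated pendant_or_isolated.isolated by auto
  next
    case (delete_vertex y)
    show ?thesis
    proof (cases "y = x")
      case True
      then have "H = (V, E)"
        using delete_vertex EV isolated by auto
      then show ?thesis
        using isolated pendant_or_isolated.member by simp
    next
      case False
      show ?thesis
      proof (cases "V = {y}")
        case True
        then have "e \<notin> E" for e
          using EV[of e] no_edge_in_singleton[of e y] by blast
        then have "E = {}"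
          by blast
        then have "H = ({x}, {})"
          using True delete_vertex False by auto
        then show ?thesis
          using single pendant_or_isolated.member by simp
      next
        case ne: False
        have "(V - {y}, {e \<in> E. y \<notin> e}) \<in> \<B>"
          using minor[OF isolated(2) minor_step.delete_vertex] ne False delete_vertex by auto
        moreover have "insert x V - {y} = insert x (V - {y})"
          using False by auto
        ultimately show ?thesis
          using delete_vertex isolated pendant_or_isolated.isolated by simp
      qed
    qed
  next
    case (contract_edge u v)
    have "insert x V - {v} = insert x (V - {v})"
      using EV[OF contract_edge(2)] isolated by auto
    then show ?thesis
      using minor[OF isolated(2) minor_step.contract_edge[OF contract_edge(2,3)]] contract_edge
        isolated pendant_or_isolated.isolated by simp
  qed
next
  case (pendant V E v)
  have EV: "\<And>e. e \<in> E \<Longrightarrow> e \<subseteq> V \<and> card e = 2"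
    using simple[OF pendant(2)] by (auto simp: simple_graph_def)
  then have xE: "{x, v} \<notin> E" "\<And>e. e \<in> E \<Longrightarrow> x \<notin> e" "\<And>w. {x, w} \<notin> E"
    using pendant by blast+
  have xv: "x \<noteq> v"
    using pendant by auto
  from assms(2) show ?thesis
    unfolding pendant(1)
  proof cases
    case (delete_edge e)
    show ?thesis
    proof (cases "e = {x, v}")
      case True
      then show ?thesis
        using delete_edge xE pendant pendant_or_isolated.isolated by simp
    next
      case False
      then have "H = (insert x V, insert {x, v} (E - {e}))" "e \<in> E"
        using delete_edge by auto
      then show ?thesis
        using minor[OF pendant(2) minor_step.delete_edge] pendant pendant_or_isolated.pendant by auto
    qed
  next
    case (delete_vertex y)
    show ?thesis
    proof (cases "y = x")
      case True
      then have "H = (V, E)"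
        using delete_vertex xE pendant by auto
      then show ?thesis
        using pendant pendant_or_isolated.member by simp
    next
      case False
      then have ins: "insert x V - {y} = insert x (V - {y})" and y: "y \<in> V"
        using delete_vertex by auto
      show ?thesis
      proof (cases "V = {y}")
        case True
        then have "e \<notin> E" for e
          using EV[of e] no_edge_in_singleton[of e y] by blast
        then have "v = y" "E = {}"
          using pendant True by blast+
        then have "H = ({x}, {})"
          using delete_vertex True False by auto
        then show ?thesis
          using single pendant_or_isolated.member by simp
      next
        case ne: False
        have B: "(V - {y}, {e \<in> E. y \<notin> e}) \<in> \<B>"
          using minor[OF pendant(2) minor_step.delete_vertex] ne y by auto
        show ?thesis
        proof (cases "y = v")
          case True
          then have "{e \<in> insert {x, v} E. y \<notin> e} = {e \<in> E. y \<notin> e}"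
            by auto
          then show ?thesis
            using B delete_vertex ins pendant pendant_or_isolated.isolated by simp
        next
          case yv: False
          then have "{e \<in> insert {x, v} E. y \<notin> e} = insert {x, v} {e \<in> E. y \<notin> e}"
            using False by auto
          then show ?thesis
            using B delete_vertex ins pendant yv pendant_or_isolated.pendant[OF B] by simp
        qed
      qed
    qed
  next
    case (contract_edge a b)
    show ?thesis
    proof (cases "{a, b} = {x, v}")
      case True
      then consider "a = v" "b = x" | "a = x" "b = v"
        by (auto simp: doubleton_eq_iff)
      then show ?thesis
      proof cases
        case 1
        have "{{a, w} |w. {b, w} \<in> insert {x, v} E \<and> w \<noteq> a} = {}"
          using 1 xE by (auto simp: doubleton_eq_iff)
        moreover have "{e \<in> insert {x, v} E. b \<notin> e} = E"
          using 1 xE by auto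
        ultimately have "H = (V, E)"
          using contract_edge 1 pendant by auto
        then show ?thesis
          using pendant pendant_or_isolated.member by simp
      next
        case 2
        \<comment> \<open>Contracting the pendant edge towards \<open>x\<close> keeps the name
          \<open>x\<close>, so the result is the old graph with \<open>v\<close> renamed to
          \<open>x\<close>.\<close>
        define f where "f = id(v := x)"
        have inj: "inj_on f V"
          using pendant by (auto simp: f_def inj_on_def)
        then have "relabel f (V, E) \<in> \<B>"
          using iso[OF pendant(2)] by simp
        moreover have "H = relabel f (V, E)"
        proof -
          have "H = contraction G x v"
            unfolding contraction_def pendant(1) fst_conv snd_conv using contract_edge(1) 2 by simp
          also have "\<dots> = collapse f G"
            unfolding f_def using simple[OF pendant(2)] pendant xv
            by (intro collapse_eq_contraction[symmetric]) (auto simp: simple_graph_def)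
          also have "\<dots> = relabel f (V, E)"
          proof (rule prod_eqI)
            show "fst (collapse f G) = fst (relabel f (V, E))"
              using pendant by (auto simp: collapse_def f_def)
            have "card (f ` e) = 2" if "e \<in> E" for e
              using EV[OF that] card_image[OF inj_on_subset[OF inj]] by simp
            moreover have "f ` {x, v} = {x}"
              using xv by (auto simp: f_def)
            then have "card (f ` {x, v}) \<noteq> 2"
              by simp
            ultimately show "snd (collapse f G) = snd (relabel f (V, E))"
              unfolding collapse_def pendant(1) by auto
          qed
          finally show ?thesis .
        qed
        ultimately show ?thesis
          using pendant_or_isolated.member by simp
      qed
    next
      case False
      then have ab: "{a, b} \<in> E"
        using contract_edge by simp
      then have abV: "a \<in> V" "b \<in> V" "b \<noteq> x"
        using EV[OF ab] pendant by auto
      define E' where "E' = {e \<in> E. b \<notin> e} \<union> {{a, w} |w. {b, w} \<in> E \<and> w \<noteq> a}"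
      have B: "(V - {b}, E') \<in> \<B>"
        using minor[OF pendant(2) minor_step.contract_edge[OF ab contract_edge(3)]] by (simp add: E'_def)
      have ins: "insert x V - {b} = insert x (V - {b})"
        using abV by auto
      show ?thesis
      proof (cases "b = v")
        case True
        \<comment> \<open>When the attachment vertex is absorbed by \<open>a\<close>, the pendant
          edge moves to \<open>a\<close>.\<close>
        have "{e \<in> insert {x, v} E. b \<notin> e} \<union> {{a, w} |w. {b, w} \<in> insert {x, v} E \<and> w \<noteq> a} = insert {x, a} E'"
          using True abV pendant xv by (auto simp: E'_def doubleton_eq_iff)
        then show ?thesis
          using contract_edge ins pendant_or_isolated.pendant[OF B, of x a] pendant abV by simp
      next
        case bv: False
        have "{e \<in> insert {x, v} E. b \<notin> e} \<union> {{a, w} |w. {b, w} \<in> insert {x, v} E \<and> w \<noteq> a} = insert {x, v} E'"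
          using bv abV by (auto simp: E'_def doubleton_eq_iff)
        then show ?thesis
          using contract_edge ins pendant_or_isolated.pendant[OF B, of x v] pendant bv by simp
      qed
    qed
  qed
qed

text \<open>Properties to be checked for \<open>\<A>\<close> directly on surfaces. They are
  inherited by intersections, and deleting the edge of a new leaf also yields isolated
  vertices.\<close>

locale leaf_extendable =
  fixes \<A> :: "nat graph set"
  assumes relabelled: "G \<in> \<A> \<Longrightarrow> simple_graph G \<Longrightarrow> inj_on f (fst G) \<Longrightarrow> relabel f G \<in> \<A>"
    and leaf: "(V, E) \<in> \<A> \<Longrightarrow> simple_graph (V, E) \<Longrightarrow> v \<in> V \<Longrightarrow> x \<notin> V \<Longrightarrow>
      (insert x V, insert {x, v} E) \<in> \<A>"
    and edge: "(V, E) \<in> \<A> \<Longrightarrow> (V, E - {e}) \<in> \<A>"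
    and single: "({x}, {}) \<in> \<A>"

lemma leaf_extendable_Int:
  assumes "leaf_extendable \<A>" "leaf_extendable \<A>'"
  shows "leaf_extendable (\<A> \<inter> \<A>')"
proof -
  interpret A: leaf_extendable \<A> by (rule assms(1))
  interpret A': leaf_extendable \<A>' by (rule assms(2))
  show ?thesis
    by unfold_locales
      (blast intro: A.relabelled A'.relabelled, blast intro: A.leaf A'.leaf, blast intro: A.edge A'.edge,
        blast intro: A.single A'.single)
qed

text \<open>Every minor of the extended graph is a member of the minor-closed class, possibly with
  \<open>x\<close> attached or isolated, and each of these shapes lies in
  \<open>\<A>\<close>.\<close>

lemma (in leaf_extendable) leaf_closed_class_Minor_class: "leaf_closed_class (Minor_class \<A>)"
proof -
  interpret graph_class "Minor_class \<A>"
    using relabelled by (rule graph_class_Minor_class)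
  have single': "({x}, {}) \<in> Minor_class \<A>" for x
  proof -
    have "H = ({x}, {})" if "is_minor H ({x}, {})" for H :: "nat graph"
      using that unfolding is_minor_def
    proof (induction rule: rtranclp_induct)
      case (step H H')
      then show ?case
        by (auto elim: minor_step.cases)
    qed simp
    then show ?thesis
      using single by (auto simp: Minor_class_def simple_graph_def)
  qed
  have sub: "Minor_class \<A> \<subseteq> \<A>"
    by (auto simp: Minor_class_def is_minor_def)
  have in_A: "G \<in> \<A>" if "pendant_or_isolated (Minor_class \<A>) x G" for G x
    using that
  proof cases
    case (isolated V E)
    obtain v where v: "v \<in> V"
      using simple[OF isolated(2)] by (auto simp: simple_graph_def)
    \<comment> \<open>The isolated vertex arises by attaching \<open>x\<close> as a leaf and
      deleting its edge.\<close>
    then have "(insert x V, insert {x, v} E - {{x, v}}) \<in> \<A>"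
      using leaf edge isolated simple[OF isolated(2)] sub by blast
    moreover have "{x, v} \<notin> E"
      using simple[OF isolated(2)] isolated by (auto simp: simple_graph_def)
    ultimately show ?thesis
      using isolated by simp
  next
    case (pendant V E v)
    then show ?thesis
      using leaf[of V E v x] simple[OF pendant(2)] sub by auto
  qed (use sub in auto)
  show ?thesis
  proof
    fix V E and v x :: nat
    assume VE: "(V, E) \<in> Minor_class \<A>" "v \<in> V" "x \<notin> V"
    define G where "G = (insert x V, insert {x, v} E)"
    have "pendant_or_isolated (Minor_class \<A>) x H" if "is_minor H G" for H
      using that unfolding is_minor_def
    proof (induction rule: rtranclp_induct)
      case base
      then show ?case
        using VE pendant_or_isolated.pendant unfolding G_def by blast
    next
      case (step H H')
      then show ?case
        using pendant_or_isolated_minor_step single' by blast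
    qed
    moreover have "card {x, v} = 2"
      using VE by (simp add: card_2_iff) blast
    then have "simple_graph G"
      using simple[OF VE(1)] VE by (auto simp: G_def simple_graph_def)
    ultimately show "(insert x V, insert {x, v} E) \<in> Minor_class \<A>"
      using in_A unfolding G_def Minor_class_def by blast
  qed (use single' in auto)
qed

section \<open>Counting leaves\<close>

definition leaves :: "'v graph \<Rightarrow> 'v set" where
  "leaves G = {v \<in> fst G. card {e \<in> snd G. v \<in> e} = 1}"

lemma num_leaves_eq: "num_leaves G = card (leaves G)"
  by (simp add: num_leaves_def leaves_def)

lemma leaves_subset: "leaves G \<subseteq> fst G"
  by (auto simp: leaves_def)

lemma finite_leaves: "simple_graph G \<Longrightarrow> finite (leaves G)"
  using finite_subset[OF leaves_subset[of G]] by (auto simp: simple_graph_def)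

lemma num_leaves_relabel:
  assumes "simple_graph G" "inj_on f (fst G)"
  shows "num_leaves (relabel f G) = num_leaves G"
proof -
  have inj: "inj_on ((`) f) (Pow (fst G))"
    using assms by (simp add: inj_on_image_Pow)
  have "card {e \<in> (`) f ` snd G. f v \<in> e} = card {e \<in> snd G. v \<in> e}" if v: "v \<in> fst G" for v
  proof -
    have "f v \<in> f ` e \<longleftrightarrow> v \<in> e" if "e \<in> snd G" for e
      using inj_on_image_mem_iff[OF assms(2) v simple_graph_edge(1)[OF assms(1) that]] .
    then have "{e \<in> (`) f ` snd G. f v \<in> e} = (`) f ` {e \<in> snd G. v \<in> e}"
      by auto
    moreover have "inj_on ((`) f) {e \<in> snd G. v \<in> e}"
      using inj simple_graph_edges_subset[OF assms(1)] by (auto intro: inj_on_subset)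
    ultimately show ?thesis
      by (simp add: card_image)
  qed
  then have "leaves (relabel f G) = f ` leaves G"
    by (auto simp: leaves_def)
  moreover have "inj_on f (leaves G)"
    using assms(2) leaves_subset by (rule inj_on_subset)
  ultimately show ?thesis
    by (simp add: num_leaves_eq card_image)
qed

lemma finite_graphs_on:
  assumes "finite W"
  shows "finite {G. simple_graph G \<and> fst G = W}"
proof (rule finite_subset)
  show "{G. simple_graph G \<and> fst G = W} \<subseteq> {W} \<times> Pow (Pow W)"
    using simple_graph_edge(1) by fastforce
qed (use assms in auto)

lemma leaf_unique_edge:
  assumes "simple_graph G" "x \<in> leaves G"
  obtains y where "y \<in> fst G" "y \<noteq> x" "{x, y} \<in> snd G"
    "snd G = insert {x, y} {e \<in> snd G. x \<notin> e}"
proof -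
  obtain e where e: "{e \<in> snd G. x \<in> e} = {e}"
    using assms(2) by (auto simp: leaves_def card_1_singleton_iff)
  then have "e \<in> snd G" "x \<in> e"
    by blast+
  moreover from this have "e \<subseteq> fst G" "card e = 2"
    using simple_graph_edge[OF assms(1)] by auto
  ultimately obtain y where y: "e = {x, y}" "y \<noteq> x"
    by (auto simp: card_2_iff)
  have "snd G = {e \<in> snd G. x \<in> e} \<union> {e \<in> snd G. x \<notin> e}"
    by blast
  then have "snd G = insert {x, y} {e \<in> snd G. x \<notin> e}"
    using e y by simp
  then show ?thesis
    using that y \<open>e \<subseteq> fst G\<close> \<open>e \<in> snd G\<close> by auto
qed

context graph_class
begin

lemma finite_on: "finite W \<Longrightarrow> finite {G \<in> \<B>. fst G = W \<and> P G}"
  using finite_graphs_on by (rule rev_finite_subset) (auto dest: simple)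

lemma finite_labelled: "finite (labelled \<B> n)"
  using finite_on[of "{1..n}" "\<lambda>_. True"] by (simp add: labelled_def)

lemma card_on_le:
  assumes "finite W" "finite W'" "card W = card W'"
  shows "card {G \<in> \<B>. fst G = W \<and> P (num_leaves G)} \<le> card {G \<in> \<B>. fst G = W' \<and> P (num_leaves G)}"
proof -
  obtain f where f: "bij_betw f W W'"
    using assms finite_same_card_bij by blast
  then have inj: "inj_on f W" and im: "f ` W = W'"
    by (auto simp: bij_betw_def)
  show ?thesis
  proof (rule card_inj_on_le)
    show "inj_on (relabel f) {G \<in> \<B>. fst G = W \<and> P (num_leaves G)}"
      by (rule inj_on_inverseI[of _ "relabel (inv_into W f)"]) (use inj relabel_inv_into simple in blast)
    show "relabel f ` {G \<in> \<B>. fst G = W \<and> P (num_leaves G)} \<subseteq> {G \<in> \<B>. fst G = W' \<and> P (num_leaves G)}"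
    proof
      fix H assume "H \<in> relabel f ` {G \<in> \<B>. fst G = W \<and> P (num_leaves G)}"
      then obtain G where G: "G \<in> \<B>" "fst G = W" "P (num_leaves G)" "H = relabel f G"
        by blast
      then show "H \<in> {G \<in> \<B>. fst G = W' \<and> P (num_leaves G)}"
        using iso[OF G(1), of f] num_leaves_relabel[OF simple[OF G(1)], of f] inj im by auto
    qed
    show "finite {G \<in> \<B>. fst G = W' \<and> P (num_leaves G)}"
      using assms by (simp add: finite_on)
  qed
qed

text \<open>Deleting a vertex leaves a label set with a gap. Counts depend only on its size, since
  membership and the number of leaves are invariant under renaming.\<close>

lemma card_on:
  assumes "finite W"
  shows "card {G \<in> \<B>. fst G = W \<and> P (num_leaves G)} = card {G \<in> labelled \<B> (card W). P (num_leaves G)}"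
  using card_on_le[of W "{1..card W}" P] card_on_le[of "{1..card W}" W P] assms
  by (simp add: labelled_def conj_assoc)

lemma card_on_labelled: "finite W \<Longrightarrow> card {G \<in> \<B>. fst G = W} = card (labelled \<B> (card W))"
  using card_on[of W "\<lambda>_. True"] by simp

text \<open>The triples stand for a leaf \<open>x\<close>, its neighbour and the graph without
  \<open>x\<close>; both counts below compare marked leaves with these triples.\<close>

lemma card_vertex_extensions:
  "card (SIGMA x:{1..Suc n}. ({1..Suc n} - {x}) \<times> {G \<in> \<B>. fst G = {1..Suc n} - {x} \<and> P (num_leaves G)}) =
     Suc n * n * card {G \<in> labelled \<B> n. P (num_leaves G)}"
proof -
  have "card {G \<in> \<B>. fst G = {1..Suc n} - {x} \<and> P (num_leaves G)} = card {G \<in> labelled \<B> n. P (num_leaves G)}"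
    if "x \<in> {1..Suc n}" for x
    using card_on[of "{1..Suc n} - {x}" P] that by simp
  then show ?thesis
    by (simp add: card_SigmaI finite_on card_cartesian_product algebra_simps)
qed

text \<open>Deleting one vertex of a component \<open>K\<^sub>2\<close> destroys two leaves; attaching a leaf to an isolated
  vertex below creates two.\<close>

lemma leaf_deletion_count:
  "k * card {G \<in> labelled \<B> (Suc n). k \<le> num_leaves G}
     \<le> Suc n * n * card {G \<in> labelled \<B> n. k - 2 \<le> num_leaves G}"
proof -
  define A where "A = {G \<in> labelled \<B> (Suc n). k \<le> num_leaves G}"
  \<comment> \<open>A graph with a marked leaf goes to the leaf, its unique neighbour and the rest,
    from which the graph can be rebuilt.\<close>
  define \<phi> where "\<phi> = (\<lambda>(G :: nat graph, x). (x, SOME y. y \<noteq> x \<and> {x, y} \<in> snd G, fst G - {x}, {e \<in> snd G. x \<notin> e}))"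
  define T where "T = (SIGMA x:{1..Suc n}. ({1..Suc n} - {x}) \<times>
      {G \<in> \<B>. fst G = {1..Suc n} - {x} \<and> k - 2 \<le> num_leaves G})"
  have A: "G \<in> \<B>" "simple_graph G" "fst G = {1..Suc n}" "k \<le> num_leaves G" if "G \<in> A" for G
    using that simple by (auto simp: A_def labelled_def)
  have finA: "finite A"
    using finite_labelled by (simp add: A_def)
  have finT: "finite T"
    unfolding T_def by (intro finite_SigmaI) (auto simp: finite_on)
  have \<phi>_eq: "\<exists>y. \<phi> (G, x) = (x, y, fst G - {x}, {e \<in> snd G. x \<notin> e}) \<and> y \<in> fst G \<and> y \<noteq> x \<and>
      snd G = insert {x, y} {e \<in> snd G. x \<notin> e}" if "G \<in> A" "x \<in> leaves G" for G x
  proof -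
    obtain y where y: "y \<in> fst G" "y \<noteq> x" "{x, y} \<in> snd G" "snd G = insert {x, y} {e \<in> snd G. x \<notin> e}"
      using leaf_unique_edge[OF A(2)[OF \<open>G \<in> A\<close>] \<open>x \<in> leaves G\<close>] by blast
    have "(SOME y. y \<noteq> x \<and> {x, y} \<in> snd G) = y"
    proof (rule some_equality)
      fix z assume z: "z \<noteq> x \<and> {x, z} \<in> snd G"
      have "{x, z} \<in> insert {x, y} {e \<in> snd G. x \<notin> e}"
        unfolding y(4)[symmetric] using z by blast
      then have "{x, z} = {x, y}"
        by blast
      then show "z = y"
        using z y(2) by (auto simp: doubleton_eq_iff)
    qed (use y in simp)
    then show ?thesis
      using y by (intro exI[of _ y]) (simp add: \<phi>_def)
  qed
  have "k * card A \<le> (\<Sum>G\<in>A. card (leaves G))"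
    using sum_bounded_below[of A k "\<lambda>G. card (leaves G)"] A(4) by (simp add: num_leaves_eq mult.commute)
  also have "\<dots> = card (SIGMA G:A. leaves G)"
    using finA A(2) by (simp add: card_SigmaI finite_leaves)
  also have "\<dots> \<le> card T"
  proof (rule card_inj_on_le[OF _ _ finT])
    show "inj_on \<phi> (SIGMA G:A. leaves G)"
    proof (rule inj_onI)
      fix p p' assume pp: "p \<in> (SIGMA G:A. leaves G)" "p' \<in> (SIGMA G:A. leaves G)" "\<phi> p = \<phi> p'"
      obtain V E x V' E' x' where p: "p = ((V, E), x)" "p' = ((V', E'), x')"
        by (metis surj_pair)
      have *: "(V, E) \<in> A" "x \<in> leaves (V, E)" "(V', E') \<in> A" "x' \<in> leaves (V', E')"
        "\<phi> ((V, E), x) = \<phi> ((V', E'), x')"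
        using pp p by auto
      obtain y where y: "\<phi> ((V, E), x) = (x, y, V - {x}, {e \<in> E. x \<notin> e})" "E = insert {x, y} {e \<in> E. x \<notin> e}"
        using \<phi>_eq[OF *(1,2)] by auto
      obtain y' where y': "\<phi> ((V', E'), x') = (x', y', V' - {x'}, {e \<in> E'. x' \<notin> e})"
          "E' = insert {x', y'} {e \<in> E'. x' \<notin> e}"
        using \<phi>_eq[OF *(3,4)] by auto
      have "x = x'" "y = y'" "{e \<in> E. x \<notin> e} = {e \<in> E'. x' \<notin> e}"
        using y y' *(5) by auto
      moreover have "V = V'"
        using A(3)[OF *(1)] A(3)[OF *(3)] by simp
      ultimately show "p = p'"
        using y(2) y'(2) p by metis
    qed
    show "\<phi> ` (SIGMA G:A. leaves G) \<subseteq> T"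
    proof (rule image_subsetI)
      fix p assume "p \<in> (SIGMA G:A. leaves G)"
      then obtain V E x where p: "p = ((V, E), x)" and *: "(V, E) \<in> A" "x \<in> leaves (V, E)"
        by (cases p; cases "fst p") auto
      define H where "H = (V - {x}, {e \<in> E. x \<notin> e})"
      obtain y where y: "\<phi> ((V, E), x) = (x, y, H)" "y \<in> V" "y \<noteq> x" "E = insert {x, y} {e \<in> E. x \<notin> e}"
        using \<phi>_eq[OF *] by (auto simp: H_def)
      have x: "x \<in> V"
        using * leaves_subset by fastforce
      have V: "V = {1..Suc n}"
        using A(3)[OF *(1)] by simp
      have "H \<in> \<B>"
        using minor[OF A(1)[OF *(1)] minor_step.delete_vertex] x y by (auto simp: H_def)
      moreover have "leaves (V, E) - {x, y} \<subseteq> leaves H"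
      proof
        fix v assume v: "v \<in> leaves (V, E) - {x, y}"
        then have "{e \<in> {e \<in> E. x \<notin> e}. v \<in> e} = {e \<in> E. v \<in> e}"
          using y(4) by blast
        then show "v \<in> leaves H"
          using v by (auto simp: H_def leaves_def)
      qed
      then have "card (leaves (V, E) - {x, y}) \<le> card (leaves H)"
        using finite_leaves simple[OF \<open>H \<in> \<B>\<close>] by (intro card_mono)
      then have "k - 2 \<le> num_leaves H"
        using A(4)[OF *(1)] diff_card_le_card_Diff[of "{x, y}" "leaves (V, E)"] y(3)
        by (simp add: num_leaves_eq)
      ultimately show "\<phi> p \<in> T"
        using x y V p by (auto simp: T_def H_def)
    qed
  qed
  also have "\<dots> = Suc n * n * card {G \<in> labelled \<B> n. k - 2 \<le> num_leaves G}"
    unfolding T_def by (rule card_vertex_extensions)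
  finally show ?thesis
    by (simp add: A_def)
qed

end

context leaf_closed_class
begin

text \<open>Every triple yields a graph with a marked leaf, and the triple can be recovered: the
  remaining graph consists of the edges that avoid \<open>x\<close>. Each resulting graph has at
  most \<open>k + 2\<close> leaves that can be marked.\<close>

lemma leaf_addition_count:
  "Suc n * n * card {G \<in> labelled \<B> n. num_leaves G \<le> k}
     \<le> (k + 2) * card {G \<in> labelled \<B> (Suc n). num_leaves G \<le> k + 2}"
proof -
  define A where "A = {G \<in> labelled \<B> (Suc n). num_leaves G \<le> k + 2}"
  define \<psi> where "\<psi> = (\<lambda>(x, y, G :: nat graph). ((insert x (fst G), insert {x, y} (snd G)), x))"
  define T where "T = (SIGMA x:{1..Suc n}. ({1..Suc n} - {x}) \<times>
      {G \<in> \<B>. fst G = {1..Suc n} - {x} \<and> num_leaves G \<le> k})"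
  have finA: "finite A"
    using finite_labelled by (simp add: A_def)
  have A: "simple_graph G" "num_leaves G \<le> k + 2" if "G \<in> A" for G
    using that simple by (auto simp: A_def labelled_def)
  have "Suc n * n * card {G \<in> labelled \<B> n. num_leaves G \<le> k} = card T"
    unfolding T_def by (rule card_vertex_extensions[symmetric])
  also have "\<dots> \<le> card (SIGMA G:A. leaves G)"
  proof (rule card_inj_on_le)
    show "finite (SIGMA G:A. leaves G)"
      using finA A by (intro finite_SigmaI finite_leaves)
    show "inj_on \<psi> T"
    proof (rule inj_onI)
      fix p p' assume pp: "p \<in> T" "p' \<in> T" "\<psi> p = \<psi> p'"
      obtain x y V E x' y' V' E' where p: "p = (x, y, V, E)" "p' = (x', y', V', E')"
        by (metis surj_pair)
      have *: "(x, y, V, E) \<in> T" "(x', y', V', E') \<in> T" "\<psi> (x, y, V, E) = \<psi> (x', y', V', E')"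
        using pp p by auto
      have eq: "x = x'" "insert x V = insert x V'" "insert {x, y} E = insert {x, y'} E'"
        using *(3) by (auto simp: \<psi>_def)
      have V: "V = {1..Suc n} - {x}" "V' = {1..Suc n} - {x}" "y \<noteq> x" "y' \<noteq> x" and B: "(V, E) \<in> \<B>" "(V', E') \<in> \<B>"
        using *(1,2) eq(1) by (auto simp: T_def)
      have xE: "x \<notin> e" if "e \<in> E \<union> E'" for e
        using that simple_graph_edge(1)[OF simple[OF B(1)]] simple_graph_edge(1)[OF simple[OF B(2)]] V by auto
      have "E = {e \<in> insert {x, y} E. x \<notin> e}" "E' = {e \<in> insert {x, y'} E'. x \<notin> e}"
        using xE by auto
      then have "E = E'"
        using eq(3) by metis
      moreover have "{x, y} = {x, y'}"
      proof -
        have "{x, y} \<in> insert {x, y'} E'"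
          unfolding eq(3)[symmetric] by blast
        then show ?thesis
          using xE by blast
      qed
      then have "y = y'"
        using V by (auto simp: doubleton_eq_iff)
      ultimately show "p = p'"
        using eq(1) V p by simp
    qed
    show "\<psi> ` T \<subseteq> (SIGMA G:A. leaves G)"
    proof (rule image_subsetI)
      fix p assume "p \<in> T"
      moreover obtain x y V E where p: "p = (x, y, V, E)"
        by (metis surj_pair)
      ultimately have x: "x \<in> {1..Suc n}" and y: "y \<in> V" "y \<noteq> x" and V: "V = {1..Suc n} - {x}"
        and B: "(V, E) \<in> \<B>" and k: "num_leaves (V, E) \<le> k"
        by (auto simp: T_def)
      define H where "H = (insert x V, insert {x, y} E)"
      have "H \<in> \<B>"
        unfolding H_def using V by (intro leaf[OF B y(1)]) simp
      have xE: "x \<notin> e" if "e \<in> E" for e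
        using that simple_graph_edge(1)[OF simple[OF B]] V by auto
      then have "{e \<in> insert {x, y} E. x \<in> e} = {{x, y}}"
        by auto
      then have xH: "x \<in> leaves H"
        by (simp add: H_def leaves_def)
      have "leaves H \<subseteq> leaves (V, E) \<union> {x, y}"
      proof
        fix v assume v: "v \<in> leaves H"
        show "v \<in> leaves (V, E) \<union> {x, y}"
        proof (cases "v \<in> {x, y}")
          case False
          then have "{e \<in> insert {x, y} E. v \<in> e} = {e \<in> E. v \<in> e}"
            by auto
          then show ?thesis
            using v False by (auto simp: H_def leaves_def)
        qed auto
      qed
      then have "card (leaves H) \<le> card (leaves (V, E) \<union> {x, y})"
        using finite_leaves[OF simple[OF B]] by (intro card_mono) auto
      also have "\<dots> \<le> k + 2"
        using card_Un_le[of "leaves (V, E)" "{x, y}"] k y by (simp add: num_leaves_eq)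
      finally have "H \<in> A"
        using \<open>H \<in> \<B>\<close> x V by (auto simp: A_def labelled_def H_def num_leaves_eq)
      then show "\<psi> p \<in> (SIGMA G:A. leaves G)"
        using xH p by (simp add: \<psi>_def H_def)
    qed
  qed
  also have "\<dots> = (\<Sum>G\<in>A. card (leaves G))"
    using finA A by (simp add: card_SigmaI finite_leaves)
  also have "\<dots> \<le> (k + 2) * card A"
    using sum_bounded_above[of A "\<lambda>G. card (leaves G)" "k + 2"] A(2) by (simp add: num_leaves_eq mult.commute)
  finally show ?thesis
    by (simp add: A_def)
qed

end

section \<open>Concentration of the number of leaves\<close>

definition egf_coeff :: "nat graph set \<Rightarrow> nat \<Rightarrow> real" where
  "egf_coeff \<D> n = real (card (labelled \<D> n)) / fact n"

lemma egf_radius_eq: "egf_radius \<D> = conv_radius (egf_coeff \<D>)"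
  by (simp add: egf_radius_def egf_coeff_def[abs_def])

lemma egf_coeff_nonneg [simp]: "0 \<le> egf_coeff \<D> n"
  by (simp add: egf_coeff_def)

lemma labelled_Collect: "labelled {G \<in> \<B>. P G} n = {G \<in> labelled \<B> n. P G}"
  by (auto simp: labelled_def)

context graph_class
begin

definition many_leaves :: "nat \<Rightarrow> nat graph set" where
  "many_leaves k = {G \<in> \<B>. k \<le> num_leaves G}"

definition few_leaves :: "nat \<Rightarrow> nat graph set" where
  "few_leaves k = {G \<in> \<B>. num_leaves G \<le> k}"

lemma many_leaves_subset: "many_leaves k \<subseteq> \<B>" and few_leaves_subset: "few_leaves k \<subseteq> \<B>"
  by (auto simp: many_leaves_def few_leaves_def)

lemma egf_coeff_mono:
  assumes "\<D> \<subseteq> \<B>"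
  shows "egf_coeff \<D> n \<le> egf_coeff \<B> n"
proof -
  have "labelled \<D> n \<subseteq> labelled \<B> n"
    using assms by (auto simp: labelled_def)
  then show ?thesis
    using card_mono[OF finite_labelled] by (simp add: egf_coeff_def divide_right_mono)
qed

lemma egf_coeff_Un:
  assumes "\<D> \<subseteq> \<D>1 \<union> \<D>2" "\<D>1 \<subseteq> \<B>" "\<D>2 \<subseteq> \<B>"
  shows "egf_coeff \<D> n \<le> egf_coeff \<D>1 n + egf_coeff \<D>2 n"
proof -
  have "finite (labelled \<D>1 n)" "finite (labelled \<D>2 n)"
    using assms by (auto intro!: finite_subset[OF _ finite_labelled[of n]] simp: labelled_def)
  moreover have "labelled \<D> n \<subseteq> labelled \<D>1 n \<union> labelled \<D>2 n"
    using assms by (auto simp: labelled_def)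
  ultimately have "card (labelled \<D> n) \<le> card (labelled \<D>1 n \<union> labelled \<D>2 n)"
    by (intro card_mono) auto
  also have "\<dots> \<le> card (labelled \<D>1 n) + card (labelled \<D>2 n)"
    by (rule card_Un_le)
  finally have "real (card (labelled \<D> n)) \<le> real (card (labelled \<D>1 n)) + real (card (labelled \<D>2 n))"
    by linarith
  then show ?thesis
    by (simp add: egf_coeff_def add_divide_distrib[symmetric] divide_right_mono)
qed

text \<open>Dividing by \<open>fact (Suc n)\<close> absorbs the choice of the label of the leaf; the
  factor \<open>n\<close> for its neighbour remains.\<close>

lemma many_leaves_step:
  "real k * egf_coeff (many_leaves k) (Suc n) \<le>
     real n * egf_coeff (many_leaves (k - 2)) n"
proof -
  have "real (k * card {G \<in> labelled \<B> (Suc n). k \<le> num_leaves G}) \<le>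
      real (Suc n * n * card {G \<in> labelled \<B> n. k - 2 \<le> num_leaves G})"
    using leaf_deletion_count[of k n] by (rule of_nat_mono)
  then have "real k * real (card {G \<in> labelled \<B> (Suc n). k \<le> num_leaves G}) / fact (Suc n) \<le>
      real (Suc n) * (real n * real (card {G \<in> labelled \<B> n. k - 2 \<le> num_leaves G})) / fact (Suc n)"
    by (intro divide_right_mono) (simp_all only: of_nat_mult mult.assoc fact_ge_zero)
  also have "\<dots> = real n * real (card {G \<in> labelled \<B> n. k - 2 \<le> num_leaves G}) / fact n"
    by (simp add: fact_Suc del: of_nat_Suc)
  finally show ?thesis
    by (simp add: egf_coeff_def many_leaves_def few_leaves_def labelled_Collect)
qed

text \<open>The step is iterated downwards \<open>j\<close> times, with every factor replaced by the
  worst one: largest numerator and smallest denominator. The assumption keeps the denominators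
  positive.\<close>

lemma many_leaves_bound:
  assumes "2 * j < k"
  shows "egf_coeff (many_leaves k) (n + j) \<le>
    (real (n + j) / real (k - 2 * j)) ^ j * egf_coeff \<B> n"
  using assms
proof (induction j arbitrary: k)
  case 0
  then show ?case
    by (simp add: egf_coeff_mono many_leaves_subset few_leaves_subset)
next
  case (Suc j)
  let ?q = "real (n + j) / real (k - 2 * Suc j)"
  have eq: "k - 2 - 2 * j = k - 2 * Suc j"
    by simp
  have "egf_coeff (many_leaves k) (Suc (n + j)) \<le>
      real (n + j) / real k * egf_coeff (many_leaves (k - 2)) (n + j)"
    using many_leaves_step[of k "n + j"] Suc.prems by (simp add: field_simps)
  also have "\<dots> \<le> ?q * (?q ^ j * egf_coeff \<B> n)"
    using Suc.IH[of "k - 2"] Suc.prems unfolding eq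
    by (intro mult_mono divide_left_mono) auto
  also have "\<dots> = ?q ^ Suc j * egf_coeff \<B> n"
    by simp
  also have "\<dots> \<le> (real (n + Suc j) / real (k - 2 * Suc j)) ^ Suc j * egf_coeff \<B> n"
    by (intro mult_right_mono power_mono divide_right_mono) auto
  finally show ?case
    by simp
qed

end

context leaf_closed_class
begin

lemma few_leaves_step:
  "real n * egf_coeff (few_leaves k) n \<le>
     real (k + 2) * egf_coeff (few_leaves (k + 2)) (Suc n)"
proof -
  have "real (Suc n * n * card {G \<in> labelled \<B> n. num_leaves G \<le> k}) \<le>
      real ((k + 2) * card {G \<in> labelled \<B> (Suc n). num_leaves G \<le> k + 2})"
    using leaf_addition_count[of n k] by (rule of_nat_mono)
  then have "real (Suc n) * (real n * real (card {G \<in> labelled \<B> n. num_leaves G \<le> k})) / fact (Suc n) \<le>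
      real (k + 2) * real (card {G \<in> labelled \<B> (Suc n). num_leaves G \<le> k + 2}) / fact (Suc n)"
    by (intro divide_right_mono) (simp_all only: of_nat_mult mult.assoc fact_ge_zero)
  moreover have "real (Suc n) * (real n * real (card {G \<in> labelled \<B> n. num_leaves G \<le> k})) / fact (Suc n) =
      real n * real (card {G \<in> labelled \<B> n. num_leaves G \<le> k}) / fact n"
    by (simp add: fact_Suc del: of_nat_Suc)
  ultimately show ?thesis
    by (simp add: egf_coeff_def many_leaves_def few_leaves_def labelled_Collect)
qed

text \<open>The iteration goes upwards here: adding \<open>j\<close> leaves compares
  \<open>n\<close> with \<open>n + j\<close>, and the leaf bound grows by two in each step.\<close>

lemma few_leaves_bound:
  assumes "0 < n"
  shows "egf_coeff (few_leaves k) n \<le>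
    (real (k + 2 * j) / real n) ^ j * egf_coeff \<B> (n + j)"
  using assms
proof (induction j arbitrary: k n)
  case 0
  then show ?case
    by (simp add: egf_coeff_mono many_leaves_subset few_leaves_subset)
next
  case (Suc j)
  let ?q = "real (k + 2 * Suc j) / real n"
  have "egf_coeff (few_leaves k) n \<le>
      real (k + 2) / real n * egf_coeff (few_leaves (k + 2)) (Suc n)"
    using few_leaves_step[of n k] Suc.prems by (simp add: field_simps)
  also have "\<dots> \<le> ?q * ((real (k + 2 + 2 * j) / real (Suc n)) ^ j * egf_coeff \<B> (Suc n + j))"
    using Suc.IH[of "Suc n" "k + 2"] by (intro mult_mono divide_right_mono) auto
  also have "\<dots> \<le> ?q * (?q ^ j * egf_coeff \<B> (Suc n + j))"
    using Suc.prems by (intro mult_left_mono mult_right_mono power_mono frac_le) auto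
  finally show ?case
    by simp
qed

section \<open>Finiteness of the radius of convergence\<close>

lemma ex_singleton: "({1}, {}) \<in> \<B>"
proof -
  have "\<exists>x. ({x}, {}) \<in> \<B>" if "card (fst G) = Suc n" "G \<in> \<B>" for G n
    using that
  proof (induction n arbitrary: G)
    case 0
    then obtain x where x: "fst G = {x}"
      by (auto simp: card_1_singleton_iff)
    then have "snd G = {}"
      using simple_graph_edge[OF simple[OF 0(2)]] no_edge_in_singleton by (metis ex_in_conv)
    then show ?case
      using 0 x by (metis prod.collapse)
  next
    case (Suc n)
    then obtain v where v: "v \<in> fst G"
      by fastforce
    have "fst G \<noteq> {v}"
      using Suc.prems by auto
    then have "(fst G - {v}, {e \<in> snd G. v \<notin> e}) \<in> \<B>"
      using minor[OF Suc.prems(2)] minor_step.delete_vertex[OF v, of "snd G"] by simp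
    then show ?case
      using Suc.IH[of "(fst G - {v}, {e \<in> snd G. v \<notin> e})"] v Suc.prems(1) by simp
  qed
  moreover obtain G where G: "G \<in> \<B>"
    using nonempty by blast
  moreover have "card (fst G) = Suc (card (fst G) - 1)"
    using simple[OF G] by (auto simp: simple_graph_def card_gt_0_iff)
  ultimately obtain x where "({x}, {}) \<in> \<B>"
    by metis
  then have "relabel (\<lambda>_. 1) ({x}, {}) \<in> \<B>"
    by (intro iso) auto
  then show ?thesis
    by (simp add: relabel_def)
qed

text \<open>A graph on \<open>n\<close> vertices has at most \<open>n\<close> leaves, so
  \<open>few_leaves_step\<close> with \<open>k = n\<close> bounds \<open>n\<close> times the
  coefficient at \<open>n\<close> by \<open>n + 2\<close> times the next one. The product of these
  ratios telescopes, starting from the value 1 at \<open>n = 1\<close>.\<close>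

lemma egf_coeff_lower: "2 / (real (Suc n) * real (Suc (Suc n))) \<le> egf_coeff \<B> (Suc n)"
proof (induction n)
  case 0
  have "({1}, {}) \<in> labelled \<B> 1"
    using ex_singleton by (simp add: labelled_def)
  then have "1 \<le> card (labelled \<B> 1)"
    using finite_labelled by (metis One_nat_def Suc_leI card_gt_0_iff empty_iff)
  then show ?case
    by (simp add: egf_coeff_def)
next
  case (Suc n)
  have "num_leaves G \<le> Suc n" if "G \<in> labelled \<B> (Suc n)" for G
    using that card_mono[OF _ leaves_subset, of G] by (auto simp: labelled_def num_leaves_eq)
  then have "labelled (few_leaves (Suc n)) (Suc n) = labelled \<B> (Suc n)"
    by (auto simp: few_leaves_def labelled_Collect)
  then have "real (Suc n) * egf_coeff \<B> (Suc n) \<le>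
      real (Suc n + 2) * egf_coeff (few_leaves (Suc n + 2)) (Suc (Suc n))"
    using few_leaves_step[of "Suc n" "Suc n"] by (simp add: egf_coeff_def)
  also have "\<dots> \<le> real (Suc n + 2) * egf_coeff \<B> (Suc (Suc n))"
    by (intro mult_left_mono egf_coeff_mono few_leaves_subset) auto
  finally have "real (Suc n) * (2 / (real (Suc n) * real (Suc (Suc n)))) \<le> real (Suc n + 2) * egf_coeff \<B> (Suc (Suc n))"
    using mult_left_mono[OF Suc.IH, of "real (Suc n)"] by linarith
  then have "2 / real (Suc (Suc n)) \<le> real (Suc (Suc (Suc n))) * egf_coeff \<B> (Suc (Suc n))"
    by (simp del: of_nat_Suc)
  then show ?case
    by (simp add: divide_simps mult.commute mult.left_commute del: of_nat_Suc)
qed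

lemma egf_radius_finite: "egf_radius \<B> < \<infinity>"
proof (rule ccontr)
  assume "\<not> egf_radius \<B> < \<infinity>"
  \<comment> \<open>The base 4 is large enough because \<open>(N + 1) (N + 2)\<close> is at most the
    square of \<open>2 ^ (N + 1)\<close>.\<close>
  then have "summable (\<lambda>n. egf_coeff \<B> n * 4 ^ n)"
    by (intro summable_in_conv_radius) (simp add: egf_radius_eq less_top[symmetric])
  then have "(\<lambda>n. egf_coeff \<B> n * 4 ^ n) \<longlonglongrightarrow> 0"
    by (rule summable_LIMSEQ_zero)
  then have "\<forall>\<^sub>F n in sequentially. egf_coeff \<B> n * 4 ^ n < 1"
    by (rule order_tendstoD) simp
  then obtain N where N: "\<forall>n\<ge>N. egf_coeff \<B> n * 4 ^ n < 1"
    by (auto simp: eventually_sequentially)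
  have "real (Suc N) * real (Suc (Suc N)) \<le> 2 ^ Suc N * 2 ^ Suc N"
  proof -
    have "Suc (Suc N) \<le> 2 ^ Suc N"
      by (induction N) auto
    then have "real (Suc (Suc N)) \<le> 2 ^ Suc N"
      by (metis of_nat_le_iff of_nat_numeral of_nat_power)
    then show ?thesis
      by (intro mult_mono) auto
  qed
  also have "\<dots> = 4 ^ Suc N"
    by (simp flip: power_mult_distrib)
  finally have "real (Suc N) * real (Suc (Suc N)) \<le> 2 * 4 ^ Suc N"
    by (rule order_trans) simp
  then have "1 \<le> 2 / (real (Suc N) * real (Suc (Suc N))) * 4 ^ Suc N"
    by (simp add: divide_simps del: of_nat_Suc power_Suc)
  also have "\<dots> \<le> egf_coeff \<B> (Suc N) * 4 ^ Suc N"
    using egf_coeff_lower by (intro mult_right_mono) auto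
  finally show False
    using N[rule_format, of "Suc N"] by simp
qed

end

section \<open>From an exponential gain to a strictly larger radius\<close>

lemma conv_radius_gt_of_geometric_bound:
  fixes f :: "nat \<Rightarrow> real"
  assumes r: "0 < r" and \<theta>: "0 < \<theta>" "\<theta> < 1"
    and bound: "\<And>n. n \<ge> N \<Longrightarrow> norm (f n) \<le> C * (\<theta> / r) ^ n"
  shows "ereal r < conv_radius f"
proof -
  \<comment> \<open>The midpoint of \<open>r\<close> and \<open>r / \<theta>\<close>, so it exceeds
    \<open>r\<close> while the geometric ratio stays below 1.\<close>
  define z where "z = r * (1 + 1 / \<theta>) / 2"
  have "1 < 1 / \<theta>"
    using \<theta> by simp
  then have "r * 1 < r * ((1 + 1 / \<theta>) / 2)"
    using r by (intro mult_strict_left_mono) auto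
  then have "r < z"
    by (simp add: z_def)
  moreover have eq: "z * \<theta> / r = (\<theta> + 1) / 2"
    using r \<theta> by (simp add: z_def field_simps)
  have "z * \<theta> / r < 1"
    unfolding eq using \<theta> by simp
  ultimately have z: "r < z" "z * \<theta> / r < 1" "0 < z"
    using r by auto
  have "summable (\<lambda>n. f n * z ^ n)"
  proof (rule summable_comparison_test)
    have "norm (f n * z ^ n) \<le> C * (z * \<theta> / r) ^ n" if "n \<ge> N" for n
    proof -
      have "norm (f n * z ^ n) = norm (f n) * z ^ n"
        using z by (simp add: abs_mult)
      also have "\<dots> \<le> C * (\<theta> / r) ^ n * z ^ n"
        using bound[OF that] z by (intro mult_right_mono) auto
      also have "\<dots> = C * (z * \<theta> / r) ^ n"
        by (simp add: power_mult_distrib power_divide)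
      finally show ?thesis .
    qed
    then show "\<exists>N. \<forall>n\<ge>N. norm (f n * z ^ n) \<le> C * (z * \<theta> / r) ^ n"
      by blast
    show "summable (\<lambda>n. C * (z * \<theta> / r) ^ n)"
      using z r \<theta> by (intro summable_mult summable_geometric) auto
  qed
  then have "ereal (norm z) \<le> conv_radius f"
    by (rule conv_radius_geI)
  moreover have "ereal r < ereal (norm z)"
    using z by simp
  ultimately show ?thesis
    by (rule less_le_trans[rotated])
qed

context leaf_closed_class
begin

text \<open>With too many leaves, deleting a leaf costs a factor smaller than the typical
  \<open>1 / r\<close>; with too few, adding one costs a factor smaller than the typical
  \<open>r\<close>. Over linearly many steps this saves an exponential factor against the general
  bound on the coefficients.\<close>

lemma atypical_leaves_radius:
  assumes r: "egf_radius \<B> = ereal r" "0 < r" and \<epsilon>: "0 < \<epsilon>" "\<epsilon> < 1"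
  shows "ereal r < egf_radius {G \<in> \<B>.
    real (num_leaves G) \<le> (1 - \<epsilon>) * r * real (num_vertices G) \<or>
    (1 + \<epsilon>) * r * real (num_vertices G) \<le> real (num_leaves G)}" (is "_ < egf_radius ?D")
proof -
  \<comment> \<open>While half of the deviation is left, a step saves a factor
    \<open>1 / (1 + \<epsilon> / 2)\<close> or \<open>1 - \<epsilon> / 2\<close>; for
    \<open>\<epsilon> < 1\<close> both are at most \<open>q\<close>.\<close>
  define q where "q = 1 - \<epsilon> / 4"
  \<comment> \<open>The first bound ensures \<open>j \<le> N\<close>. By the second, changing the
    number of leaves by \<open>2 * j\<close> uses up at most half of the deviation
    \<open>\<epsilon> * r * N\<close>.\<close>
  define \<delta> where "\<delta> = min (1/2) (\<epsilon> * r / 4)"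
  \<comment> \<open>Chosen so that \<open>t ^ (2 * N)\<close> equals
    \<open>q powr (- \<delta> / 2 * N)\<close>, half of the gain in the exponent.\<close>
  define t where "t = q powr (- \<delta> / 4)"
  define s where "s = r / t"
  have q: "0 < q" "q < 1"
    using \<epsilon> by (auto simp: q_def)
  have \<delta>: "0 < \<delta>" "\<delta> \<le> 1/2" "2 * \<delta> \<le> \<epsilon> * r / 2"
    using r \<epsilon> by (auto simp: \<delta>_def)
  have t: "1 < t"
    using q \<delta> by (simp add: t_def powr_def mult_pos_neg)
  have s: "0 < s" "s < r"
    using r t by (auto simp: s_def field_simps)
  \<comment> \<open>The point \<open>s = r / t\<close> is inside the disc of convergence; bounded
    terms there mean coefficients of order \<open>(t / r) ^ n\<close>.\<close>
  have "summable (\<lambda>n. egf_coeff \<B> n * s ^ n)"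
    using r s by (intro summable_in_conv_radius) (simp add: egf_radius_eq)
  then have "Bseq (\<lambda>n. egf_coeff \<B> n * s ^ n)"
    by (metis convergent_imp_Bseq convergentI summable_LIMSEQ_zero)
  then obtain K where K: "K > 0" "\<And>n. norm (egf_coeff \<B> n * s ^ n) \<le> K"
    by (auto elim: BseqE)
  have B: "egf_coeff \<B> n \<le> K * (t / r) ^ n" for n
    using K(2)[of n] s r t by (simp add: s_def power_divide field_simps)
  have bound: "norm (egf_coeff ?D N) \<le> (2 * K / q) * (q powr (\<delta> / 2) / r) ^ N" if N: "N > 0" for N
  proof -
    \<comment> \<open>Rounding down loses less than one step; this is the factor
      \<open>1 / q\<close> in the final bound.\<close>
    define j where "j = nat \<lfloor>\<delta> * real N\<rfloor>"
    have j: "real j \<le> \<delta> * real N" "\<delta> * real N < real j + 1"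
      using \<delta> by (auto simp: j_def)
    have jN: "j \<le> N"
      using j(1) \<delta> mult_right_mono[of \<delta> 1 "real N"] by (simp add: of_nat_le_iff[symmetric, where 'a = real] del: of_nat_le_iff)
    define k1 where "k1 = nat \<lceil>(1 + \<epsilon>) * r * real N\<rceil>"
    define k2 where "k2 = nat \<lfloor>(1 - \<epsilon>) * r * real N\<rfloor>"
    have k1: "(1 + \<epsilon>) * r * real N \<le> real k1"
      by (simp add: k1_def real_nat_ceiling_ge)
    have k2: "real k2 \<le> (1 - \<epsilon>) * r * real N"
      using r \<epsilon> by (simp add: k2_def)
    have rN: "0 < r * real N"
      using r N by simp
    have 2: "2 * real j \<le> \<epsilon> / 2 * (r * real N)"
      using j(1) mult_right_mono[OF \<delta>(3), of "real N"] by simp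
    \<comment> \<open>The range up to \<open>2 * N\<close> covers both exponents that occur,
      \<open>N - j\<close> for deletion and \<open>N + j\<close> for addition.\<close>
    have pow: "q ^ j * t ^ m \<le> (q powr (\<delta> / 2)) ^ N / q" if "m \<le> 2 * N" for m
    proof -
      have "t ^ m \<le> t ^ (2 * N)"
        using t that by (intro power_increasing) auto
      also have "\<dots> = q powr (- \<delta> / 2 * real N)"
        using q by (simp add: t_def powr_powr flip: powr_realpow)
      finally have "q ^ j * t ^ m \<le> q powr real j * q powr (- \<delta> / 2 * real N)"
        using q t by (intro mult_mono) (auto simp: powr_realpow)
      also have "\<dots> \<le> q powr (\<delta> * real N - 1) * q powr (- \<delta> / 2 * real N)"
        using q j by (intro mult_right_mono powr_mono') auto
      also have "\<dots> = q powr (\<delta> / 2 * real N) / q"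
        using q by (simp add: powr_diff flip: powr_add)
      also have "q powr (\<delta> / 2 * real N) = (q powr (\<delta> / 2)) powr real N"
        by (simp add: powr_powr)
      also have "\<dots> = (q powr (\<delta> / 2)) ^ N"
        using q by (simp add: powr_realpow)
      finally show ?thesis .
    qed
    have many: "egf_coeff (many_leaves k1) N \<le> K * (q powr (\<delta> / 2) / r) ^ N / q"
    proof -
      have "(1 + \<epsilon> / 2) * (r * real N) \<le> real k1 - 2 * real j"
        using k1 2 by (simp add: algebra_simps)
      moreover have "0 < (1 + \<epsilon> / 2) * (r * real N)"
        using rN \<epsilon> by simp
      ultimately have jk: "2 * j < k1" and k': "(1 + \<epsilon> / 2) * (r * real N) \<le> real (k1 - 2 * j)"
        by linarith+
      have "1 \<le> q * (1 + \<epsilon> / 2)"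
      proof -
        have "\<epsilon> * \<epsilon> \<le> \<epsilon> * 1"
          using \<epsilon> by (intro mult_left_mono) auto
        then show ?thesis
          using \<epsilon> by (simp add: q_def algebra_simps)
      qed
      then have "r * real N \<le> q * ((1 + \<epsilon> / 2) * (r * real N))"
        using mult_right_mono[of 1 "q * (1 + \<epsilon> / 2)" "r * real N"] rN by simp
      also have "\<dots> \<le> q * real (k1 - 2 * j)"
        using k' q by (intro mult_left_mono) auto
      finally have "real N / real (k1 - 2 * j) \<le> q / r"
        using jk r by (simp add: field_simps)
      then have "(real N / real (k1 - 2 * j)) ^ j \<le> (q / r) ^ j"
        by (intro power_mono) auto
      moreover have "egf_coeff (many_leaves k1) N \<le>
          (real N / real (k1 - 2 * j)) ^ j * egf_coeff \<B> (N - j)"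
        using many_leaves_bound[OF jk, of "N - j"] jN by simp
      ultimately have "egf_coeff (many_leaves k1) N \<le> (q / r) ^ j * (K * (t / r) ^ (N - j))"
        using B[of "N - j"] q r by (meson egf_coeff_nonneg mult_mono order_trans zero_le_divide_iff zero_le_power less_imp_le)
      also have "\<dots> = K * (q ^ j * t ^ (N - j)) / (r ^ j * r ^ (N - j))"
        by (simp add: power_divide)
      also have "\<dots> = K * (q ^ j * t ^ (N - j)) / r ^ N"
        using jN by (simp flip: power_add)
      also have "\<dots> \<le> K * ((q powr (\<delta> / 2)) ^ N / q) / r ^ N"
        using K(1) r by (intro divide_right_mono mult_left_mono pow) auto
      finally show ?thesis
        by (simp add: power_divide mult.commute)
    qed
    have few: "egf_coeff (few_leaves k2) N \<le> K * (q powr (\<delta> / 2) / r) ^ N / q"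
    proof -
      have "real (k2 + 2 * j) \<le> (1 - \<epsilon> / 2) * (r * real N)"
        using k2 2 by (simp add: algebra_simps)
      also have "\<dots> \<le> q * (r * real N)"
        using rN \<epsilon> by (intro mult_right_mono) (auto simp: q_def)
      finally have "real (k2 + 2 * j) / real N \<le> q * r"
        using N by (simp add: field_simps)
      then have "(real (k2 + 2 * j) / real N) ^ j \<le> (q * r) ^ j"
        by (intro power_mono) auto
      then have "egf_coeff (few_leaves k2) N \<le> (q * r) ^ j * (K * (t / r) ^ (N + j))"
        using few_leaves_bound[OF N, of k2 j] B[of "N + j"] q r
        by (meson egf_coeff_nonneg mult_mono order_trans zero_le_mult_iff zero_le_power less_imp_le)
      also have "\<dots> = K * (q ^ j * t ^ (N + j)) / r ^ N"
        using r by (simp add: power_divide power_mult_distrib power_add)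
      also have "\<dots> \<le> K * ((q powr (\<delta> / 2)) ^ N / q) / r ^ N"
        using K(1) r jN by (intro divide_right_mono mult_left_mono pow) auto
      finally show ?thesis
        by (simp add: power_divide mult.commute)
    qed
    have "labelled ?D N \<subseteq> labelled (many_leaves k1 \<union> few_leaves k2) N"
    proof
      fix G assume G: "G \<in> labelled ?D N"
      then have "num_vertices G = N"
        by (simp add: labelled_def num_vertices_def)
      then show "G \<in> labelled (many_leaves k1 \<union> few_leaves k2) N"
        using G by (auto simp: labelled_def many_leaves_def few_leaves_def k1_def k2_def le_nat_floor nat_ceiling_le_eq)
    qed
    moreover have "many_leaves k1 \<union> few_leaves k2 \<subseteq> \<B>"
      using many_leaves_subset few_leaves_subset by blast
    ultimately have "egf_coeff ?D N \<le> egf_coeff (many_leaves k1 \<union> few_leaves k2) N"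
      unfolding egf_coeff_def
      by (intro divide_right_mono of_nat_mono card_mono finite_subset[OF _ finite_labelled[of N]])
        (auto simp: labelled_def)
    also have "\<dots> \<le> egf_coeff (many_leaves k1) N + egf_coeff (few_leaves k2) N"
      by (rule egf_coeff_Un[OF _ many_leaves_subset few_leaves_subset]) simp
    also have "\<dots> \<le> (2 * K / q) * (q powr (\<delta> / 2) / r) ^ N"
      using many few by (simp add: add_divide_distrib[symmetric])
    finally show ?thesis
      by simp
  qed
  have "ereal r < conv_radius (egf_coeff ?D)"
  proof (rule conv_radius_gt_of_geometric_bound)
    show "0 < q powr (\<delta> / 2)" "q powr (\<delta> / 2) < 1"
      using q \<delta> by (auto simp: powr_def mult_pos_neg)
    show "norm (egf_coeff ?D N) \<le> (2 * K / q) * (q powr (\<delta> / 2) / r) ^ N" if "N \<ge> 1" for N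
      using bound[of N] that by simp
  qed (use r in auto)
  then show ?thesis
    by (simp add: egf_radius_eq)
qed

end

section \<open>Mader's bound on the number of edges\<close>

definition induced :: "'v graph \<Rightarrow> 'v set \<Rightarrow> 'v graph" where
  "induced G U = (U, {e \<in> snd G. e \<subseteq> U})"

lemma minor_step_contraction: "{u, v} \<in> snd G \<Longrightarrow> u \<noteq> v \<Longrightarrow> minor_step G (contraction G u v)"
  using minor_step.contract_edge[of u v "snd G" "fst G"] by (simp add: contraction_def)

lemma is_minor_refl [simp]: "is_minor G G"
  by (simp add: is_minor_def)

lemma is_minor_trans: "is_minor K H \<Longrightarrow> is_minor H G \<Longrightarrow> is_minor K G"
  unfolding is_minor_def by (rule rtranclp_trans)

lemma minor_step_is_minor: "minor_step G H \<Longrightarrow> is_minor H G"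
  by (auto simp: is_minor_def)

lemma simple_graph_induced: "simple_graph G \<Longrightarrow> U \<subseteq> fst G \<Longrightarrow> U \<noteq> {} \<Longrightarrow> simple_graph (induced G U)"
  using finite_subset by (fastforce simp: simple_graph_def induced_def)

lemma is_minor_induced:
  assumes "simple_graph G" "U \<subseteq> fst G" "U \<noteq> {}"
  shows "is_minor (induced G U) G"
proof -
  have "finite (fst G - U)"
    using assms by (auto simp: simple_graph_def)
  then show ?thesis
    using assms
  proof (induction "fst G - U" arbitrary: G rule: finite_induct)
    case empty
    then have "U = fst G"
      by blast
    then have "induced G U = G"
      using simple_graph_edge(1)[OF empty(2)] by (intro prod_eqI) (auto simp: induced_def)
    then show ?case
      by simp
  next
    case (insert v F)
    have v: "v \<in> fst G" "v \<notin> U" "fst G \<noteq> {v}"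
      using insert by auto
    define H where "H = (fst G - {v}, {e \<in> snd G. v \<notin> e})"
    have step: "minor_step G H"
      using minor_step.delete_vertex[OF v(1,3), of "snd G"] by (simp add: H_def)
    have "F = fst H - U" "U \<subseteq> fst H"
      using insert v by (auto simp: H_def)
    then have "is_minor (induced H U) H"
      using insert.hyps(3) minor_step_simple_graph[OF step] insert.prems by blast
    moreover have "induced H U = induced G U"
      using v by (auto simp: H_def induced_def)
    ultimately show ?case
      using is_minor_trans minor_step_is_minor[OF step] by metis
  qed
qed

lemma is_minor_delete_edges:
  assumes "finite F" "F \<subseteq> E"
  shows "is_minor (V, E - F) (V, E)"
  using assms
proof (induction rule: finite_induct)
  case (insert e F)
  then have "minor_step (V, E - F) (V, E - F - {e})"
    by (intro minor_step.delete_edge) auto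
  then show ?case
    using insert is_minor_trans minor_step_is_minor by (metis Diff_insert insert_subset)
qed simp

text \<open>The join with an apex. It turns a complete minor of the neighbourhood of
  \<open>v\<close> into one with one more vertex.\<close>

definition cone :: "'v \<Rightarrow> 'v graph \<Rightarrow> 'v graph" where
  "cone v G = (insert v (fst G), snd G \<union> {{v, w} |w. w \<in> fst G})"

lemma minor_step_cone:
  assumes "minor_step G H" "simple_graph G" "v \<notin> fst G"
  shows "minor_step (cone v G) (cone v H)"
  using assms
proof (induction rule: minor_step.induct)
  case (delete_edge e E V)
  then have "e \<subseteq> V"
    by (auto simp: simple_graph_def)
  then have "E \<union> {{v, w} |w. w \<in> V} - {e} = E - {e} \<union> {{v, w} |w. w \<in> V}"
    using delete_edge by auto
  then show ?case
    using minor_step.delete_edge[of e "E \<union> {{v, w} |w. w \<in> V}" "insert v V"] delete_edge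
    by (simp add: cone_def)
next
  case (delete_vertex x V E)
  have "insert v V - {x} = insert v (V - {x})" "insert v V \<noteq> {x}"
    using delete_vertex by auto
  moreover have "{e \<in> E \<union> {{v, w} |w. w \<in> V}. x \<notin> e} = {e \<in> E. x \<notin> e} \<union> {{v, w} |w. w \<in> V - {x}}"
    using delete_vertex by auto
  ultimately show ?case
    using minor_step.delete_vertex[of x "insert v V" "E \<union> {{v, w} |w. w \<in> V}"] delete_vertex
    by (simp add: cone_def)
next
  case (contract_edge a b E V)
  have E: "\<And>e. e \<in> E \<Longrightarrow> e \<subseteq> V"
    using contract_edge by (auto simp: simple_graph_def)
  then have ab: "a \<in> V" "b \<in> V" "a \<noteq> v" "b \<noteq> v"
    using contract_edge by auto
  let ?E = "E \<union> {{v, w} |w. w \<in> V}"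
  have "insert v V - {b} = insert v (V - {b})"
    using ab by auto
  moreover have "{e \<in> ?E. b \<notin> e} \<union> {{a, w} |w. {b, w} \<in> ?E \<and> w \<noteq> a} =
      {e \<in> E. b \<notin> e} \<union> {{a, w} |w. {b, w} \<in> E \<and> w \<noteq> a} \<union> {{v, w} |w. w \<in> V - {b}}" (is "?L = ?R")
  proof (intro equalityI subsetI)
    fix e assume "e \<in> ?L"
    then consider "e \<in> E" "b \<notin> e" | w where "e = {v, w}" "w \<in> V" "w \<noteq> b"
      | w where "e = {a, w}" "{b, w} \<in> E" "w \<noteq> a" | w u where "e = {a, w}" "{b, w} = {v, u}" "u \<in> V"
      by auto
    then show "e \<in> ?R"
    proof cases
      case 4
      then have "w = v"
        using ab by (auto simp: doubleton_eq_iff)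
      then have "e = {v, a}" "a \<in> V - {b}"
        using 4 ab contract_edge by auto
      then show ?thesis
        by blast
    qed blast+
  next
    fix e assume "e \<in> ?R"
    then show "e \<in> ?L"
      using ab by auto
  qed
  ultimately show ?case
    using minor_step.contract_edge[of a b ?E "insert v V"] contract_edge by (simp add: cone_def)
qed

lemma is_minor_cone:
  assumes "is_minor H G" "simple_graph G" "v \<notin> fst G"
  shows "is_minor (cone v H) (cone v G)"
  using assms(1) unfolding is_minor_def
proof (induction rule: rtranclp_induct)
  case (step H H')
  then have H: "is_minor H G"
    by (simp add: is_minor_def)
  have "minor_step (cone v H) (cone v H')"
    using step.hyps(2) is_minor_simple_graph[OF H assms(2)] is_minor_vertices[OF H] assms(3)
    by (intro minor_step_cone) auto
  with step.IH show ?case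
    by (rule rtranclp.rtrancl_into_rtrancl)
qed simp

definition complete_edges :: "'v set \<Rightarrow> 'v set set" where
  "complete_edges U = {e. e \<subseteq> U \<and> card e = 2}"

lemma complete_edges_insert:
  assumes "v \<notin> U"
  shows "complete_edges (insert v U) = complete_edges U \<union> {{v, w} |w. w \<in> U}" (is "?L = ?R")
proof (intro equalityI subsetI)
  fix e assume e: "e \<in> ?L"
  show "e \<in> ?R"
  proof (cases "v \<in> e")
    case True
    then obtain w where "e = {v, w}" "w \<noteq> v"
      using e by (auto simp: complete_edges_def card_2_iff)
    then show ?thesis
      using e by (auto simp: complete_edges_def)
  next
    case False
    then show ?thesis
      using e by (auto simp: complete_edges_def)
  qed
next
  fix e assume "e \<in> ?R"
  then show "e \<in> ?L"
    using assms by (auto simp: complete_edges_def card_2_iff)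
qed

lemma finite_complete_edges: "finite U \<Longrightarrow> finite (complete_edges U)"
  by (rule finite_subset[of _ "Pow U"]) (auto simp: complete_edges_def)

definition nbrs :: "'v graph \<Rightarrow> 'v \<Rightarrow> 'v set" where
  "nbrs G v = {w. {v, w} \<in> snd G}"

lemma nbrs_subset: "simple_graph G \<Longrightarrow> nbrs G v \<subseteq> fst G - {v}"
  using simple_graph_edge by (fastforce simp: nbrs_def)

lemma finite_nbrs: "simple_graph G \<Longrightarrow> finite (nbrs G v)"
  using nbrs_subset[of G v] by (auto simp: simple_graph_def intro: finite_subset)

lemma simple_graph_finite_edges: "simple_graph G \<Longrightarrow> finite (snd G)"
  by (rule finite_subset[OF simple_graph_edges_subset]) (auto simp: simple_graph_def)

lemma card_incident_edges:
  assumes "simple_graph G"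
  shows "card {e \<in> snd G. v \<in> e} = card (nbrs G v)"
proof -
  have "{e \<in> snd G. v \<in> e} = (\<lambda>w. {v, w}) ` nbrs G v"
  proof (intro equalityI subsetI)
    fix e assume e: "e \<in> {e \<in> snd G. v \<in> e}"
    then obtain w where "e = {v, w}"
      using simple_graph_edge(2)[OF assms, of e] by (auto simp: card_2_iff)
    then show "e \<in> (\<lambda>w. {v, w}) ` nbrs G v"
      using e by (auto simp: nbrs_def)
  qed (auto simp: nbrs_def)
  moreover have "inj_on (\<lambda>w. {v, w}) (nbrs G v)"
    by (auto simp: inj_on_def doubleton_eq_iff)
  ultimately show ?thesis
    by (simp add: card_image)
qed

lemma sum_degrees:
  assumes "simple_graph G"
  shows "(\<Sum>v\<in>fst G. card (nbrs G v)) = 2 * card (snd G)"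
proof -
  have fin: "finite (fst G)" "finite (snd G)"
    using assms simple_graph_finite_edges[OF assms] unfolding simple_graph_def by blast+
  have "(\<Sum>v\<in>fst G. card (nbrs G v)) = (\<Sum>v\<in>fst G. card {e \<in> snd G. v \<in> e})"
    using card_incident_edges[OF assms] by simp
  also have "\<dots> = 2 * card (snd G)"
  proof (rule sum_multicount)
    show "\<forall>e\<in>snd G. card {v \<in> fst G. v \<in> e} = 2"
    proof
      fix e assume e: "e \<in> snd G"
      then have "{v \<in> fst G. v \<in> e} = e"
        using simple_graph_edge(1)[OF assms e] by auto
      then show "card {v \<in> fst G. v \<in> e} = 2"
        using simple_graph_edge(2)[OF assms e] by simp
    qed
  qed (use fin in auto)
  finally show ?thesis .
qed

text \<open>Contracting \<open>uv\<close> loses the edge itself and one edge for each common neighbour.\<close>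

lemma card_edges_contraction:
  assumes "simple_graph G" "{u, v} \<in> snd G"
  shows "card (snd G) \<le> card (snd (contraction G u v)) + card (nbrs G u \<inter> nbrs G v) + 1"
proof -
  have uv: "u \<noteq> v"
    using simple_graph_edge(2)[OF assms] by auto
  define A where "A = {e \<in> snd G. v \<notin> e}"
  define B where "B = (\<lambda>w. {u, w}) ` (nbrs G v - {u})"
  have con: "snd (contraction G u v) = A \<union> B"
    by (auto simp: contraction_def A_def B_def nbrs_def)
  have fin: "finite A" "finite B"
    using simple_graph_finite_edges[OF assms(1)] finite_nbrs[OF assms(1)] by (auto simp: A_def B_def)
  have "A \<inter> B \<subseteq> (\<lambda>w. {u, w}) ` (nbrs G u \<inter> nbrs G v)"
    by (auto simp: A_def B_def nbrs_def)
  then have "card (A \<inter> B) \<le> card (nbrs G u \<inter> nbrs G v)"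
    using surj_card_le[of "nbrs G u \<inter> nbrs G v"] finite_nbrs[OF assms(1)] by simp
  moreover have "card B = card (nbrs G v - {u})"
    unfolding B_def by (intro card_image) (auto simp: inj_on_def doubleton_eq_iff)
  moreover have "card (nbrs G v) = card (nbrs G v - {u}) + 1"
  proof -
    have "u \<in> nbrs G v"
      using assms(2) by (simp add: nbrs_def insert_commute)
    then show ?thesis
      using finite_nbrs[OF assms(1), of v] card_gt_0_iff[of "nbrs G v"] by (simp add: card_Diff_singleton) (metis Suc_pred empty_iff)
  qed
  moreover have "card (snd G) = card A + card (nbrs G v)"
  proof -
    have "snd G = A \<union> {e \<in> snd G. v \<in> e}" "A \<inter> {e \<in> snd G. v \<in> e} = {}"
      by (auto simp: A_def)
    then show ?thesis
      using card_Un_disjoint[of A "{e \<in> snd G. v \<in> e}"] fin simple_graph_finite_edges[OF assms(1)]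
        card_incident_edges[OF assms(1), of v] by simp
  qed
  moreover have "card (A \<union> B) + card (A \<inter> B) = card A + card B"
    using card_Un_Int[OF fin] by simp
  ultimately show ?thesis
    unfolding con by linarith
qed

text \<open>The handshake lemma inside the neighbourhood of \<open>v\<close>, where numbers of
  common neighbours become degrees.\<close>

lemma dense_neighbourhood:
  assumes "simple_graph G" "\<And>w. w \<in> nbrs G v \<Longrightarrow> 2 * d \<le> card (nbrs G v \<inter> nbrs G w)"
    and "nbrs G v \<noteq> {}"
  shows "d * card (nbrs G v) \<le> card (snd (induced G (nbrs G v)))"
proof -
  let ?N = "nbrs G v"
  have simple: "simple_graph (induced G ?N)"
    using assms nbrs_subset[OF assms(1), of v] by (intro simple_graph_induced) auto
  have "nbrs (induced G ?N) w = ?N \<inter> nbrs G w" if "w \<in> ?N" for w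
    using that by (auto simp: nbrs_def induced_def)
  then have "card ?N * (2 * d) \<le> (\<Sum>w\<in>?N. card (nbrs (induced G ?N) w))"
    using sum_bounded_below[of ?N "2 * d" "\<lambda>w. card (nbrs (induced G ?N) w)"] assms(2) by simp
  also have "\<dots> = 2 * card (snd (induced G ?N))"
    using sum_degrees[OF simple] by (simp add: induced_def)
  finally show ?thesis
    by (simp add: mult.commute)
qed

text \<open>An edge whose ends have few common neighbours can be contracted without lowering the
  density. If there is none, every nonempty neighbourhood is dense enough for the induction on
  \<open>t\<close>, and its centre completes the minor.\<close>

theorem Mader_complete_minor:
  assumes "simple_graph G" "2 ^ t * card (fst G) \<le> card (snd G)"
  shows "\<exists>U. card U = Suc t \<and> is_minor (U, complete_edges U) G"
  using assms
proof (induction t arbitrary: G)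
  case 0
  obtain v where v: "v \<in> fst G"
    using 0 by (auto simp: simple_graph_def)
  have "induced G {v} = ({v}, complete_edges {v})"
  proof -
    have "e \<notin> snd G" if "e \<subseteq> {v}" for e
      using that no_edge_in_singleton simple_graph_edge(2)[OF 0(1)] by metis
    moreover have "e \<notin> complete_edges {v}" for e
      using no_edge_in_singleton by (auto simp: complete_edges_def)
    ultimately show ?thesis
      by (auto simp: induced_def)
  qed
  then show ?case
    using is_minor_induced[OF 0(1), of "{v}"] v by (intro exI[of _ "{v}"]) simp
next
  case (Suc t)
  from Suc.prems show ?case
  proof (induction "card (fst G)" arbitrary: G rule: less_induct)
    case less
    note simple = less.prems(1)
    have finV: "finite (fst G)" and neV: "fst G \<noteq> {}"
      using simple by (auto simp: simple_graph_def)
    show ?case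
    proof (cases "\<exists>u v. {u, v} \<in> snd G \<and> card (nbrs G u \<inter> nbrs G v) < 2 ^ Suc t")
      case True
      then obtain u v where uv: "{u, v} \<in> snd G" "card (nbrs G u \<inter> nbrs G v) < 2 ^ Suc t"
        by blast
      have ne: "u \<noteq> v" and v: "v \<in> fst G"
        using simple_graph_edge[OF simple uv(1)] by auto
      have step: "minor_step G (contraction G u v)"
        using minor_step_contraction[OF uv(1) ne] .
      have fst: "card (fst (contraction G u v)) = card (fst G) - 1" and pos: "0 < card (fst G)"
        using v finV neV by (auto simp: contraction_def card_gt_0_iff)
      \<comment> \<open>Fewer than \<open>2 ^ Suc t\<close> common neighbours and the edge itself:
        at most \<open>2 ^ Suc t\<close> edges are lost together with one vertex.\<close>
      have "2 ^ Suc t * card (fst G) \<le> card (snd (contraction G u v)) + 2 ^ Suc t"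
        using less.prems(2) card_edges_contraction[OF simple uv(1)] uv(2) by linarith
      then have "2 ^ Suc t * (card (fst G) - 1) \<le> card (snd (contraction G u v))"
        by (simp only: diff_mult_distrib2)
      then show ?thesis
        using less.hyps[of "contraction G u v"] fst pos minor_step_simple_graph[OF step simple]
          is_minor_trans minor_step_is_minor[OF step] by (metis diff_less zero_less_one)
    next
      case False
      have "0 < 2 ^ Suc t * card (fst G)"
        using finV neV by (simp add: card_gt_0_iff)
      then have "snd G \<noteq> {}"
        using less.prems(2) by auto
      then obtain v w where vw: "{v, w} \<in> snd G"
        using simple_graph_edge(2)[OF simple] by (metis card_2_iff ex_in_conv)
      let ?N = "nbrs G v"
      have neN: "?N \<noteq> {}"
        using vw by (auto simp: nbrs_def)
      have sub: "?N \<subseteq> fst G - {v}"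
        by (rule nbrs_subset[OF simple])
      have simpleN: "simple_graph (induced G ?N)"
        using simple_graph_induced[OF simple _ neN] sub by blast
      have "2 * 2 ^ t \<le> card (?N \<inter> nbrs G x)" if "x \<in> ?N" for x
        using False that by (simp add: nbrs_def not_less)
      then have "2 ^ t * card ?N \<le> card (snd (induced G ?N))"
        using dense_neighbourhood[OF simple _ neN] by blast
      then obtain U where U: "card U = Suc t" "is_minor (U, complete_edges U) (induced G ?N)"
        using Suc.IH[OF simpleN] by (auto simp: induced_def)
      have vN: "v \<notin> fst (induced G ?N)"
        using sub by (auto simp: induced_def)
      have UN: "U \<subseteq> ?N"
        using is_minor_vertices[OF U(2)] by (simp add: induced_def)
      have finU: "finite U" and vU: "v \<notin> U"
        using U(1) card.infinite UN vN by (force simp: induced_def)+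
      have "cone v (U, complete_edges U) = (insert v U, complete_edges (insert v U))"
        using complete_edges_insert[OF vU] by (simp add: cone_def)
      then have 1: "is_minor (insert v U, complete_edges (insert v U)) (cone v (induced G ?N))"
        using is_minor_cone[OF U(2) simpleN vN] by simp
      \<comment> \<open>The closed neighbourhood is the cone over the open one.\<close>
      have "cone v (induced G ?N) = induced G (insert v ?N)"
      proof -
        have "snd (cone v (induced G ?N)) = {e \<in> snd G. e \<subseteq> insert v ?N}"
        proof (intro equalityI subsetI)
          fix e assume e: "e \<in> {e \<in> snd G. e \<subseteq> insert v ?N}"
          show "e \<in> snd (cone v (induced G ?N))"
          proof (cases "v \<in> e")
            case True
            then obtain x where "e = {v, x}"
              using simple_graph_edge(2)[OF simple, of e] e by (auto simp: card_2_iff)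
            then show ?thesis
              using e by (auto simp: cone_def induced_def nbrs_def)
          next
            case False
            then show ?thesis
              using e by (auto simp: cone_def induced_def)
          qed
        next
          fix e assume "e \<in> snd (cone v (induced G ?N))"
          then show "e \<in> {e \<in> snd G. e \<subseteq> insert v ?N}"
            by (auto simp: cone_def induced_def nbrs_def)
        qed
        then show ?thesis
          by (intro prod_eqI) (simp_all add: cone_def induced_def)
      qed
      moreover have "is_minor (induced G (insert v ?N)) G"
      proof (rule is_minor_induced[OF simple])
        show "insert v ?N \<subseteq> fst G"
          using sub simple_graph_edge(1)[OF simple vw] by auto
      qed simp
      ultimately have "is_minor (insert v U, complete_edges (insert v U)) G"
        using 1 is_minor_trans by metis
      moreover have "card (insert v U) = Suc (Suc t)"
        using finU vU U(1) by simp
      ultimately show ?thesis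
        by blast
    qed
  qed
qed

text \<open>A complete graph on as many vertices as \<open>H\<close> contains a copy of
  \<open>H\<close>, so it is excluded as a minor as well, and Mader's bound applies.\<close>

lemma (in graph_class) linear_edge_bound:
  assumes H: "simple_graph H" "H \<notin> \<B>"
  obtains d where "\<And>G. G \<in> \<B> \<Longrightarrow> card (snd G) \<le> d * card (fst G)"
proof -
  obtain t where t: "card (fst H) = Suc t"
    using H(1) by (metis card_eq_0_iff not0_implies_Suc simple_graph_def)
  have "card (snd G) \<le> 2 ^ t * card (fst G)" if G: "G \<in> \<B>" for G
  proof (rule ccontr)
    assume "\<not> card (snd G) \<le> 2 ^ t * card (fst G)"
    then obtain U where U: "card U = Suc t" "is_minor (U, complete_edges U) G"
      using Mader_complete_minor[OF simple[OF G], of t] by auto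
    have KU: "(U, complete_edges U) \<in> \<B>"
      using is_minor[OF G U(2)] .
    have finU: "finite U"
      using U(1) card.infinite by force
    obtain f where f: "bij_betw f U (fst H)"
      using finite_same_card_bij[OF finU, of "fst H"] H(1) U(1) t unfolding simple_graph_def by metis
    then have inj: "inj_on f U" and im: "f ` U = fst H"
      by (auto simp: bij_betw_def)
    have K: "relabel f (U, complete_edges U) \<in> \<B>"
      using iso[OF KU] inj by simp
    define E where "E = (`) f ` complete_edges U"
    have "snd H \<subseteq> E"
    proof
      fix e assume e: "e \<in> snd H"
      define d where "d = inv_into U f ` e"
      have sub: "e \<subseteq> f ` U" "card e = 2"
        using simple_graph_edge[OF H(1) e] im by auto
      then have "f ` d = e" "d \<subseteq> U"
        using image_inv_into_cancel[of f U "f ` U" e] inv_into_into[of _ f U] by (auto simp: d_def)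
      moreover have "card d = 2"
        using sub calculation card_image[OF inj_on_subset[OF inj]] by metis
      ultimately show "e \<in> E"
        by (auto simp: E_def complete_edges_def)
    qed
    then have "E - (E - snd H) = snd H"
      by blast
    moreover have "is_minor (fst H, E - (E - snd H)) (fst H, E)"
      using finite_complete_edges[OF finU] by (intro is_minor_delete_edges) (auto simp: E_def)
    moreover have "(fst H, E) \<in> \<B>"
      using K im by (simp add: relabel_def E_def)
    ultimately show False
      using is_minor H(2) by (metis prod.collapse)
  qed
  then show ?thesis
    using that by blast
qed

section \<open>Proper minor-closed classes are small\<close>

definition merge :: "'v set \<Rightarrow> ('v \<Rightarrow> 'v) \<Rightarrow> 'v \<Rightarrow> 'v" where
  "merge U f x = (if x \<in> U then f x else x)"

lemma collapse_comp:
  assumes "simple_graph G"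
  shows "collapse f (collapse h G) = collapse (f \<circ> h) G"
proof -
  have card_h: "card (h ` e) = 2" if "e \<in> snd G" "card (f ` h ` e) = 2" for e
    using simple_graph_edge[OF assms that(1)] that(2) card_image_le[of e h] card_image_le[of "h ` e" f]
    by simp
  have "snd (collapse f (collapse h G)) = snd (collapse (f \<circ> h) G)"
  proof (intro equalityI subsetI)
    fix d assume "d \<in> snd (collapse f (collapse h G))"
    then obtain e where "e \<in> snd G" "d = f ` h ` e" "card d = 2"
      by (auto simp: collapse_def)
    then show "d \<in> snd (collapse (f \<circ> h) G)"
      unfolding collapse_def image_comp by auto
  next
    fix d assume "d \<in> snd (collapse (f \<circ> h) G)"
    then obtain e where "e \<in> snd G" "d = f ` h ` e" "card (f ` h ` e) = 2"
      unfolding collapse_def image_comp by auto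
    moreover from this have "h ` e \<in> snd (collapse h G)"
      using card_h by (auto simp: collapse_def)
    ultimately show "d \<in> snd (collapse f (collapse h G))"
      unfolding collapse_def[of f] by auto
  qed
  moreover have "fst (collapse f (collapse h G)) = fst (collapse (f \<circ> h) G)"
    by (simp add: collapse_def image_comp)
  ultimately show ?thesis
    by (rule prod_eqI[rotated])
qed

text \<open>The edges are contracted one at a time. Since \<open>f\<close> maps \<open>U\<close>
  outside \<open>U\<close>, earlier contractions leave the edge at \<open>u\<close> intact and the
  quotient maps compose to \<open>merge\<close>.\<close>

lemma is_minor_collapse_matching:
  assumes "finite U" "simple_graph G"
    and "\<And>u. u \<in> U \<Longrightarrow> {f u, u} \<in> snd G" "\<And>u. u \<in> U \<Longrightarrow> f u \<notin> U"
  shows "is_minor (collapse (merge U f) G) G"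
  using assms
proof (induction rule: finite_induct)
  case empty
  have "collapse (merge {} f) G = G"
    using simple_graph_edge(2)[OF empty(1)]
    by (intro prod_eqI) (auto simp: collapse_def merge_def)
  then show ?case
    by simp
next
  case (insert u U)
  let ?H = "collapse (merge U f) G"
  have H: "is_minor ?H G"
    using insert.prems by (intro insert.IH) auto
  have simple: "simple_graph ?H"
    using is_minor_simple_graph[OF H insert.prems(1)] .
  have ne: "f u \<noteq> u" "f u \<notin> U" "u \<notin> U"
    using insert by auto
  have "merge U f ` {f u, u} = {f u, u}"
    using ne by (simp add: merge_def)
  moreover have "{f u, u} \<in> snd G" "card {f u, u} = 2"
    using insert.prems(2)[of u] simple_graph_edge(2)[OF insert.prems(1)] by auto
  ultimately have edge: "{f u, u} \<in> snd ?H"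
    by (auto simp: collapse_def intro!: exI[of _ "{f u, u}"])
  have "minor_step ?H (collapse (id(u := f u)) ?H)"
    using minor_step_contraction[OF edge ne(1)] collapse_eq_contraction[OF simple edge] by simp
  moreover have "collapse (id(u := f u)) ?H = collapse (id(u := f u) \<circ> merge U f) G"
    by (rule collapse_comp[OF insert.prems(1)])
  moreover have "id(u := f u) \<circ> merge U f = merge (insert u U) f"
    using insert.prems(3) insert.hyps(2) by (fastforce simp: merge_def fun_eq_iff)
  ultimately show ?case
    using H is_minor_trans minor_step_is_minor by metis
qed

definition matching_into :: "'v set \<Rightarrow> ('v \<Rightarrow> 'v) \<Rightarrow> 'v graph \<Rightarrow> bool" where
  "matching_into U f G \<longleftrightarrow> inj_on f U \<and> (\<forall>u\<in>U. {f u, u} \<in> snd G)"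

text \<open>Ensures that deleting \<open>U\<close> loses no information: \<open>U\<close> is
  independent, and the neighbours of \<open>u\<close> can be read off from its twin.\<close>

definition twins_into :: "'v set \<Rightarrow> ('v \<Rightarrow> 'v) \<Rightarrow> 'v graph \<Rightarrow> bool" where
  "twins_into U f G \<longleftrightarrow> (\<forall>u\<in>U. nbrs G u = nbrs G (f u) \<and> nbrs G u \<inter> U = {})"

text \<open>Every fibre of \<open>merge U f\<close> has at most two elements, so a pair has at most four preimages.\<close>

lemma card_preimage_pairs:
  assumes V: "finite V" and U: "U \<subseteq> V" and f: "inj_on f U" and E': "finite E'" "\<And>e. e \<in> E' \<Longrightarrow> card e = 2"
  shows "card {e. e \<subseteq> V \<and> card e = 2 \<and> merge U f ` e \<in> E'} \<le> 4 * card E'"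
proof -
  let ?\<phi> = "merge U f"
  define P where "P e' = {e. e \<subseteq> V \<and> card e = 2 \<and> ?\<phi> ` e = e'}" for e'
  define F where "F x = {a \<in> V. ?\<phi> a = x}" for x
  have F: "finite (F x)" "card (F x) \<le> 2" for x
  proof -
    show "finite (F x)"
      using V by (simp add: F_def)
    have "F x \<subseteq> insert x {a \<in> U. f a = x}"
      by (auto simp: F_def merge_def split: if_splits)
    moreover have fin: "finite {a \<in> U. f a = x}"
      using finite_subset[OF U V] by simp
    moreover have "card {a \<in> U. f a = x} \<le> Suc 0"
      unfolding card_le_Suc0_iff_eq[OF fin] using f by (auto dest: inj_onD)
    ultimately have "card (F x) \<le> card (insert x {a \<in> U. f a = x})"
      by (intro card_mono) auto
    also have "\<dots> \<le> Suc (card {a \<in> U. f a = x})"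
      using fin by (simp add: card_insert_if)
    finally show "card (F x) \<le> 2"
      using \<open>card {a \<in> U. f a = x} \<le> Suc 0\<close> by simp
  qed
  have P: "finite (P e')" "card (P e') \<le> 4" if "e' \<in> E'" for e'
  proof -
    obtain x y where xy: "e' = {x, y}" "x \<noteq> y"
      using E'(2)[OF \<open>e' \<in> E'\<close>] by (auto simp: card_2_iff)
    have "P e' \<subseteq> (\<lambda>(a, b). {a, b}) ` (F x \<times> F y)"
    proof
      fix e assume e: "e \<in> P e'"
      then obtain a b where ab: "e = {a, b}" "a \<noteq> b"
        by (auto simp: P_def card_2_iff)
      then have "{?\<phi> a, ?\<phi> b} = {x, y}" "a \<in> V" "b \<in> V"
        using e xy by (auto simp: P_def)
      then have "(a, b) \<in> F x \<times> F y \<or> (b, a) \<in> F x \<times> F y"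
        by (auto simp: F_def doubleton_eq_iff)
      then show "e \<in> (\<lambda>(a, b). {a, b}) ` (F x \<times> F y)"
        using ab(1) by (auto simp: insert_commute)
    qed
    moreover have fin: "finite (F x \<times> F y)"
      using F(1) by simp
    ultimately have "card (P e') \<le> card (F x \<times> F y)" "finite (P e')"
      using surj_card_le[OF fin] finite_subset[OF _ finite_imageI[OF fin]] by blast+
    moreover have "card (F x \<times> F y) \<le> 2 * 2"
      unfolding card_cartesian_product using F by (intro mult_le_mono)
    ultimately show "finite (P e')" "card (P e') \<le> 4"
      by auto
  qed
  have "{e. e \<subseteq> V \<and> card e = 2 \<and> ?\<phi> ` e \<in> E'} = (\<Union>e'\<in>E'. P e')"
    by (auto simp: P_def)
  also have "card \<dots> \<le> (\<Sum>e'\<in>E'. card (P e'))"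
    by (rule card_UN_le[OF E'(1)])
  also have "\<dots> \<le> (\<Sum>e'\<in>E'. 4)"
    by (intro sum_mono P)
  finally show ?thesis
    by simp
qed

section \<open>Graphs recovered from a smaller graph\<close>

context graph_class
begin

text \<open>The graph is determined by its restriction to \<open>V - U\<close>: the twin
  \<open>f u\<close> survives there and none of the neighbours of \<open>u\<close> has been
  deleted.\<close>

lemma card_twins_le:
  assumes V: "finite V" and U: "U \<subset> V" and f: "f \<in> U \<rightarrow> V - U"
  shows "card {G \<in> \<B>. fst G = V \<and> twins_into U f G} \<le> card {G \<in> \<B>. fst G = V - U}"
proof (rule card_inj_on_le)
  let ?A = "{G \<in> \<B>. fst G = V \<and> twins_into U f G}"
  show "finite {G \<in> \<B>. fst G = V - U}"
    using finite_on[of "V - U" "\<lambda>_. True"] V by simp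
  show "(\<lambda>G. induced G (V - U)) ` ?A \<subseteq> {G \<in> \<B>. fst G = V - U}"
  proof (rule image_subsetI)
    fix G assume G: "G \<in> ?A"
    then have "is_minor (induced G (V - U)) G"
      using U by (intro is_minor_induced simple) auto
    then have "induced G (V - U) \<in> \<B>"
      using G is_minor by blast
    then show "induced G (V - U) \<in> {G \<in> \<B>. fst G = V - U}"
      by (simp add: induced_def)
  qed
  have sub: "snd G \<subseteq> snd H" if G: "G \<in> ?A" and H: "H \<in> ?A" and eq: "induced G (V - U) = induced H (V - U)" for G H
  proof
    fix e assume e: "e \<in> snd G"
    have eq': "e \<in> snd G \<longleftrightarrow> e \<in> snd H" if "e \<subseteq> V - U" for e
      using eq that by (auto simp: induced_def)
    have simpG: "simple_graph G"
      using G simple by auto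
    have eV: "e \<subseteq> V" "card e = 2"
      using simple_graph_edge[OF simpG e] G by auto
    show "e \<in> snd H"
    proof (cases "e \<inter> U = {}")
      case True
      then show ?thesis
        using e eq'[of e] eV by blast
    next
      case False
      then obtain u w where u: "u \<in> U" "e = {u, w}"
        using eV by (auto simp: card_2_iff insert_commute)
      have tG: "nbrs G u = nbrs G (f u)" "nbrs G u \<inter> U = {}" and tH: "nbrs H u = nbrs H (f u)"
        using G H u(1) by (auto simp: twins_into_def)
      have "w \<in> nbrs G u"
        using e u(2) by (simp add: nbrs_def)
      then have "{f u, w} \<in> snd G" "w \<notin> U"
        using tG by (auto simp: nbrs_def)
      moreover have "f u \<in> V - U"
        using f u(1) by auto
      ultimately have "{f u, w} \<in> snd H"
        using eq'[of "{f u, w}"] eV(1) u(2) by auto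
      then have "w \<in> nbrs H u"
        unfolding tH by (simp add: nbrs_def)
      then show ?thesis
        using u(2) by (simp add: nbrs_def)
    qed
  qed
  show "inj_on (\<lambda>G. induced G (V - U)) ?A"
  proof (rule inj_onI)
    fix G H assume "G \<in> ?A" "H \<in> ?A" "induced G (V - U) = induced H (V - U)"
    then have "snd G = snd H" "fst G = fst H"
      using sub[of G H] sub[of H G] by auto
    then show "G = H"
      by (rule prod_eqI[rotated])
  qed
qed

text \<open>After contracting the matching to \<open>G'\<close>, every edge of \<open>G\<close> is a
  matching edge or lies over an edge of \<open>G'\<close>. This leaves at most
  \<open>card U + 4 * card (snd G')\<close> candidate edges, linearly many, and \<open>G\<close> is
  a subset of them.\<close>

lemma card_matching_le:
  assumes V: "finite V" and U: "U \<subset> V" and f: "f \<in> U \<rightarrow> V - U"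
    and d: "\<And>G. G \<in> \<B> \<Longrightarrow> card (snd G) \<le> d * card (fst G)"
  shows "card {G \<in> \<B>. fst G = V \<and> matching_into U f G} \<le>
    card {G \<in> \<B>. fst G = V - U} * 2 ^ ((4 * d + 1) * card V)"
proof (cases "inj_on f U")
  case False
  then show ?thesis
    by (simp add: matching_into_def)
next
  case inj: True
  let ?A = "{G \<in> \<B>. fst G = V \<and> matching_into U f G}"
  let ?B = "{G \<in> \<B>. fst G = V - U}"
  let ?\<phi> = "merge U f"
  have finU: "finite U"
    using V U finite_subset by blast
  define M where "M = (\<lambda>u. {f u, u}) ` U"
  define P where "P G' = M \<union> {e. e \<subseteq> V \<and> card e = 2 \<and> ?\<phi> ` e \<in> snd G'}" for G' :: "nat graph"
  have finP: "finite (P G')" for G'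
    using V finU by (auto simp: P_def M_def intro: finite_subset[of _ "Pow V"])
  have finB: "finite ?B"
    using finite_on[of "V - U" "\<lambda>_. True"] V by simp
  have cardP: "card (P G') \<le> (4 * d + 1) * card V" if "G' \<in> ?B" for G'
  proof -
    have G': "simple_graph G'"
      using that simple by auto
    have "card (P G') \<le> card M + card {e. e \<subseteq> V \<and> card e = 2 \<and> ?\<phi> ` e \<in> snd G'}"
      unfolding P_def by (rule card_Un_le)
    also have "\<dots> \<le> card U + 4 * card (snd G')"
      using card_image_le[OF finU, of "\<lambda>u. {f u, u}"] U
        card_preimage_pairs[OF V _ inj simple_graph_finite_edges[OF G'] simple_graph_edge(2)[OF G']]
      by (intro add_mono) (auto simp: M_def)
    also have "\<dots> \<le> card V + 4 * (d * card V)"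
    proof (intro add_mono mult_le_mono2)
      show "card U \<le> card V"
        using V U by (intro card_mono) auto
      have "card (snd G') \<le> d * card (V - U)"
        using d[of G'] that by auto
      also have "\<dots> \<le> d * card V"
        using V by (intro mult_le_mono2 card_mono) auto
      finally show "card (snd G') \<le> d * card V" .
    qed
    finally show ?thesis
      by (simp add: algebra_simps)
  qed
  have "?A \<subseteq> (\<Union>G'\<in>?B. {V} \<times> Pow (P G'))"
  proof
    fix G assume G: "G \<in> ?A"
    then have simpG: "simple_graph G" and match: "\<And>u. u \<in> U \<Longrightarrow> {f u, u} \<in> snd G"
      using simple by (auto simp: matching_into_def)
    have minor: "is_minor (collapse ?\<phi> G) G"
      using finU simpG match f by (intro is_minor_collapse_matching) auto
    have "?\<phi> ` V = V - U"
      using f by (auto simp: merge_def image_iff split: if_splits)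
    then have B: "collapse ?\<phi> G \<in> ?B"
      using is_minor[OF _ minor] G by (simp add: collapse_def)
    have "snd G \<subseteq> P (collapse ?\<phi> G)"
    proof
      fix e assume e: "e \<in> snd G"
      have eV: "e \<subseteq> V" "card e = 2" "finite e"
        using simple_graph_edge[OF simpG e] G by auto
      show "e \<in> P (collapse ?\<phi> G)"
      proof (cases "card (?\<phi> ` e) = 2")
        case True
        then show ?thesis
          using e eV by (auto simp: P_def collapse_def)
      next
        case False
        obtain a b where ab: "e = {a, b}" "a \<noteq> b"
          using eV(2) by (auto simp: card_2_iff)
        then have "?\<phi> a = ?\<phi> b"
          using False by (auto simp: card_2_iff)
        \<comment> \<open>Injectivity of \<open>f\<close> excludes that two vertices of
          \<open>U\<close> are identified, so one end is the partner of the other.\<close>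
        then have "(a \<in> U \<and> b = f a) \<or> (b \<in> U \<and> a = f b)"
          using ab(2) inj by (auto simp: merge_def dest: inj_onD split: if_splits)
        then show ?thesis
          using ab(1) by (auto simp: P_def M_def insert_commute)
      qed
    qed
    then show "G \<in> (\<Union>G'\<in>?B. {V} \<times> Pow (P G'))"
      using G B by (intro UN_I[of "collapse ?\<phi> G"]) (auto simp: mem_Times_iff)
  qed
  then have "card ?A \<le> card (\<Union>G'\<in>?B. {V} \<times> Pow (P G'))"
    using finB finP by (intro card_mono finite_UN_I) auto
  also have "\<dots> \<le> (\<Sum>G'\<in>?B. card ({V} \<times> Pow (P G')))"
    by (rule card_UN_le[OF finB])
  also have "\<dots> \<le> (\<Sum>G'\<in>?B. 2 ^ ((4 * d + 1) * card V))"
  proof (intro sum_mono)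
    fix G' assume "G' \<in> ?B"
    then show "card ({V} \<times> Pow (P G')) \<le> 2 ^ ((4 * d + 1) * card V)"
      using cardP by (simp add: card_cartesian_product card_Pow finP)
  qed
  finally show ?thesis
    by simp
qed

text \<open>A union bound over the choices of \<open>U\<close> and \<open>f\<close>; for each choice
  the graph comes from one on \<open>n - m\<close> vertices.\<close>

lemma egf_recursion:
  assumes d: "\<And>G. G \<in> \<B> \<Longrightarrow> card (snd G) \<le> d * card (fst G)"
    and m: "m < n"
    and dich: "\<And>G. G \<in> labelled \<B> n \<Longrightarrow> \<exists>U f. U \<subseteq> {1..n} \<and> card U = m \<and> f \<in> U \<rightarrow> {1..n} - U \<and>
      (matching_into U f G \<or> twins_into U f G)"
  shows "card (labelled \<B> n) \<le>
    (n choose m) * (n - m) ^ m * (card (labelled \<B> (n - m)) * 2 ^ ((4 * d + 2) * n))"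
proof -
  define V where "V = {1..n}"
  \<comment> \<open>Extensional functions are taken, since only the values on \<open>U\<close>
    matter and only then is the index set finite.\<close>
  define I where "I = (SIGMA U:{U. U \<subseteq> V \<and> card U = m}. (U \<rightarrow>\<^sub>E V - U))"
  define K where "K = (\<lambda>(U, f). {G \<in> \<B>. fst G = V \<and> matching_into U f G} \<union> {G \<in> \<B>. fst G = V \<and> twins_into U f G})"
  have V: "finite V" "card V = n"
    by (auto simp: V_def)
  have finI: "finite I"
    unfolding I_def using V by (intro finite_SigmaI finite_PiE) (auto intro: finite_subset[of _ "Pow V"] finite_subset)
  have UV: "U \<subset> V" "finite U" "card (V - U) = n - m" if "U \<subseteq> V" "card U = m" for U
    using that V m finite_subset[OF that(1)] by (auto simp: card_Diff_subset)
  have cardI: "card I = (n choose m) * (n - m) ^ m"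
  proof -
    have "card (U \<rightarrow>\<^sub>E V - U) = (n - m) ^ m" if "U \<in> {U. U \<subseteq> V \<and> card U = m}" for U
      using that UV[of U] by (simp add: card_PiE)
    then have "card I = card {U. U \<subseteq> V \<and> card U = m} * (n - m) ^ m"
      unfolding I_def using V UV
      by (subst card_SigmaI) (auto intro!: finite_PiE intro: finite_subset[of _ "Pow V"])
    then show ?thesis
      using n_subsets[OF V(1), of m] V by simp
  qed
  have cardK: "card (K p) \<le> card (labelled \<B> (n - m)) * 2 ^ ((4 * d + 2) * n)" if p: "p \<in> I" for p
  proof -
    obtain U f where Uf: "p = (U, f)" "U \<subseteq> V" "card U = m" "f \<in> U \<rightarrow> V - U"
      using p by (auto simp: I_def)
    define b where "b = card (labelled \<B> (n - m))"
    have b: "card {G \<in> \<B>. fst G = V - U} = b"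
      using card_on_labelled[of "V - U"] V UV[OF Uf(2,3)] by (simp add: b_def)
    have "card (K p) \<le> card {G \<in> \<B>. fst G = V \<and> matching_into U f G} + card {G \<in> \<B>. fst G = V \<and> twins_into U f G}"
      unfolding K_def Uf(1) prod.case by (rule card_Un_le)
    also have "\<dots> \<le> b * 2 ^ ((4 * d + 1) * n) + b * 1"
      using card_matching_le[OF V(1) UV(1)[OF Uf(2,3)] Uf(4) d] card_twins_le[OF V(1) UV(1)[OF Uf(2,3)] Uf(4)]
      unfolding b V(2) by simp
    also have "\<dots> \<le> b * 2 ^ ((4 * d + 1) * n) + b * 2 ^ ((4 * d + 1) * n)"
      by (intro add_left_mono mult_le_mono2) simp
    also have "\<dots> = b * 2 ^ ((4 * d + 1) * n + 1)"
      by simp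
    \<comment> \<open>The extra \<open>n\<close> in the exponent absorbs the factor 2 from adding
      the two cases, as \<open>n\<close> is positive.\<close>
    also have "\<dots> \<le> b * 2 ^ ((4 * d + 2) * n)"
      using m by (intro mult_le_mono2 power_increasing) auto
    finally show ?thesis
      by (simp add: b_def)
  qed
  have "labelled \<B> n \<subseteq> (\<Union>p\<in>I. K p)"
  proof
    fix G assume G: "G \<in> labelled \<B> n"
    obtain U f where Uf: "U \<subseteq> V" "card U = m" "f \<in> U \<rightarrow> V - U" "matching_into U f G \<or> twins_into U f G"
      using dich[OF G] unfolding V_def by blast
    define f' where "f' = restrict f U"
    have "matching_into U f' G \<or> twins_into U f' G"
      using Uf(4) by (auto simp: f'_def matching_into_def twins_into_def inj_on_def)
    moreover have "(U, f') \<in> I"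
      using Uf by (auto simp: I_def f'_def)
    ultimately show "G \<in> (\<Union>p\<in>I. K p)"
      using G by (intro UN_I[of "(U, f')"]) (auto simp: K_def labelled_def V_def)
  qed
  moreover have "finite (K p)" for p
    using finite_on[OF V(1)] by (simp add: K_def split: prod.split)
  ultimately have "card (labelled \<B> n) \<le> card (\<Union>p\<in>I. K p)"
    using finI by (intro card_mono) auto
  also have "\<dots> \<le> (\<Sum>p\<in>I. card (K p))"
    by (rule card_UN_le[OF finI])
  also have "\<dots> \<le> (\<Sum>p\<in>I. card (labelled \<B> (n - m)) * 2 ^ ((4 * d + 2) * n))"
    by (intro sum_mono cardK)
  also have "\<dots> = (n choose m) * (n - m) ^ m * (card (labelled \<B> (n - m)) * 2 ^ ((4 * d + 2) * n))"
    using cardI by simp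
  finally show ?thesis .
qed

end

section \<open>Few cliques, and the choice between a matching and twins\<close>

definition cliques :: "'v graph \<Rightarrow> 'v set set" where
  "cliques G = {Q. Q \<subseteq> fst G \<and> (\<forall>x\<in>Q. \<forall>y\<in>Q. x \<noteq> y \<longrightarrow> {x, y} \<in> snd G)}"

lemma finite_cliques: "simple_graph G \<Longrightarrow> finite (cliques G)"
  by (rule finite_subset[of _ "Pow (fst G)"]) (auto simp: cliques_def simple_graph_def)

context graph_class
begin

lemma induced_in: "G \<in> \<B> \<Longrightarrow> U \<subseteq> fst G \<Longrightarrow> U \<noteq> {} \<Longrightarrow> induced G U \<in> \<B>"
  using is_minor is_minor_induced simple by blast

text \<open>Degeneracy: some vertex \<open>v\<close> has degree at most \<open>2 * d\<close>, so at
  most \<open>2 ^ (2 * d)\<close> cliques contain it, and the others survive in the graph without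
  \<open>v\<close>. The summand 1 is the empty clique.\<close>

lemma card_cliques_le:
  assumes d: "\<And>G. G \<in> \<B> \<Longrightarrow> card (snd G) \<le> d * card (fst G)"
    and G: "G \<in> \<B>"
  shows "card (cliques G) \<le> 1 + 2 ^ (2 * d) * card (fst G)"
  using G
proof (induction "card (fst G)" arbitrary: G)
  case 0
  then show ?case
    using simple[of G] by (simp add: simple_graph_def)
next
  case (Suc n)
  have sG: "simple_graph G" and fin: "finite (fst G)" "fst G \<noteq> {}"
    using simple[OF Suc.prems] by (auto simp: simple_graph_def)
  \<comment> \<open>The average degree is at most \<open>2 * d\<close>.\<close>
  have "\<exists>v\<in>fst G. card (nbrs G v) \<le> 2 * d"
  proof (rule ccontr)
    assume "\<not> ?thesis"
    then have "(\<Sum>v\<in>fst G. 2 * d) < (\<Sum>v\<in>fst G. card (nbrs G v))"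
      using fin by (intro sum_strict_mono) auto
    then show False
      using sum_degrees[OF sG] d[OF Suc.prems] by (simp add: mult.commute)
  qed
  then obtain v where v: "v \<in> fst G" "card (nbrs G v) \<le> 2 * d"
    by blast
  define C where "C = {Q \<in> cliques G. v \<notin> Q}"
  have cardC: "card C \<le> 1 + 2 ^ (2 * d) * n"
  proof (cases "fst G = {v}")
    case True
    then have "C \<subseteq> {{}}"
      by (auto simp: C_def cliques_def)
    then have "card C \<le> card {{} :: nat set}"
      by (intro card_mono) auto
    then show ?thesis
      by simp
  next
    case False
    define H where "H = induced G (fst G - {v})"
    have H: "H \<in> \<B>" "fst H = fst G - {v}" "card (fst H) = n"
      using Suc.hyps(2) Suc.prems v False fin induced_in[of G "fst G - {v}"] by (auto simp: H_def induced_def)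
    have "C \<subseteq> cliques H"
      by (auto simp: C_def cliques_def H_def induced_def)
    then have "card C \<le> card (cliques H)"
      using finite_cliques[OF simple[OF H(1)]] by (rule card_mono[rotated])
    then show ?thesis
      using Suc.hyps(1)[of H] H by simp
  qed
  have "cliques G \<subseteq> C \<union> insert v ` Pow (nbrs G v)"
  proof
    fix Q assume Q: "Q \<in> cliques G"
    show "Q \<in> C \<union> insert v ` Pow (nbrs G v)"
    proof (cases "v \<in> Q")
      case True
      then have "Q = insert v (Q - {v})" "Q - {v} \<in> Pow (nbrs G v)"
        using Q by (auto simp: cliques_def nbrs_def)
      then show ?thesis
        by blast
    next
      case False
      then show ?thesis
        using Q by (simp add: C_def)
    qed
  qed
  then have "card (cliques G) \<le> card (C \<union> insert v ` Pow (nbrs G v))"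
    using finite_cliques[OF sG] finite_nbrs[OF sG] by (intro card_mono) (auto simp: C_def)
  also have "\<dots> \<le> card C + card (insert v ` Pow (nbrs G v))"
    by (rule card_Un_le)
  also have "card (insert v ` Pow (nbrs G v)) \<le> card (Pow (nbrs G v))"
    using finite_nbrs[OF sG] by (intro card_image_le) simp
  also have "\<dots> \<le> 2 ^ (2 * d)"
    using v(2) finite_nbrs[OF sG] by (simp add: card_Pow)
  finally show ?case
    using cardC Suc.hyps(2) by (simp flip: Suc.hyps(2))
qed

text \<open>Vertices of the independent set outside \<open>Y\<close> are contracted into \<open>Y\<close> as long as this creates
  a new edge inside \<open>Y\<close>; when no further step is possible, the neighbourhoods are cliques.\<close>

lemma contract_into:
  assumes "G \<in> \<B>" "Y \<subseteq> fst G" "Y \<noteq> {}" "\<And>e. e \<in> snd G \<Longrightarrow> e \<inter> Y \<noteq> {}"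
  shows "\<exists>E' S. (Y, E') \<in> \<B> \<and> S \<subseteq> fst G - Y \<and> card S + card {e \<in> snd G. e \<subseteq> Y} \<le> card E' \<and>
    (\<forall>s\<in>fst G - Y - S. nbrs G s \<in> cliques (Y, E'))"
  using assms
proof (induction "card (fst G - Y)" arbitrary: G rule: less_induct)
  case less
  note indep = less.prems(4)
  have sG: "simple_graph G" and finV: "finite (fst G)"
    using simple[OF less.prems(1)] by (auto simp: simple_graph_def)
  define E where "E = {e \<in> snd G. e \<subseteq> Y}"
  have nbrsY: "nbrs G s \<subseteq> Y" if "s \<in> fst G - Y" for s
  proof
    fix w assume "w \<in> nbrs G s"
    then have "{s, w} \<inter> Y \<noteq> {}"
      using indep[of "{s, w}"] by (simp add: nbrs_def)
    then show "w \<in> Y"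
      using that by auto
  qed
  show ?case
  proof (cases "\<forall>s\<in>fst G - Y. nbrs G s \<in> cliques (Y, E)")
    case True
    have "(Y, E) \<in> \<B>"
      using induced_in[OF less.prems(1-3)] by (simp add: induced_def E_def)
    then show ?thesis
      using True by (intro exI[of _ E] exI[of _ "{}"]) (simp add: E_def)
  next
    case False
    then obtain s where s: "s \<in> fst G - Y" "nbrs G s \<notin> cliques (Y, E)"
      by blast
    then obtain x y where xy: "x \<in> nbrs G s" "y \<in> nbrs G s" "x \<noteq> y" "{x, y} \<notin> E"
      using nbrsY[OF s(1)] by (auto simp: cliques_def)
    have xyY: "x \<in> Y" "y \<in> Y"
      using nbrsY[OF s(1)] xy by auto
    have ne: "x \<noteq> s" "y \<noteq> s"
      using xyY s by auto
    define H where "H = contraction G x s"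
    have edge: "{x, s} \<in> snd G"
      using xy(1) by (simp add: nbrs_def insert_commute)
    have H: "H \<in> \<B>"
      using minor[OF less.prems(1) minor_step_contraction[OF edge ne(1)]] by (simp add: H_def)
    have fstH: "fst H = fst G - {s}"
      by (simp add: H_def contraction_def)
    have edges: "e \<in> snd H" if "e \<in> snd G" "s \<notin> e" for e
      using that by (auto simp: H_def contraction_def)
    have new: "{x, y} \<in> snd H"
      using xy ne by (auto simp: H_def contraction_def nbrs_def)
    have "\<exists>E' S. (Y, E') \<in> \<B> \<and> S \<subseteq> fst H - Y \<and> card S + card {e \<in> snd H. e \<subseteq> Y} \<le> card E' \<and>
        (\<forall>s\<in>fst H - Y - S. nbrs H s \<in> cliques (Y, E'))"
    proof (rule less.hyps[OF _ H])
      have "fst H - Y \<subset> fst G - Y"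
        using s fstH by auto
      then show "card (fst H - Y) < card (fst G - Y)"
        using finV by (intro psubset_card_mono) auto
      show "Y \<subseteq> fst H" "Y \<noteq> {}"
        using less.prems s fstH by auto
      show "e \<inter> Y \<noteq> {}" if "e \<in> snd H" for e
        using that indep xyY by (auto simp: H_def contraction_def)
    qed
    then obtain E' S where E'S: "(Y, E') \<in> \<B>" "S \<subseteq> fst H - Y"
        "card S + card {e \<in> snd H. e \<subseteq> Y} \<le> card E'" "\<forall>t\<in>fst H - Y - S. nbrs H t \<in> cliques (Y, E')"
      by blast
    \<comment> \<open>The new edge \<open>{x, y}\<close> pays for the contracted vertex
      \<open>s\<close>, so the size of \<open>S\<close> is bounded by the final number of edges on
      \<open>Y\<close>.\<close>
    have "insert {x, y} E \<subseteq> {e \<in> snd H. e \<subseteq> Y}"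
      using edges new xyY s by (auto simp: E_def)
    then have "card (insert {x, y} E) \<le> card {e \<in> snd H. e \<subseteq> Y}"
      using simple_graph_finite_edges[OF simple[OF H]] by (intro card_mono) auto
    moreover have "card (insert {x, y} E) = Suc (card E)"
      using simple_graph_finite_edges[OF sG] xy(4) by (simp add: E_def)
    moreover have "card (insert s S) \<le> Suc (card S)"
      by (rule card_insert_le_m1) simp_all
    ultimately have "card (insert s S) + card E \<le> card E'"
      using E'S(3) by linarith
    moreover have "nbrs G t \<in> cliques (Y, E')" if t: "t \<in> fst G - Y - insert s S" for t
    proof -
      have "nbrs G t \<subseteq> nbrs H t"
      proof
        fix w assume w: "w \<in> nbrs G t"
        then have "w \<in> Y"
          using nbrsY t by blast
        then have "s \<notin> {t, w}"
          using s t by auto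
        then show "w \<in> nbrs H t"
          using edges w by (simp add: nbrs_def)
      qed
      moreover have "nbrs H t \<in> cliques (Y, E')"
        using E'S(4) t fstH by auto
      ultimately show ?thesis
        by (auto simp: cliques_def)
    qed
    moreover have "insert s S \<subseteq> fst G - Y"
      using E'S(2) s fstH by auto
    ultimately show ?thesis
      using E'S(1) unfolding E_def by (intro exI[of _ E'] exI[of _ "insert s S"]) blast
  qed
qed

text \<open>Without a matching of size \<open>m\<close>, the ends of a maximum matching meet all
  edges. Setting aside these ends, at most \<open>2 * d * m\<close> contracted vertices and one
  representative for each remaining neighbourhood leaves at least \<open>m\<close> vertices; the
  constant is the sum of these contributions.\<close>

lemma matching_or_twins:
  assumes d: "\<And>G. G \<in> \<B> \<Longrightarrow> card (snd G) \<le> d * card (fst G)"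
    and G: "G \<in> \<B>" and m: "0 < m" "(4 + 2 * d + 2 * 2 ^ (2 * d)) * m \<le> card (fst G)"
  shows "\<exists>U f. U \<subseteq> fst G \<and> card U = m \<and> f \<in> U \<rightarrow> fst G - U \<and> (matching_into U f G \<or> twins_into U f G)"
proof -
  define V where "V = fst G"
  have sG: "simple_graph G" and finV: "finite V" and neV: "V \<noteq> {}"
    using simple[OF G] by (auto simp: simple_graph_def V_def)
  define mat where "mat U \<longleftrightarrow> (\<exists>f. U \<subseteq> V \<and> f \<in> U \<rightarrow> V - U \<and> matching_into U f G)" for U
  show ?thesis
  proof (cases "\<exists>U. mat U \<and> m \<le> card U")
    case True
    then obtain U f where U: "U \<subseteq> V" "f \<in> U \<rightarrow> V - U" "matching_into U f G" "m \<le> card U"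
      by (auto simp: mat_def)
    obtain W where W: "W \<subseteq> U" "card W = m"
      using obtain_subset_with_card_n[OF U(4)] by metis
    have "W \<subseteq> V" "f \<in> W \<rightarrow> V - W" "matching_into W f G"
      using U W by (auto simp: matching_into_def intro: inj_on_subset)
    then show ?thesis
      using W(2) unfolding V_def by blast
  next
    case False
    have "mat {}"
      by (auto simp: mat_def matching_into_def)
    moreover have "\<forall>U. mat U \<longrightarrow> card U < m"
      using False by (auto simp: not_le)
    \<comment> \<open>A largest matching, given by one side \<open>U\<close> and the partner
      map.\<close>
    ultimately obtain U where U: "mat U" "\<And>W. mat W \<Longrightarrow> card W \<le> card U"
      using ex_has_greatest_nat[of mat "{}" card m] by (metis less_imp_le)
    obtain f where f: "U \<subseteq> V" "f \<in> U \<rightarrow> V - U" "matching_into U f G"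
      using U(1) by (auto simp: mat_def)
    have finU: "finite U" and cardU: "card U < m"
      using f(1) finV finite_subset False U(1) by (auto simp: not_le)
    obtain v0 where v0: "v0 \<in> V"
      using neV by blast
    \<comment> \<open>The vertex \<open>v0\<close> keeps \<open>Y\<close> nonempty if there is no
      edge at all; as \<open>card U < m\<close>, the bound \<open>2 * m\<close> still holds.\<close>
    define Y where "Y = insert v0 (U \<union> f ` U)"
    have Y: "Y \<subseteq> V" "Y \<noteq> {}" "finite Y"
      using f v0 finU by (auto simp: Y_def)
    have cardY: "card Y \<le> 2 * m"
    proof -
      have "card Y \<le> Suc (card (U \<union> f ` U))"
        unfolding Y_def using finU by (simp add: card_insert_if)
      moreover have "card (U \<union> f ` U) \<le> card U + card U"
        using card_Un_le[of U "f ` U"] card_image_le[OF finU, of f] by linarith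
      ultimately show ?thesis
        using cardU by linarith
    qed
    have indep: "e \<inter> Y \<noteq> {}" if e: "e \<in> snd G" for e
    proof
      assume disj: "e \<inter> Y = {}"
      obtain a b where ab: "e = {a, b}" "a \<noteq> b"
        using simple_graph_edge(2)[OF sG e] by (auto simp: card_2_iff)
      have abV: "a \<in> V" "b \<in> V"
        using simple_graph_edge(1)[OF sG e] ab by (auto simp: V_def)
      have out: "a \<notin> U" "b \<notin> U" "a \<notin> f ` U" "b \<notin> f ` U"
        using disj ab by (auto simp: Y_def)
      \<comment> \<open>An edge that misses \<open>Y\<close> would enlarge the matching.\<close>
      define h where "h = f(a := b)"
      have hU: "h u = f u" if "u \<in> U" for u
        using that out by (auto simp: h_def)
      have "h \<in> insert a U \<rightarrow> V - insert a U"
        using f(2) hU abV ab out by (auto simp: h_def)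
      moreover have "inj_on h (insert a U)"
        using f(3) out by (auto simp: matching_into_def h_def inj_on_def)
      moreover have "\<forall>u\<in>insert a U. {h u, u} \<in> snd G"
        using f(3) hU e ab by (auto simp: matching_into_def h_def insert_commute)
      ultimately have "mat (insert a U)"
        using f(1) abV unfolding mat_def matching_into_def by blast
      then show False
        using U(2)[of "insert a U"] finU out by simp
    qed
    obtain E' S where E'S: "(Y, E') \<in> \<B>" "S \<subseteq> V - Y" "card S + card {e \<in> snd G. e \<subseteq> Y} \<le> card E'"
        "\<forall>s\<in>V - Y - S. nbrs G s \<in> cliques (Y, E')"
      using contract_into[OF G _ Y(2) indep] Y(1) unfolding V_def by blast
    have "card E' \<le> d * card Y"
      using d[OF E'S(1)] by simp
    then have cardS: "card S \<le> d * (2 * m)"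
      using E'S(3) mult_le_mono2[OF cardY, of d] by linarith
    have "card (cliques (Y, E')) \<le> 1 + 2 ^ (2 * d) * card Y"
      using card_cliques_le[OF d E'S(1)] by simp
    also have "\<dots> \<le> 1 + 2 ^ (2 * d) * (2 * m)"
      using cardY by (intro add_left_mono mult_le_mono2)
    finally have cardC: "card (cliques (Y, E')) \<le> 1 + 2 ^ (2 * d) * (2 * m)" .
    define S2 where "S2 = V - Y - S"
    \<comment> \<open>One vertex is selected for each neighbourhood that occurs; all other vertices
      of \<open>S2\<close> are twins of a selected one. They are pairwise non-adjacent, because
      their neighbours lie in \<open>Y\<close>.\<close>
    define rep where "rep N = (SOME s. s \<in> S2 \<and> nbrs G s = N)" for N
    have rep: "rep (nbrs G s) \<in> S2" "nbrs G (rep (nbrs G s)) = nbrs G s" if "s \<in> S2" for s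
      using someI[of "\<lambda>t. t \<in> S2 \<and> nbrs G t = nbrs G s" s] that by (auto simp: rep_def)
    define R where "R = rep ` nbrs G ` S2"
    have finC: "finite (cliques (Y, E'))"
      using finite_cliques[OF simple[OF E'S(1)]] .
    have "nbrs G ` S2 \<subseteq> cliques (Y, E')"
      using E'S(4) by (auto simp: S2_def)
    then have "card (nbrs G ` S2) \<le> card (cliques (Y, E'))" "finite (nbrs G ` S2)"
      using finC by (auto intro: card_mono finite_subset)
    then have cardR: "card R \<le> 1 + 2 ^ (2 * d) * (2 * m)"
      using card_image_le[of "nbrs G ` S2" rep] cardC unfolding R_def by linarith
    have "finite (Y \<union> S \<union> R \<union> (S2 - R))"
      using Y(3) finV finite_subset[OF E'S(2)] \<open>finite (nbrs G ` S2)\<close> by (simp add: S2_def R_def)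
    then have "card V \<le> card (Y \<union> S \<union> R \<union> (S2 - R))"
      by (rule card_mono) (auto simp: S2_def)
    also have "\<dots> \<le> card Y + card S + card R + card (S2 - R)"
      using card_Un_le[of "Y \<union> S \<union> R" "S2 - R"] card_Un_le[of "Y \<union> S" R] card_Un_le[of Y S] by linarith
    finally have "card V \<le> 2 * m + d * (2 * m) + (1 + 2 ^ (2 * d) * (2 * m)) + card (S2 - R)"
      using cardY cardS cardR by linarith
    moreover have "(4 + 2 * d + 2 * 2 ^ (2 * d)) * m = 4 * m + d * (2 * m) + 2 ^ (2 * d) * (2 * m)"
      by (simp add: algebra_simps)
    ultimately have "m \<le> card (S2 - R)"
      using m unfolding V_def[symmetric] by linarith
    then obtain W where W: "W \<subseteq> S2 - R" "card W = m"
      using obtain_subset_with_card_n by metis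
    define h where "h u = rep (nbrs G u)" for u
    have "h \<in> W \<rightarrow> V - W"
    proof
      fix u assume u: "u \<in> W"
      then have "h u \<in> S2" "h u \<in> R"
        using W(1) rep(1) by (auto simp: h_def R_def)
      then show "h u \<in> V - W"
        using W(1) by (auto simp: S2_def)
    qed
    moreover have "twins_into W h G"
    proof -
      have "nbrs G u \<subseteq> Y" if "u \<in> W" for u
        using E'S(4) W(1) that by (auto simp: S2_def cliques_def)
      moreover have "W \<inter> Y = {}"
        using W(1) by (auto simp: S2_def)
      ultimately have "nbrs G u \<inter> W = {}" if "u \<in> W" for u
        using that by blast
      moreover have "nbrs G u = nbrs G (h u)" if "u \<in> W" for u
        using rep(2) W(1) that by (auto simp: h_def)
      ultimately show ?thesis
        by (simp add: twins_into_def)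
    qed
    moreover have "W \<subseteq> V"
      using W(1) by (auto simp: S2_def)
    ultimately show ?thesis
      using W(2) unfolding V_def by blast
  qed
qed

section \<open>Positivity of the radius of convergence\<close>

lemma power_div_fact_le: "real n ^ m / fact m \<le> 4 ^ n"
proof -
  have sums: "(\<lambda>k. real n ^ k /\<^sub>R fact k) sums exp (real n)"
    by (rule exp_converges)
  \<comment> \<open>A single term of the exponential series is at most its sum; the base is then
    rounded up to a power of 2.\<close>
  have "(\<Sum>k\<in>{m}. real n ^ k /\<^sub>R fact k) \<le> (\<Sum>k. real n ^ k /\<^sub>R fact k)"
    using sums by (intro sum_le_suminf) (auto simp: sums_iff)
  then have "real n ^ m / fact m \<le> exp (real n)"
    using sums by (simp add: sums_iff divide_inverse mult.commute)
  also have "\<dots> = exp 1 ^ n"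
    by (simp flip: exp_of_nat_mult)
  also have "\<dots> \<le> 4 ^ n"
    using exp_le by (intro power_mono) auto
  finally show ?thesis .
qed

text \<open>The recursion removes \<open>n div L\<close> vertices at the price of
  \<open>2 ^ (D * n)\<close>. This is at most a constant factor \<open>C\<close> for each removed
  vertex, so induction gives an exponential bound.\<close>

theorem egf_radius_pos:
  assumes H: "simple_graph H" "H \<notin> \<B>"
  shows "0 < egf_radius \<B>"
proof -
  obtain d where d: "\<And>G. G \<in> \<B> \<Longrightarrow> card (snd G) \<le> d * card (fst G)"
    using linear_edge_bound[OF H] by blast
  define L where "L = 4 + 2 * d + 2 * 2 ^ (2 * d :: nat)"
  \<comment> \<open>The exponent \<open>4 * d + 2\<close> of the recursion, and 2 more for
    \<open>4 ^ n\<close>.\<close>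
  define D where "D = 4 * d + 4"
  \<comment> \<open>For \<open>n \<ge> L\<close> and \<open>m = n div L\<close> one has
    \<open>n < 2 * L * m\<close>, hence \<open>2 ^ (D * n) \<le> C ^ m\<close>.\<close>
  define C where "C = (2 :: real) ^ (D * (2 * L))"
  have L: "0 < L"
    by (simp add: L_def)
  have rec: "egf_coeff \<B> n \<le> 2 ^ (D * n) * egf_coeff \<B> (n - m)"
    if n: "L \<le> n" and m: "m = n div L" for n m
  proof -
    have m0: "0 < m"
      using n L m by (simp add: div_greater_zero_iff)
    have Lm: "L * m \<le> n"
      using m by simp
    have "4 * m \<le> L * m"
      by (intro mult_le_mono1) (simp add: L_def)
    then have mn: "m < n"
      using Lm m0 by linarith
    have "card (labelled \<B> n) \<le>
        (n choose m) * (n - m) ^ m * (card (labelled \<B> (n - m)) * 2 ^ ((4 * d + 2) * n))"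
    proof (rule egf_recursion[OF d mn])
      fix G assume "G \<in> labelled \<B> n"
      then have "G \<in> \<B>" "fst G = {1..n}"
        by (auto simp: labelled_def)
      then show "\<exists>U f. U \<subseteq> {1..n} \<and> card U = m \<and> f \<in> U \<rightarrow> {1..n} - U \<and>
          (matching_into U f G \<or> twins_into U f G)"
        using matching_or_twins[OF d \<open>G \<in> \<B>\<close> m0] Lm by (simp add: L_def)
    qed simp
    also have "\<dots> \<le> (n choose m) * n ^ m * (card (labelled \<B> (n - m)) * 2 ^ ((4 * d + 2) * n))"
      by (intro mult_le_mono1 mult_le_mono2 power_mono) auto
    finally have "real (card (labelled \<B> n)) \<le>
        real (n choose m) * real n ^ m * (real (card (labelled \<B> (n - m))) * 2 ^ ((4 * d + 2) * n))"
      by (metis (mono_tags, opaque_lifting) of_nat_le_iff of_nat_mult of_nat_numeral of_nat_power)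
    then have "egf_coeff \<B> n \<le>
        real (n choose m) * real n ^ m * (real (card (labelled \<B> (n - m))) * 2 ^ ((4 * d + 2) * n)) / fact n"
      unfolding egf_coeff_def by (rule divide_right_mono) simp
    \<comment> \<open>The normalisation cancels against the binomial coefficient, since
      \<open>(n choose m) * fact (n - m) / fact n\<close> is \<open>1 / fact m\<close>.\<close>
    also have "\<dots> = (real n ^ m / fact m) * 2 ^ ((4 * d + 2) * n) * egf_coeff \<B> (n - m)"
      using mn by (simp add: binomial_fact egf_coeff_def)
    also have "\<dots> \<le> 4 ^ n * 2 ^ ((4 * d + 2) * n) * egf_coeff \<B> (n - m)"
      by (intro mult_right_mono power_div_fact_le) auto
    also have "(4 :: real) ^ n * 2 ^ ((4 * d + 2) * n) = 2 ^ (D * n)"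
    proof -
      have "(4 :: real) ^ n = 2 ^ (2 * n)"
        by (simp add: power_mult)
      moreover have "D * n = 2 * n + (4 * d + 2) * n"
        by (simp add: D_def algebra_simps)
      ultimately show ?thesis
        by (simp only: power_add)
    qed
    finally show ?thesis .
  qed
  \<comment> \<open>Covers the values \<open>n < L\<close>, where no vertex would be
    removed.\<close>
  define K where "K = Max (insert 1 (egf_coeff \<B> ` {..<L}))"
  have K: "1 \<le> K" "\<And>n. n < L \<Longrightarrow> egf_coeff \<B> n \<le> K"
    by (auto simp: K_def)
  have C1: "1 \<le> C"
    by (simp add: C_def)
  have bound: "egf_coeff \<B> n \<le> K * C ^ n" for n
  proof (induction n rule: less_induct)
    case (less n)
    show ?case
    proof (cases "n < L")
      case True
      then have "egf_coeff \<B> n \<le> K * 1"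
        using K(2) by simp
      also have "\<dots> \<le> K * C ^ n"
        using K(1) C1 by (intro mult_left_mono) auto
      finally show ?thesis .
    next
      case False
      define m where "m = n div L"
      have m0: "0 < m" and mn: "m \<le> n"
        using False L by (auto simp: m_def div_greater_zero_iff)
      have "n < L * (m + 1)"
        using L by (simp add: m_def dividend_less_times_div)
      also have "\<dots> \<le> L * (2 * m)"
        using m0 by (intro mult_le_mono2) simp
      finally have "D * n \<le> D * (2 * L) * m"
        using mult_le_mono2[of n "L * (2 * m)" D] by (simp add: mult_ac)
      then have pow: "(2 :: real) ^ (D * n) \<le> C ^ m"
        unfolding C_def power_mult[symmetric] by (intro power_increasing) auto
      have "egf_coeff \<B> n \<le> 2 ^ (D * n) * egf_coeff \<B> (n - m)"
        using rec[of n m] False by (simp add: m_def)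
      also have "\<dots> \<le> C ^ m * (K * C ^ (n - m))"
        using pow less.IH[of "n - m"] m0 mn C1 by (intro mult_mono) auto
      also have "\<dots> = K * C ^ n"
        using mn by (simp add: mult.left_commute flip: power_add)
      finally show ?thesis .
    qed
  qed
  have "summable (\<lambda>n. egf_coeff \<B> n * (1 / (2 * C)) ^ n)"
  proof (rule summable_comparison_test)
    have "norm (egf_coeff \<B> n * (1 / (2 * C)) ^ n) \<le> K * (1 / 2) ^ n" for n
    proof -
      have "norm (egf_coeff \<B> n * (1 / (2 * C)) ^ n) = egf_coeff \<B> n * (1 / (2 * C)) ^ n"
        using C1 by (simp add: abs_mult)
      also have "\<dots> \<le> K * C ^ n * (1 / (2 * C)) ^ n"
        using C1 by (intro mult_right_mono bound) auto
      also have "\<dots> = K * (1 / 2) ^ n"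
        using C1 by (simp add: power_divide power_mult_distrib)
      finally show ?thesis .
    qed
    then show "\<exists>N. \<forall>n\<ge>N. norm (egf_coeff \<B> n * (1 / (2 * C)) ^ n) \<le> K * (1 / 2) ^ n"
      by blast
    show "summable (\<lambda>n. K * (1 / 2) ^ n)"
      by (intro summable_mult summable_geometric) auto
  qed
  then have "ereal (norm (1 / (2 * C))) \<le> egf_radius \<B>"
    unfolding egf_radius_eq by (rule conv_radius_geI)
  moreover have "0 < ereal (norm (1 / (2 * C)))"
    using C1 by simp
  ultimately show ?thesis
    by (rule less_le_trans[rotated])
qed

end

section \<open>Graphs embeddable in surfaces\<close>

lemma embeds_in_relabel:
  assumes emb: "embeds_in G S" and G: "simple_graph G" and f: "inj_on f (fst G)"
  shows "embeds_in (relabel f G) S"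
proof -
  obtain p \<gamma> where p: "p ` fst G \<subseteq> topspace S" "inj_on p (fst G)"
    and \<gamma>: "\<forall>e\<in>snd G. pathin S (\<gamma> e) \<and> inj_on (\<gamma> e) {0..1} \<and> {\<gamma> e 0, \<gamma> e 1} = p ` e \<and>
      \<gamma> e ` {0<..<1} \<inter> p ` fst G = {}"
    and disj: "\<forall>e\<in>snd G. \<forall>e'\<in>snd G. e \<noteq> e' \<longrightarrow> \<gamma> e ` {0<..<1} \<inter> \<gamma> e' ` {0<..<1} = {}"
    using emb unfolding embeds_in_def by (elim exE conjE) (rule that; assumption)
  define k where "k = inv_into (fst G) f"
  have kf: "k ` f ` A = A" if "A \<subseteq> fst G" for A
    using that unfolding k_def by (rule inv_into_image_cancel[OF f])
  have k_edge: "k ` f ` e = e" if "e \<in> snd G" for e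
    using kf simple_graph_edge(1)[OF G that] by blast
  have img: "(p \<circ> k) ` f ` A = p ` A" if "A \<subseteq> fst G" for A
    using kf[OF that] by (simp only: image_comp[symmetric])
  have img_edge: "(p \<circ> k) ` f ` e = p ` e" if "e \<in> snd G" for e
    using img simple_graph_edge(1)[OF G that] by blast
  show ?thesis
    unfolding embeds_in_def
  proof (intro exI[of _ "p \<circ> k"] exI[of _ "\<lambda>e. \<gamma> (k ` e)"] conjI)
    show "(p \<circ> k) ` fst (relabel f G) \<subseteq> topspace S"
      using p(1) img[of "fst G"] by simp
    have "inj_on k (f ` fst G)" "k ` f ` fst G = fst G"
      unfolding k_def using kf by (auto simp: k_def intro: inj_on_inv_into)
    then show "inj_on (p \<circ> k) (fst (relabel f G))"
      using p(2) by (simp add: comp_inj_on)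
    show "\<forall>e\<in>snd (relabel f G). pathin S (\<gamma> (k ` e)) \<and> inj_on (\<gamma> (k ` e)) {0..1} \<and>
        {\<gamma> (k ` e) 0, \<gamma> (k ` e) 1} = (p \<circ> k) ` e \<and>
        \<gamma> (k ` e) ` {0<..<1} \<inter> (p \<circ> k) ` fst (relabel f G) = {}"
    proof
      fix d assume "d \<in> snd (relabel f G)"
      then obtain e where e: "e \<in> snd G" "d = f ` e"
        by auto
      show "pathin S (\<gamma> (k ` d)) \<and> inj_on (\<gamma> (k ` d)) {0..1} \<and>
        {\<gamma> (k ` d) 0, \<gamma> (k ` d) 1} = (p \<circ> k) ` d \<and>
        \<gamma> (k ` d) ` {0<..<1} \<inter> (p \<circ> k) ` fst (relabel f G) = {}"
        unfolding e(2) fst_relabel k_edge[OF e(1)] img_edge[OF e(1)] img[OF subset_refl]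
        using \<gamma> e(1) by (rule bspec)
    qed
    show "\<forall>e\<in>snd (relabel f G). \<forall>e'\<in>snd (relabel f G). e \<noteq> e' \<longrightarrow>
        \<gamma> (k ` e) ` {0<..<1} \<inter> \<gamma> (k ` e') ` {0<..<1} = {}"
    proof (intro ballI impI)
      fix d d' assume "d \<in> snd (relabel f G)" "d' \<in> snd (relabel f G)" and ne: "d \<noteq> d'"
      then obtain e e' where e: "e \<in> snd G" "d = f ` e" "e' \<in> snd G" "d' = f ` e'"
        by auto
      have "e \<noteq> e'"
        using e ne by blast
      then show "\<gamma> (k ` d) ` {0<..<1} \<inter> \<gamma> (k ` d') ` {0<..<1} = {}"
        unfolding e(2,4) k_edge[OF e(1)] k_edge[OF e(3)] using disj e(1,3) by blast
    qed
  qed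
qed

lemma embeds_in_delete_edge:
  assumes "embeds_in (V, E) S"
  shows "embeds_in (V, E - {e}) S"
proof -
  obtain p \<gamma> where p: "p ` V \<subseteq> topspace S" "inj_on p V"
    and \<gamma>: "\<forall>e\<in>E. pathin S (\<gamma> e) \<and> inj_on (\<gamma> e) {0..1} \<and> {\<gamma> e 0, \<gamma> e 1} = p ` e \<and>
      \<gamma> e ` {0<..<1} \<inter> p ` V = {}"
    and disj: "\<forall>e\<in>E. \<forall>e'\<in>E. e \<noteq> e' \<longrightarrow> \<gamma> e ` {0<..<1} \<inter> \<gamma> e' ` {0<..<1} = {}"
    using assms unfolding embeds_in_def fst_conv snd_conv by (elim exE conjE) (rule that; assumption)
  show ?thesis
    unfolding embeds_in_def fst_conv snd_conv
  proof (intro exI[of _ p] exI[of _ \<gamma>] conjI)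
    show "\<forall>e\<in>E - {e}. pathin S (\<gamma> e) \<and> inj_on (\<gamma> e) {0..1} \<and> {\<gamma> e 0, \<gamma> e 1} = p ` e \<and>
        \<gamma> e ` {0<..<1} \<inter> p ` V = {}"
      using \<gamma> by (intro ballI) simp
    show "\<forall>d\<in>E - {e}. \<forall>e'\<in>E - {e}. d \<noteq> e' \<longrightarrow> \<gamma> d ` {0<..<1} \<inter> \<gamma> e' ` {0<..<1} = {}"
      using disj by (intro ballI) simp
  qed (use p in auto)
qed

section \<open>The sphere as a surface of Euler genus zero\<close>

lemma embeds_in_singleton:
  assumes "P \<in> topspace S"
  shows "embeds_in ({x}, {}) S"
  unfolding embeds_in_def using assms by (intro exI[of _ "\<lambda>_. P"]) simp

text \<open>It has Euler genus 0 in both families, so it witnesses that one-vertex graphs belong to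
  each class whatever \<open>g\<close> is.\<close>

definition unit_sphere :: "(complex \<times> real) topology" where
  "unit_sphere = top_of_set (sphere 0 1)"

text \<open>Stereographic projection ends in a hyperplane of \<open>complex \<times> real\<close>;
  this identifies it with the model space of the charts.\<close>

lemma hyperplane_homeomorphic_complex:
  "{z :: complex \<times> real. (0, 1) \<bullet> z = 0} homeomorphic (UNIV :: complex set)"
  unfolding homeomorphic_def homeomorphism_def
  by (intro exI[of _ fst] exI[of _ "\<lambda>w. (w, 0)"])
    (auto simp: inner_prod_def image_iff intro!: continuous_intros)

lemma closed_surface_unit_sphere: "closed_surface unit_sphere"
  unfolding closed_surface_def
proof (intro conjI ballI)
  show "compact_space unit_sphere"
    unfolding unit_sphere_def by (simp add: compact_space_subtopology)
  have "connected (sphere (0 :: complex \<times> real) 1)"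
    by (rule connected_sphere) simp
  then have "connectedin euclidean (sphere (0 :: complex \<times> real) 1)"
    by simp
  then show "connected_space unit_sphere"
    unfolding unit_sphere_def connectedin_def by blast
  show "Hausdorff_space unit_sphere"
    unfolding unit_sphere_def by (intro Hausdorff_space_subtopology) simp
  fix x assume x: "x \<in> topspace unit_sphere"
  \<comment> \<open>The chart at \<open>x\<close> is the sphere punctured at the antipode.\<close>
  define U where "U = sphere 0 1 - {- x}"
  have U: "U \<subseteq> sphere 0 1"
    by (auto simp: U_def)
  have xs: "x \<in> sphere 0 1"
    using x by (simp add: unit_sphere_def)
  moreover have "x = 0" if "x = - x"
    using that by (cases x) (auto simp: complex_eq_iff zero_prod_def)
  ultimately have "- x \<in> sphere 0 1" "x \<noteq> - x"
    by auto
  then have "U homeomorphic {z :: complex \<times> real. (0, 1) \<bullet> z = 0}"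
    unfolding U_def by (intro homeomorphic_punctured_sphere_hyperplane) (auto simp: zero_prod_def)
  then have "U homeomorphic (UNIV :: complex set)"
    using hyperplane_homeomorphic_complex homeomorphic_trans by blast
  then obtain f :: "complex \<times> real \<Rightarrow> complex" and h where "homeomorphism U UNIV f h"
    unfolding homeomorphic_def by blast
  then have "homeomorphic_maps (top_of_set U) (euclidean :: complex topology) f h"
    unfolding homeomorphism_def homeomorphic_maps_def by (auto simp: continuous_map_in_subtopology)
  then have "top_of_set U homeomorphic_space (euclidean :: complex topology)"
    unfolding homeomorphic_space_def by blast
  moreover have "subtopology unit_sphere U = top_of_set U"
    using U by (simp add: unit_sphere_def subtopology_subtopology Int_absorb1)
  moreover have "openin unit_sphere U"
    unfolding unit_sphere_def U_def by (intro openin_delete) simp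
  moreover have "x \<in> U"
    using xs \<open>x \<noteq> - x\<close> by (simp add: U_def)
  ultimately show "\<exists>U. openin unit_sphere U \<and> x \<in> U \<and>
      subtopology unit_sphere U homeomorphic_space (euclidean :: complex topology)"
    by (intro exI[of _ U] conjI) simp_all
qed

lemma orientable_unit_sphere: "orientable_surface 0 unit_sphere"
proof -
  have "sphere_with_handles 0 unit_sphere"
    unfolding sphere_with_handles_def
  proof (intro exI[of _ id] conjI)
    show "quotient_map (top_of_set (handle_domain 0)) unit_sphere id"
      using homeomorphic_map_id[of unit_sphere unit_sphere]
      by (simp add: handle_domain_def unit_sphere_def homeomorphic_map_def)
  qed (simp add: handle_glued_def)
  then show ?thesis
    using closed_surface_unit_sphere by (simp add: orientable_surface_def)
qed

lemma nonorientable_unit_sphere: "nonorientable_surface 0 unit_sphere"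
proof -
  have "sphere_with_crosscaps 0 unit_sphere"
    unfolding sphere_with_crosscaps_def
  proof (intro exI[of _ id] conjI)
    show "quotient_map (top_of_set (crosscap_domain 0)) unit_sphere id"
      using homeomorphic_map_id[of unit_sphere unit_sphere]
      by (simp add: crosscap_domain_def unit_sphere_def homeomorphic_map_def)
  qed (simp add: crosscap_glued_def)
  then show ?thesis
    using closed_surface_unit_sphere by (simp add: nonorientable_surface_def)
qed

text \<open>The predicate \<open>\<S>\<close> selects the admissible surfaces of each Euler genus,
  so that three of the classes are handled at once. The intersection is treated separately, as its
  two conditions may use different surfaces.\<close>

definition surface_class :: "(nat \<Rightarrow> (complex \<times> real) topology \<Rightarrow> bool) \<Rightarrow> (nat \<Rightarrow> nat) \<Rightarrow> nat graph set" where
  "surface_class \<S> g = {G. simple_graph G \<and> (\<exists>eg\<le>g (num_vertices G). \<exists>S. \<S> eg S \<and> embeds_in G S)}"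

lemma OE_class_eq: "OE_class g = surface_class orientable_surface g"
  and NE_class_eq: "NE_class g = surface_class nonorientable_surface g"
  and E_class_eq: "E_class g = surface_class (\<lambda>eg S. orientable_surface eg S \<or> nonorientable_surface eg S) g"
  by (simp_all add: OE_class_def NE_class_def E_class_def surface_class_def)

text \<open>A leaf is added on the same surface; the number of vertices grows, and monotonicity of
  \<open>g\<close> keeps the surface admissible.\<close>

lemma leaf_extendable_surface_class:
  assumes closed: "\<And>eg S. \<S> eg S \<Longrightarrow> closed_surface S" and sphere: "\<S> 0 unit_sphere"
    and g: "mono_on {1..} g"
  shows "leaf_extendable (surface_class \<S> g)"
proof
  fix G and f :: "nat \<Rightarrow> nat" assume G: "G \<in> surface_class \<S> g" "simple_graph G" "inj_on f (fst G)"
  then obtain eg S where S: "eg \<le> g (num_vertices G)" "\<S> eg S" "embeds_in G S"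
    by (auto simp: surface_class_def)
  moreover have "num_vertices (relabel f G) = num_vertices G"
    using G(3) by (simp add: num_vertices_def card_image)
  moreover have "embeds_in (relabel f G) S"
    using embeds_in_relabel S(3) G(2,3) by blast
  ultimately have "eg \<le> g (num_vertices (relabel f G)) \<and> \<S> eg S \<and> embeds_in (relabel f G) S"
    by simp
  then show "relabel f G \<in> surface_class \<S> g"
    using simple_graph_relabel[OF G(2,3)] unfolding surface_class_def by blast
next
  fix V :: "nat set" and E and v x :: nat
  assume VE: "(V, E) \<in> surface_class \<S> g" "simple_graph (V, E)" "v \<in> V" "x \<notin> V"
  then obtain eg S where S: "eg \<le> g (card V)" "\<S> eg S" "embeds_in (V, E) S"
    by (auto simp: surface_class_def num_vertices_def)
  have V: "finite V" "E \<subseteq> {e. e \<subseteq> V \<and> card e = 2}"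
    using VE(2) by (auto simp: simple_graph_def)
  have "embeds_in (insert x V, insert {x, v} E) S"
    using embeds_in_add_leaf[OF closed[OF S(2)] S(3) V VE(3,4)] .
  \<comment> \<open>Monotonicity of \<open>g\<close> is given on positive arguments.\<close>
  moreover have "card V > 0"
    using V(1) VE(3) by (auto simp: card_gt_0_iff)
  then have "g (card V) \<le> g (card (insert x V))"
    using V(1) VE(4) by (intro mono_onD[OF g]) auto
  then have "eg \<le> g (num_vertices (insert x V, insert {x, v} E))"
    using S(1) by (simp add: num_vertices_def)
  moreover have "card {x, v} = 2"
    using VE(3,4) by (simp add: card_2_iff) blast
  then have "simple_graph (insert x V, insert {x, v} E)"
    using V VE(3) by (auto simp: simple_graph_def)
  ultimately show "(insert x V, insert {x, v} E) \<in> surface_class \<S> g"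
    using S(2) unfolding surface_class_def by blast
next
  fix V :: "nat set" and E e assume "(V, E) \<in> surface_class \<S> g"
  then obtain eg S where S: "simple_graph (V, E)" "eg \<le> g (card V)" "\<S> eg S" "embeds_in (V, E) S"
    by (auto simp: surface_class_def num_vertices_def)
  then have "simple_graph (V, E - {e})"
    by (auto simp: simple_graph_def)
  then show "(V, E - {e}) \<in> surface_class \<S> g"
    using S(2,3) embeds_in_delete_edge[OF S(4)] unfolding surface_class_def num_vertices_def by auto
next
  fix x :: nat
  have "(0, 1) \<in> topspace unit_sphere"
    by (simp add: unit_sphere_def dist_norm norm_Pair)
  then have "embeds_in ({x}, {}) unit_sphere"
    by (rule embeds_in_singleton)
  then show "({x}, {}) \<in> surface_class \<S> g"
    using sphere unfolding surface_class_def simple_graph_def by auto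
qed

section \<open>The class of all graphs\<close>

lemma graph_class_all: "graph_class {G :: nat graph. simple_graph G}"
proof
  show "relabel f G \<in> {G. simple_graph G}" if "G \<in> {G. simple_graph G}" "inj_on f (fst G)" for G :: "nat graph" and f
    using that simple_graph_relabel by simp
  show "H \<in> {G. simple_graph G}" if "G \<in> {G. simple_graph G}" "minor_step G H" for G H :: "nat graph"
    using that minor_step_simple_graph by simp
qed simp

lemma card_labelled_all:
  assumes "0 < n"
  shows "card (labelled {G. simple_graph G} n) = 2 ^ (n choose 2)"
proof -
  have "G \<in> labelled {G. simple_graph G} n \<longleftrightarrow> fst G = {1..n} \<and> snd G \<in> Pow (complete_edges {1..n})" for G
    unfolding labelled_def simple_graph_def complete_edges_def
    using assms by (cases "fst G = {1..n}") simp_all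
  then have "labelled {G. simple_graph G} n = {{1..n}} \<times> Pow (complete_edges {1..n})"
    by (intro set_eqI) (simp add: mem_Times_iff)
  moreover have "card (complete_edges {1..n}) = n choose 2"
    unfolding complete_edges_def by (simp add: n_subsets)
  ultimately show ?thesis
    by (simp add: card_cartesian_product card_Pow finite_complete_edges)
qed

text \<open>Graphs with a leaf number at most \<open>Suc n * n\<close> times all graphs on
  \<open>n\<close> vertices, and one more vertex multiplies the number of graphs by
  \<open>2 ^ n\<close>.\<close>

lemma random_graph_no_leaves:
  assumes "0 < n"
  shows "1 - real (Suc n * n) / 2 ^ n \<le>
    measure_pmf.prob (pmf_of_set (labelled {G. simple_graph G} (Suc n))) {R. num_leaves R = 0}"
proof -
  interpret graph_class "{G. simple_graph G}"
    by (rule graph_class_all)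
  define A where "A = labelled {G :: nat graph. simple_graph G} (Suc n)"
  define L where "L = {G \<in> A. 1 \<le> num_leaves G}"
  have finA: "finite A"
    unfolding A_def by (rule finite_labelled)
  have "Suc n choose 2 = n + (n choose 2)"
    by (simp add: numeral_2_eq_2)
  then have cardA: "card A = 2 ^ n * 2 ^ (n choose 2)"
    using card_labelled_all[of "Suc n"] by (simp add: A_def power_add)
  then have neA: "A \<noteq> {}"
    by auto
  \<comment> \<open>For \<open>k = 1\<close> the truncated difference \<open>k - 2\<close> is 0, so
    the right-hand side of the deletion count ranges over all graphs on \<open>n\<close>
    vertices.\<close>
  have "card L \<le> Suc n * n * 2 ^ (n choose 2)"
    using leaf_deletion_count[of 1 n] card_labelled_all[OF assms] by (simp add: L_def A_def)
  then have "real (card L) \<le> real (Suc n * n * 2 ^ (n choose 2))"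
    by (rule of_nat_mono)
  then have L: "real (card L) \<le> real (Suc n * n) * 2 ^ (n choose 2)"
    by (simp only: of_nat_mult of_nat_power of_nat_numeral)
  have "A \<inter> {R. num_leaves R = 0} = A - L"
    by (auto simp: L_def)
  then have "measure_pmf.prob (pmf_of_set A) {R. num_leaves R = 0} = real (card (A - L)) / real (card A)"
    using measure_pmf_of_set[OF neA finA] by simp
  also have "card (A - L) = card A - card L"
    using finA by (intro card_Diff_subset) (auto simp: L_def)
  also have "real (card A - card L) / real (card A) = 1 - real (card L) / real (card A)"
    using finA neA card_mono[of A L] by (simp add: L_def of_nat_diff diff_divide_distrib card_gt_0_iff)
  finally have "measure_pmf.prob (pmf_of_set A) {R. num_leaves R = 0} = 1 - real (card L) / real (card A)" .
  moreover have "real (card L) / real (card A) \<le> real (Suc n * n) * 2 ^ (n choose 2) / real (card A)"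
    using L by (intro divide_right_mono) auto
  moreover have "real (Suc n * n) * 2 ^ (n choose 2) / real (card A) = real (Suc n * n) / 2 ^ n"
    by (simp add: cardA)
  ultimately show ?thesis
    unfolding A_def by linarith
qed

theorem theorem38:
  fixes g :: "nat \<Rightarrow> nat" and \<A> \<B> :: "nat graph set"
  assumes "mono_on {1..} g"
    and "\<A> \<in> {E_class g, OE_class g, NE_class g, OE_class g \<inter> NE_class g}"
    and "\<B> = Minor_class \<A>"
  shows "({G. simple_graph G} \<subseteq> \<A> \<longrightarrow>
            (\<exists>c::real. c > 0 \<and>
               (\<forall>\<^sub>F n in sequentially.
                  measure_pmf.prob (pmf_of_set (labelled \<B> n)) {R. num_leaves R = 0}
                    \<ge> 1 - exp (- (c * real n)))))
       \<and> (\<not> {G. simple_graph G} \<subseteq> \<A> \<longrightarrow>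
            (\<forall>\<epsilon>::real. 0 < \<epsilon> \<and> \<epsilon> < 1 \<longrightarrow>
               egf_radius {G \<in> \<B>. ereal (real (num_leaves G)) \<notin>
                   {ereal (1 - \<epsilon>) * egf_radius \<B> * ereal (real (num_vertices G)) <..<
                    ereal (1 + \<epsilon>) * egf_radius \<B> * ereal (real (num_vertices G))}}
                 > egf_radius \<B>))"
proof (intro conjI impI allI)
  assume all: "{G. simple_graph G} \<subseteq> \<A>"
  have "\<B> = {G. simple_graph G}"
    using all is_minor_simple_graph unfolding assms(3) Minor_class_def by blast
  \<comment> \<open>The base \<open>3 / 4\<close> exceeds \<open>1 / 2\<close>, which absorbs the
    quadratic factor, and is at most \<open>exp (- 1 / 4)\<close> by
    \<open>1 + x \<le> exp x\<close>, whence the constant \<open>c = 1 / 4\<close>.\<close>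
  moreover have "\<forall>\<^sub>F n in sequentially. (real n + 1) * real n / 2 ^ n \<le> (3 / 4) ^ Suc n"
  proof -
    have "\<forall>\<^sub>F n in sequentially. (real n + 1) * real n \<le> 3 / 4 * (3 / 2) ^ n"
      by real_asymp
    then show ?thesis
    proof eventually_elim
      case (elim n)
      have "(real n + 1) * real n / 2 ^ n \<le> 3 / 4 * (3 / 2) ^ n / 2 ^ n"
        using elim by (intro divide_right_mono) auto
      also have "\<dots> = 3 / 4 * (3 / 2 / 2) ^ n"
        by (simp only: power_divide[of "3 / 2" 2] times_divide_eq_right)
      finally show ?case
        by simp
    qed
  qed
  then have "\<forall>\<^sub>F n in sequentially. 1 - exp (- (1 / 4 * real (Suc n))) \<le>
      measure_pmf.prob (pmf_of_set (labelled {G. simple_graph G} (Suc n))) {R. num_leaves R = 0}"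
    using eventually_gt_at_top[of 0]
  proof eventually_elim
    case (elim n)
    have "(3 / 4 :: real) ^ Suc n \<le> exp (- (1 / 4)) ^ Suc n"
      using exp_ge_add_one_self[of "- (1 / 4)"] by (intro power_mono) auto
    also have "\<dots> = exp (- (1 / 4 * real (Suc n)))"
      by (subst exp_of_nat_mult[symmetric]) (simp add: mult.commute)
    finally have "(3 / 4 :: real) ^ Suc n \<le> exp (- (1 / 4 * real (Suc n)))" .
    moreover have "real (Suc n * n) = (real n + 1) * real n"
      by (simp add: algebra_simps)
    with elim(1) have "real (Suc n * n) / 2 ^ n \<le> (3 / 4) ^ Suc n"
      by (simp only:)
    ultimately show ?case
      using random_graph_no_leaves[OF elim(2)] by (meson diff_left_mono order_trans)
  qed
  then have "\<forall>\<^sub>F n in sequentially. 1 - exp (- (1 / 4 * real n)) \<le>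
      measure_pmf.prob (pmf_of_set (labelled {G. simple_graph G} n)) {R. num_leaves R = 0}"
    by (subst eventually_sequentially_Suc[symmetric])
  ultimately show "\<exists>c::real. c > 0 \<and> (\<forall>\<^sub>F n in sequentially.
      measure_pmf.prob (pmf_of_set (labelled \<B> n)) {R. num_leaves R = 0} \<ge> 1 - exp (- (c * real n)))"
    by (intro exI[of _ "1 / 4"]) simp
next
  fix \<epsilon> :: real
  assume not_all: "\<not> {G. simple_graph G} \<subseteq> \<A>" and \<epsilon>: "0 < \<epsilon> \<and> \<epsilon> < 1"
  have "leaf_extendable (E_class g)" "leaf_extendable (OE_class g)" "leaf_extendable (NE_class g)"
    unfolding E_class_eq OE_class_eq NE_class_eq using orientable_unit_sphere nonorientable_unit_sphere
    by (auto intro!: leaf_extendable_surface_class assms(1)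
        simp: orientable_surface_def nonorientable_surface_def)
  then have "leaf_extendable \<A>"
    using assms(2) leaf_extendable_Int by auto
  then interpret leaf_closed_class \<B>
    unfolding assms(3) by (rule leaf_extendable.leaf_closed_class_Minor_class)
  obtain H where "simple_graph H" "H \<notin> \<A>"
    using not_all by blast
  moreover have "\<B> \<subseteq> \<A>"
    unfolding assms(3) by (auto simp: Minor_class_def)
  ultimately have "0 < egf_radius \<B>"
    using egf_radius_pos by blast
  \<comment> \<open>Positivity comes from the graph outside \<open>\<A>\<close>, finiteness from
    closure under adding leaves; with a real radius the extended-real interval becomes two real
    inequalities.\<close>
  then obtain r where r: "egf_radius \<B> = ereal r" "0 < r"
    using egf_radius_finite by (cases "egf_radius \<B>") auto
  show "egf_radius {G \<in> \<B>. ereal (real (num_leaves G)) \<notin>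
         {ereal (1 - \<epsilon>) * egf_radius \<B> * ereal (real (num_vertices G)) <..<
          ereal (1 + \<epsilon>) * egf_radius \<B> * ereal (real (num_vertices G))}} > egf_radius \<B>"
    using atypical_leaves_radius[OF r] \<epsilon> by (simp add: r(1) de_Morgan_conj not_less)
qed

end
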